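(* Let $R$ be a commutative noetherian ring, let $\mathfrak{a}$ be a proper ideal of $R$, let $\mathfrak{b}$ be an ideal of $R$, and let $X$ be an arbitrary non-zero $R$-module (not necessarily finitely generated). Then: (i) $H^{\mathrm{ara}(\mathfrak{a})+\mathrm{cd}(\mathfrak{b},X)}_{\mathfrak{a}+\mathfrak{b}}(X)\cong H^{\mathrm{ara}(\mathfrak{a})}_{\mathfrak{a}}\bigl(H^{\mathrm{cd}(\mathfrak{b},X)}_{\mathfrak{b}}(X)\bigr)$. (ii) The following statements are equivalent: (a) $\mathrm{cd}(\mathfrak{a}+\mathfrak{b},X)=\mathrm{ara}(\mathfrak{a})+\mathrm{cd}(\mathfrak{b},X)$; (b) $\mathrm{ara}(\mathfrak{a})=\mathrm{cd}\bigl(\mathfrak{a},H^{\mathrm{cd}(\mathfrak{b},X)}_{\mathfrak{b}}(X)\bigr)$.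
   Context: $H^i_{\mathfrak{a}}$ denotes the $i$th local cohomology functor, i.e. the $i$th right derived functor of the $\mathfrak{a}$-torsion functor $\Gamma_{\mathfrak{a}}$. For an ideal $\mathfrak{a}$ of $R$ and an $R$-module $X$, $\mathrm{cd}(\mathfrak{a},X):=\sup\{i : H^i_{\mathfrak{a}}(X)\neq 0\}$, the supremum being taken in the non-negative integers, so that $\mathrm{cd}(\mathfrak{a},X)=0$ if all $H^i_{\mathfrak{a}}(X)$ vanish. $\mathrm{ara}(\mathfrak{a})$ (arithmetic rank) is the least integer $n\ge 0$ such that there are $x_1,\dots,x_n\in R$ with $\sqrt{\mathfrak{a}}=\sqrt{(x_1,\dots,x_n)}$. *)

theory Defs
  imports "HOL-Algebra.QuotRing" "HOL-Algebra.Module" "HOL-Algebra.Ideal_Product"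
    "HOL-Algebra.Ring_Divisibility"
begin

section \<open>Modules\<close>

definition mod_hom ::
  "('a, 'r) ring_scheme \<Rightarrow> ('a, 'b, 'm) module_scheme \<Rightarrow> ('a, 'c, 'n) module_scheme \<Rightarrow> ('b \<Rightarrow> 'c) set"
  where "mod_hom R M N =
    {f \<in> carrier M \<rightarrow> carrier N.
      (\<forall>x \<in> carrier M. \<forall>y \<in> carrier M. f (x \<oplus>\<^bsub>M\<^esub> y) = f x \<oplus>\<^bsub>N\<^esub> f y) \<and>
      (\<forall>r \<in> carrier R. \<forall>x \<in> carrier M. f (r \<odot>\<^bsub>M\<^esub> x) = r \<odot>\<^bsub>N\<^esub> f x)}"

definition mod_iso ::
  "('a, 'r) ring_scheme \<Rightarrow> ('a, 'b, 'm) module_scheme \<Rightarrow> ('a, 'c, 'n) module_scheme \<Rightarrow> bool"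
  where "mod_iso R M N \<longleftrightarrow> (\<exists>f \<in> mod_hom R M N. bij_betw f (carrier M) (carrier N))"

text \<open>
  The record type of modules extends that of rings, so a module carries \<^const>\<open>monoid.mult\<close> and
  \<^const>\<open>monoid.one\<close> fields which have no meaning; the quotient just inherits them from
  \<^const>\<open>FactRing\<close>.
\<close>

definition quot_module :: "('a, 'b, 'm) module_scheme \<Rightarrow> 'b set \<Rightarrow> ('a, 'b set) module"
  where "quot_module M H =
    \<lparr>carrier = a_rcosets\<^bsub>M\<^esub> H, monoid.mult = rcoset_mult M H, monoid.one = H +>\<^bsub>M\<^esub> \<one>\<^bsub>M\<^esub>,
     ring.zero = H, ring.add = set_add M, smult = (\<lambda>r A. \<Union>x\<in>A. H +>\<^bsub>M\<^esub> (r \<odot>\<^bsub>M\<^esub> x))\<rparr>"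


section \<open>Injective modules and injective resolutions\<close>

text \<open>
  The test modules \<^term>\<open>A\<close> and \<^term>\<open>B\<close> have to live on some fixed type; here it is the type
  \<^typ>\<open>'c\<close> carrying \<^term>\<open>E\<close> itself.  So this is injectivity in the category of modules carried
  by \<^typ>\<open>'c\<close>.  As soon as the elements of the ring embed into \<^typ>\<open>'c\<close>, this is injectivity
  among the modules of all types: see \<open>injective_module_extend\<close> below.
\<close>

definition injective_module ::
  "('a, 'r) ring_scheme \<Rightarrow> ('a, 'c) module \<Rightarrow> bool"
  where "injective_module R E \<longleftrightarrow> module R E \<and>
    (\<forall>(A :: ('a, 'c) module) (B :: ('a, 'c) module) i f.
       module R A \<longrightarrow> module R B \<longrightarrow>
       i \<in> mod_hom R A B \<longrightarrow> inj_on i (carrier A) \<longrightarrow> f \<in> mod_hom R A E \<longrightarrow>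
       (\<exists>g \<in> mod_hom R B E. \<forall>x \<in> carrier A. g (i x) = f x))"

lemma baer_extend:
  fixes R (structure)
    and A :: "('a, 'x, 'm) module_scheme" and B :: "('a, 'y, 'n) module_scheme"
    and E :: "('a, 'c, 'k) module_scheme"
  assumes E: "module R E"
    and baer: "\<And>I h. ideal I R \<Longrightarrow> h \<in> I \<rightarrow> carrier E \<Longrightarrow>
        (\<And>r s. r \<in> I \<Longrightarrow> s \<in> I \<Longrightarrow> h (r \<oplus> s) = h r \<oplus>\<^bsub>E\<^esub> h s) \<Longrightarrow>
        (\<And>r s. r \<in> carrier R \<Longrightarrow> s \<in> I \<Longrightarrow> h (r \<otimes> s) = r \<odot>\<^bsub>E\<^esub> h s) \<Longrightarrow>
        \<exists>e \<in> carrier E. \<forall>r \<in> I. h r = r \<odot>\<^bsub>E\<^esub> e"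
    and A: "module R A" and B: "module R B"
    and i: "i \<in> mod_hom R A B" "inj_on i (carrier A)" and f: "f \<in> mod_hom R A E"
  shows "\<exists>g \<in> mod_hom R B E. \<forall>x \<in> carrier A. g (i x) = f x"
proof -
  interpret E: module R E by (rule E)
  interpret A: module R A by (rule A)
  interpret B: module R B by (rule B)
  have ic: "i x \<in> carrier B" and fc: "f x \<in> carrier E" if "x \<in> carrier A" for x
    using i f that by (auto simp: mod_hom_def)
  have ia: "i (x \<oplus>\<^bsub>A\<^esub> y) = i x \<oplus>\<^bsub>B\<^esub> i y" and fa: "f (x \<oplus>\<^bsub>A\<^esub> y) = f x \<oplus>\<^bsub>E\<^esub> f y"
    if "x \<in> carrier A" "y \<in> carrier A" for x y
    using i f that by (auto simp: mod_hom_def)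
  have im: "i (r \<odot>\<^bsub>A\<^esub> x) = r \<odot>\<^bsub>B\<^esub> i x" and fm: "f (r \<odot>\<^bsub>A\<^esub> x) = r \<odot>\<^bsub>E\<^esub> f x"
    if "r \<in> carrier R" "x \<in> carrier A" for r x
    using i f that by (auto simp: mod_hom_def)
  define F where "F = (\<lambda>x. (i x, f x)) ` carrier A"
  define P where "P = {G. G \<subseteq> carrier B \<times> carrier E \<and> F \<subseteq> G \<and>
     (\<forall>x y x' y'. (x, y) \<in> G \<longrightarrow> (x', y') \<in> G \<longrightarrow> (x \<oplus>\<^bsub>B\<^esub> x', y \<oplus>\<^bsub>E\<^esub> y') \<in> G) \<and>
     (\<forall>r x y. r \<in> carrier R \<longrightarrow> (x, y) \<in> G \<longrightarrow> (r \<odot>\<^bsub>B\<^esub> x, r \<odot>\<^bsub>E\<^esub> y) \<in> G) \<and>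
     (\<forall>x y y'. (x, y) \<in> G \<longrightarrow> (x, y') \<in> G \<longrightarrow> y = y')}"
  have Pc: "G \<subseteq> carrier B \<times> carrier E" and PF: "F \<subseteq> G" if "G \<in> P" for G
    using that unfolding P_def mem_Collect_eq by simp_all
  have Pa: "(x \<oplus>\<^bsub>B\<^esub> x', y \<oplus>\<^bsub>E\<^esub> y') \<in> G" if "G \<in> P" "(x, y) \<in> G" "(x', y') \<in> G" for G x y x' y'
    using that by (simp add: P_def)
  have Pm: "(r \<odot>\<^bsub>B\<^esub> x, r \<odot>\<^bsub>E\<^esub> y) \<in> G" if "G \<in> P" "r \<in> carrier R" "(x, y) \<in> G" for G r x y
    using that by (simp add: P_def)
  have Ps: "y = y'" if "G \<in> P" "(x, y) \<in> G" "(x, y') \<in> G" for G x y y'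
    using that unfolding P_def mem_Collect_eq by meson
  have FP: "F \<in> P"
    unfolding P_def
  proof (intro CollectI conjI allI impI)
    show "F \<subseteq> carrier B \<times> carrier E" using ic fc by (auto simp: F_def)
    fix x y x' y' assume "(x, y) \<in> F" "(x', y') \<in> F"
    then obtain u v where "u \<in> carrier A" "v \<in> carrier A" "x = i u" "y = f u" "x' = i v" "y' = f v"
      by (auto simp: F_def)
    then show "(x \<oplus>\<^bsub>B\<^esub> x', y \<oplus>\<^bsub>E\<^esub> y') \<in> F"
      unfolding F_def by (intro image_eqI[of _ _ "u \<oplus>\<^bsub>A\<^esub> v"]) (simp_all add: ia fa)
  next
    fix r x y assume "r \<in> carrier R" "(x, y) \<in> F"
    then obtain u where "r \<in> carrier R" "u \<in> carrier A" "x = i u" "y = f u"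
      by (auto simp: F_def)
    then show "(r \<odot>\<^bsub>B\<^esub> x, r \<odot>\<^bsub>E\<^esub> y) \<in> F"
      unfolding F_def by (intro image_eqI[of _ _ "r \<odot>\<^bsub>A\<^esub> u"]) (simp_all add: im fm)
  next
    fix x y y' assume "(x, y) \<in> F" "(x, y') \<in> F"
    then show "y = y'" using i(2) by (auto simp: F_def inj_on_def)
  qed simp
  have chain: "\<Union>C \<in> P" if "C \<noteq> {}" and "subset.chain P C" for C
  proof -
    have CP: "G \<in> P" if "G \<in> C" for G
      using \<open>subset.chain P C\<close> that by (auto simp: subset.chain_def)
    have two: "\<exists>G \<in> C. p \<in> G \<and> q \<in> G" if "p \<in> \<Union>C" "q \<in> \<Union>C" for p q
    proof -
      obtain G H where GH: "G \<in> C" "H \<in> C" "p \<in> G" "q \<in> H" using \<open>p \<in> \<Union>C\<close> \<open>q \<in> \<Union>C\<close> by blast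
      have "G \<subseteq> H \<or> H \<subseteq> G"
        using \<open>subset.chain P C\<close> GH(1,2) unfolding subset_chain_def by blast
      then show ?thesis using GH by blast
    qed
    show ?thesis
      unfolding P_def
    proof (intro CollectI conjI allI impI)
      show "\<Union>C \<subseteq> carrier B \<times> carrier E" using CP Pc by blast
      show "F \<subseteq> \<Union>C" using CP PF \<open>C \<noteq> {}\<close> by blast
      fix x y x' y' assume "(x, y) \<in> \<Union>C" "(x', y') \<in> \<Union>C"
      then obtain G where "G \<in> C" "(x, y) \<in> G" "(x', y') \<in> G" using two by blast
      then show "(x \<oplus>\<^bsub>B\<^esub> x', y \<oplus>\<^bsub>E\<^esub> y') \<in> \<Union>C" using Pa[OF CP] by blast
    next
      fix r x y assume "r \<in> carrier R" "(x, y) \<in> \<Union>C"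
      then show "(r \<odot>\<^bsub>B\<^esub> x, r \<odot>\<^bsub>E\<^esub> y) \<in> \<Union>C" using Pm[OF CP] by blast
    next
      fix x y y' assume "(x, y) \<in> \<Union>C" "(x, y') \<in> \<Union>C"
      then obtain G where "G \<in> C" "(x, y) \<in> G" "(x, y') \<in> G" using two by blast
      then show "y = y'" using Ps[OF CP] by blast
    qed
  qed
  have "\<exists>M \<in> P. \<forall>X \<in> P. M \<subseteq> X \<longrightarrow> X = M"
    by (rule subset_Zorn_nonempty) (use FP chain in auto)
  then obtain G where G: "G \<in> P" and max: "\<And>X. X \<in> P \<Longrightarrow> G \<subseteq> X \<Longrightarrow> X = G" by blast
  note Gc = subsetD[OF Pc[OF G], THEN SigmaD1] subsetD[OF Pc[OF G], THEN SigmaD2]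
  note Ga = Pa[OF G] and Gm = Pm[OF G] and Gs = Ps[OF G] and GF = PF[OF G]
  have G0: "(\<zero>\<^bsub>B\<^esub>, \<zero>\<^bsub>E\<^esub>) \<in> G"
  proof -
    have "(i \<zero>\<^bsub>A\<^esub>, f \<zero>\<^bsub>A\<^esub>) \<in> G" using GF by (auto simp: F_def)
    from Gm[OF E.R.zero_closed this] show ?thesis using ic fc by simp
  qed
  have Gn: "(\<ominus>\<^bsub>B\<^esub> x, \<ominus>\<^bsub>E\<^esub> y) \<in> G" if "(x, y) \<in> G" for x y
  proof -
    have "((\<ominus> \<one>) \<odot>\<^bsub>B\<^esub> x, (\<ominus> \<one>) \<odot>\<^bsub>E\<^esub> y) \<in> G" using that by (intro Gm) auto
    then show ?thesis using Gc[OF that] by (simp add: B.smult_l_minus E.smult_l_minus)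
  qed
  have total: "\<exists>y. (b, y) \<in> G" if b: "b \<in> carrier B" for b
  proof -
    define I where "I = {r \<in> carrier R. \<exists>y. (r \<odot>\<^bsub>B\<^esub> b, y) \<in> G}"
    define h where "h r = (THE y. (r \<odot>\<^bsub>B\<^esub> b, y) \<in> G)" for r
    have h_eq: "h r = y" if "(r \<odot>\<^bsub>B\<^esub> b, y) \<in> G" for r y
      unfolding h_def using that Gs by blast
    have hG: "(r \<odot>\<^bsub>B\<^esub> b, h r) \<in> G" if "r \<in> I" for r
      using that h_eq by (auto simp: I_def)
    have II: "r \<in> I" if "r \<in> carrier R" "(r \<odot>\<^bsub>B\<^esub> b, y) \<in> G" for r y
      using that by (auto simp: I_def)
    have Ic: "r \<in> carrier R" if "r \<in> I" for r using that by (simp add: I_def)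
    have add: "((r \<oplus> s) \<odot>\<^bsub>B\<^esub> b, h r \<oplus>\<^bsub>E\<^esub> h s) \<in> G" if "r \<in> I" "s \<in> I" for r s
      using Ga[OF hG hG] that b Ic by (simp add: B.smult_l_distr)
    have mul: "((r \<otimes> s) \<odot>\<^bsub>B\<^esub> b, r \<odot>\<^bsub>E\<^esub> h s) \<in> G" if "r \<in> carrier R" "s \<in> I" for r s
      using Gm[OF that(1) hG[OF that(2)]] that b Ic by (simp add: B.smult_assoc1)
    have mulI: "r \<otimes> s \<in> I" if "r \<in> carrier R" "s \<in> I" for r s
      by (rule II[OF _ mul[OF that]]) (use that Ic in simp)
    have "ideal I R"
    proof (rule idealI[OF E.R.ring_axioms])
      show "subgroup I (add_monoid R)"
      proof (rule E.R.add.subgroupI)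
        show "I \<subseteq> carrier R" using Ic by blast
        have "\<zero> \<in> I" by (rule II[of _ "\<zero>\<^bsub>E\<^esub>"]) (use G0 b in auto)
        then show "I \<noteq> {}" by blast
        fix r assume r: "r \<in> I"
        have "(\<ominus> \<one>) \<otimes> r \<in> I" by (rule mulI) (use r in auto)
        then show "\<ominus> r \<in> I" using Ic[OF r] by (simp add: E.R.l_minus)
        fix s assume s: "s \<in> I"
        show "r \<oplus> s \<in> I" by (rule II[OF _ add[OF r s]]) (use Ic[OF r] Ic[OF s] in simp)
      qed
    next
      fix r x assume "r \<in> I" "x \<in> carrier R"
      then show "x \<otimes> r \<in> I" "r \<otimes> x \<in> I"
        using mulI[of x r] Ic E.R.m_comm by auto
    qed
    then have "\<exists>e \<in> carrier E. \<forall>r \<in> I. h r = r \<odot>\<^bsub>E\<^esub> e"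
    proof (rule baer)
      show "h \<in> I \<rightarrow> carrier E" using hG Gc by blast
      show "h (r \<oplus> s) = h r \<oplus>\<^bsub>E\<^esub> h s" if "r \<in> I" "s \<in> I" for r s
        by (rule h_eq) (rule add[OF that])
      show "h (r \<otimes> s) = r \<odot>\<^bsub>E\<^esub> h s" if "r \<in> carrier R" "s \<in> I" for r s
        by (rule h_eq) (rule mul[OF that])
    qed
    then obtain e where e: "e \<in> carrier E" and he: "\<And>r. r \<in> I \<Longrightarrow> h r = r \<odot>\<^bsub>E\<^esub> e" by blast
    define G' where "G' = {(x \<oplus>\<^bsub>B\<^esub> r \<odot>\<^bsub>B\<^esub> b, y \<oplus>\<^bsub>E\<^esub> r \<odot>\<^bsub>E\<^esub> e) | x y r. (x, y) \<in> G \<and> r \<in> carrier R}"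
    have G'I: "(x \<oplus>\<^bsub>B\<^esub> r \<odot>\<^bsub>B\<^esub> b, y \<oplus>\<^bsub>E\<^esub> r \<odot>\<^bsub>E\<^esub> e) \<in> G'" if "(x, y) \<in> G" "r \<in> carrier R" for x y r
      using that unfolding G'_def by blast
    have GG': "G \<subseteq> G'"
    proof (rule subrelI)
      fix x y assume "(x, y) \<in> G"
      from G'I[OF this E.R.zero_closed] show "(x, y) \<in> G'" using Gc[OF \<open>(x, y) \<in> G\<close>] b e by simp
    qed
    have "G' \<in> P"
      unfolding P_def
    proof (intro CollectI conjI allI impI)
      show "G' \<subseteq> carrier B \<times> carrier E" using Gc b e unfolding G'_def by auto
      show "F \<subseteq> G'" using GF GG' by blast
      fix x y x' y' assume "(x, y) \<in> G'" "(x', y') \<in> G'"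
      then obtain u v r u' v' r' where
        1: "(u, v) \<in> G" "r \<in> carrier R" "x = u \<oplus>\<^bsub>B\<^esub> r \<odot>\<^bsub>B\<^esub> b" "y = v \<oplus>\<^bsub>E\<^esub> r \<odot>\<^bsub>E\<^esub> e" and
        2: "(u', v') \<in> G" "r' \<in> carrier R" "x' = u' \<oplus>\<^bsub>B\<^esub> r' \<odot>\<^bsub>B\<^esub> b" "y' = v' \<oplus>\<^bsub>E\<^esub> r' \<odot>\<^bsub>E\<^esub> e"
        unfolding G'_def by blast
      have "((u \<oplus>\<^bsub>B\<^esub> u') \<oplus>\<^bsub>B\<^esub> (r \<oplus> r') \<odot>\<^bsub>B\<^esub> b, (v \<oplus>\<^bsub>E\<^esub> v') \<oplus>\<^bsub>E\<^esub> (r \<oplus> r') \<odot>\<^bsub>E\<^esub> e) \<in> G'"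
        using 1 2 by (intro G'I Ga) auto
      then show "(x \<oplus>\<^bsub>B\<^esub> x', y \<oplus>\<^bsub>E\<^esub> y') \<in> G'"
        using 1 2 Gc[OF 1(1)] Gc[OF 2(1)] b e
        by (simp add: B.smult_l_distr E.smult_l_distr B.M.add.m_ac E.M.add.m_ac)
    next
      fix s x y assume s: "s \<in> carrier R" and "(x, y) \<in> G'"
      then obtain u v r where
        1: "(u, v) \<in> G" "r \<in> carrier R" "x = u \<oplus>\<^bsub>B\<^esub> r \<odot>\<^bsub>B\<^esub> b" "y = v \<oplus>\<^bsub>E\<^esub> r \<odot>\<^bsub>E\<^esub> e"
        unfolding G'_def by blast
      have "(s \<odot>\<^bsub>B\<^esub> u \<oplus>\<^bsub>B\<^esub> (s \<otimes> r) \<odot>\<^bsub>B\<^esub> b, s \<odot>\<^bsub>E\<^esub> v \<oplus>\<^bsub>E\<^esub> (s \<otimes> r) \<odot>\<^bsub>E\<^esub> e) \<in> G'"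
        using 1 s by (intro G'I Gm) auto
      then show "(s \<odot>\<^bsub>B\<^esub> x, s \<odot>\<^bsub>E\<^esub> y) \<in> G'"
        using 1 s Gc[OF 1(1)] b e
        by (simp add: B.smult_r_distr E.smult_r_distr B.smult_assoc1 E.smult_assoc1)
    next
      fix x y y' assume "(x, y) \<in> G'" "(x, y') \<in> G'"
      then obtain u v r u' v' r' where
        1: "(u, v) \<in> G" "r \<in> carrier R" "x = u \<oplus>\<^bsub>B\<^esub> r \<odot>\<^bsub>B\<^esub> b" "y = v \<oplus>\<^bsub>E\<^esub> r \<odot>\<^bsub>E\<^esub> e" and
        2: "(u', v') \<in> G" "r' \<in> carrier R" "x = u' \<oplus>\<^bsub>B\<^esub> r' \<odot>\<^bsub>B\<^esub> b" "y' = v' \<oplus>\<^bsub>E\<^esub> r' \<odot>\<^bsub>E\<^esub> e"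
        unfolding G'_def by blast
      note c = Gc[OF 1(1)] Gc[OF 2(1)] b e 1(2) 2(2)
      have mem: "(u' \<oplus>\<^bsub>B\<^esub> \<ominus>\<^bsub>B\<^esub> u, v' \<oplus>\<^bsub>E\<^esub> \<ominus>\<^bsub>E\<^esub> v) \<in> G"
        by (rule Ga[OF 2(1) Gn[OF 1(1)]])
      have "u \<oplus>\<^bsub>B\<^esub> r \<odot>\<^bsub>B\<^esub> b = u' \<oplus>\<^bsub>B\<^esub> r' \<odot>\<^bsub>B\<^esub> b" using 1(3) 2(3) by simp
      then have "u' \<oplus>\<^bsub>B\<^esub> \<ominus>\<^bsub>B\<^esub> u = r \<odot>\<^bsub>B\<^esub> b \<oplus>\<^bsub>B\<^esub> \<ominus>\<^bsub>B\<^esub> (r' \<odot>\<^bsub>B\<^esub> b)"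
        using c by (smt (verit) B.M.a_assoc B.M.a_comm B.M.a_inv_closed B.M.add.inv_solve_right'
            B.M.add.m_closed B.smult_closed)
      then have eq: "u' \<oplus>\<^bsub>B\<^esub> \<ominus>\<^bsub>B\<^esub> u = (r \<oplus> \<ominus> r') \<odot>\<^bsub>B\<^esub> b"
        using c by (simp add: B.smult_l_distr B.smult_l_minus)
      have "r \<oplus> \<ominus> r' \<in> I" by (rule II[OF _ mem[unfolded eq]]) (use c in simp)
      then have "v' \<oplus>\<^bsub>E\<^esub> \<ominus>\<^bsub>E\<^esub> v = (r \<oplus> \<ominus> r') \<odot>\<^bsub>E\<^esub> e"
        using he h_eq mem unfolding eq by metis
      then have "v' \<oplus>\<^bsub>E\<^esub> \<ominus>\<^bsub>E\<^esub> v = r \<odot>\<^bsub>E\<^esub> e \<oplus>\<^bsub>E\<^esub> \<ominus>\<^bsub>E\<^esub> (r' \<odot>\<^bsub>E\<^esub> e)"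
        using c by (simp add: E.smult_l_distr E.smult_l_minus)
      then have "v \<oplus>\<^bsub>E\<^esub> r \<odot>\<^bsub>E\<^esub> e = v' \<oplus>\<^bsub>E\<^esub> r' \<odot>\<^bsub>E\<^esub> e"
        using c by (smt (verit) E.M.a_assoc E.M.a_comm E.M.a_inv_closed E.M.add.inv_solve_right'
            E.M.add.m_closed E.smult_closed)
      then show "y = y'" using 1(4) 2(4) by simp
    qed
    then have "G' = G" using max GG' by blast
    moreover have "(\<zero>\<^bsub>B\<^esub> \<oplus>\<^bsub>B\<^esub> \<one> \<odot>\<^bsub>B\<^esub> b, \<zero>\<^bsub>E\<^esub> \<oplus>\<^bsub>E\<^esub> \<one> \<odot>\<^bsub>E\<^esub> e) \<in> G'" by (intro G'I G0) auto
    ultimately show ?thesis using b e by auto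
  qed
  define g where "g b = (THE y. (b, y) \<in> G)" for b
  have g_eq: "g b = y" if "(b, y) \<in> G" for b y
    unfolding g_def using that Gs by blast
  have gG: "(b, g b) \<in> G" if "b \<in> carrier B" for b
    using total[OF that] g_eq by auto
  have "g \<in> mod_hom R B E"
    unfolding mod_hom_def
  proof (intro CollectI conjI ballI)
    show "g \<in> carrier B \<rightarrow> carrier E" using gG Gc by blast
    show "g (x \<oplus>\<^bsub>B\<^esub> y) = g x \<oplus>\<^bsub>E\<^esub> g y" if "x \<in> carrier B" "y \<in> carrier B" for x y
      by (rule g_eq[OF Ga[OF gG gG]]) (rule that)+
    show "g (r \<odot>\<^bsub>B\<^esub> x) = r \<odot>\<^bsub>E\<^esub> g x" if "r \<in> carrier R" "x \<in> carrier B" for r x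
      by (rule g_eq[OF Gm[OF that(1) gG[OF that(2)]]])
  qed
  moreover have "g (i x) = f x" if "x \<in> carrier A" for x
    by (rule g_eq) (use GF that in \<open>auto simp: F_def\<close>)
  ultimately show ?thesis by blast
qed

lemma injective_module_extend:
  fixes R :: "('a, 'r) ring_scheme" and E :: "('a, 'c) module" and \<phi> :: "'a \<Rightarrow> 'c"
    and A :: "('a, 'x, 'm) module_scheme" and B :: "('a, 'y, 'n) module_scheme"
  assumes inj: "injective_module R E" and \<phi>: "inj_on \<phi> (carrier R)"
    and A: "module R A" and B: "module R B"
    and i: "i \<in> mod_hom R A B" "inj_on i (carrier A)" and f: "f \<in> mod_hom R A E"
  shows "\<exists>g \<in> mod_hom R B E. \<forall>x \<in> carrier A. g (i x) = f x"
proof -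
  interpret E: module R E using inj by (simp add: injective_module_def)
  define \<psi> where "\<psi> = the_inv_into (carrier R) \<phi>"
  have \<psi>: "\<psi> (\<phi> r) = r" if "r \<in> carrier R" for r
    unfolding \<psi>_def using \<phi> that by (rule the_inv_into_f_f)
  define T :: "'a set \<Rightarrow> ('a, 'c) module" where "T S =
    \<lparr>carrier = \<phi> ` S, monoid.mult = undefined, monoid.one = undefined, ring.zero = \<phi> \<zero>\<^bsub>R\<^esub>,
     ring.add = (\<lambda>x y. \<phi> (\<psi> x \<oplus>\<^bsub>R\<^esub> \<psi> y)), smult = (\<lambda>r x. \<phi> (r \<otimes>\<^bsub>R\<^esub> \<psi> x))\<rparr>" for S
  have T: "module R (T S)" if "ideal S R" for S
  proof -
    interpret S: ideal S R by (rule that)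
    have [simp]: "\<psi> (\<phi> r) = r" "r \<in> carrier R" if "r \<in> S" for r
      using S.Icarr[OF that] \<psi> by auto
    have ag: "abelian_group (T S)"
    proof (rule abelian_groupI)
      fix x assume "x \<in> carrier (T S)"
      then obtain r where r: "x = \<phi> r" "r \<in> S" by (auto simp: T_def)
      show "\<exists>y\<in>carrier (T S). y \<oplus>\<^bsub>T S\<^esub> x = \<zero>\<^bsub>T S\<^esub>"
        using r by (intro bexI[of _ "\<phi> (\<ominus>\<^bsub>R\<^esub> r)"]) (auto simp: T_def E.R.l_neg)
    qed (auto simp: T_def S.a_closed E.R.a_assoc intro!: arg_cong[of _ _ \<phi>] E.R.a_comm)
    show ?thesis
      by (rule moduleI[OF E.R.cring_axioms ag])
        (auto simp: T_def S.I_l_closed S.a_closed E.R.l_distr E.R.r_distr E.R.m_assoc)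
  qed
  show ?thesis
  proof (rule baer_extend[OF E.module_axioms _ A B i f])
    fix I h assume I: "ideal I R" and hc: "h \<in> I \<rightarrow> carrier E"
      and ha: "\<And>r s. r \<in> I \<Longrightarrow> s \<in> I \<Longrightarrow> h (r \<oplus>\<^bsub>R\<^esub> s) = h r \<oplus>\<^bsub>E\<^esub> h s"
      and hm: "\<And>r s. r \<in> carrier R \<Longrightarrow> s \<in> I \<Longrightarrow> h (r \<otimes>\<^bsub>R\<^esub> s) = r \<odot>\<^bsub>E\<^esub> h s"
    interpret I: ideal I R by (rule I)
    have [simp]: "\<psi> (\<phi> r) = r" "r \<in> carrier R" if "r \<in> I" for r
      using I.Icarr[OF that] \<psi> by auto
    have id: "(\<lambda>x. x) \<in> mod_hom R (T I) (T (carrier R))"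
      by (auto simp: mod_hom_def T_def)
    have "(\<lambda>x. h (\<psi> x)) \<in> mod_hom R (T I) E"
      using hc by (auto simp: mod_hom_def T_def ha hm I.a_closed I.I_l_closed)
    from inj[unfolded injective_module_def, THEN conjunct2, rule_format,
        OF T[OF I] T[OF E.R.oneideal] id _ this]
    obtain g where g: "g \<in> mod_hom R (T (carrier R)) E"
      and gh: "\<forall>x \<in> carrier (T I). g x = h (\<psi> x)"
      by (auto simp: inj_on_def)
    have g1: "g (\<phi> \<one>\<^bsub>R\<^esub>) \<in> carrier E" using g by (auto simp: mod_hom_def T_def)
    have "h r = r \<odot>\<^bsub>E\<^esub> g (\<phi> \<one>\<^bsub>R\<^esub>)" if r: "r \<in> I" for r
    proof -
      have "g (r \<odot>\<^bsub>T (carrier R)\<^esub> \<phi> \<one>\<^bsub>R\<^esub>) = r \<odot>\<^bsub>E\<^esub> g (\<phi> \<one>\<^bsub>R\<^esub>)"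
        using g r by (auto simp: mod_hom_def T_def)
      moreover have "r \<odot>\<^bsub>T (carrier R)\<^esub> \<phi> \<one>\<^bsub>R\<^esub> = \<phi> r" using r \<psi> by (simp add: T_def)
      moreover have "g (\<phi> r) = h r" using gh r by (auto simp: T_def)
      ultimately show ?thesis by simp
    qed
    then show "\<exists>e \<in> carrier E. \<forall>r \<in> I. h r = r \<odot>\<^bsub>E\<^esub> e" using g1 by blast
  qed
qed

text \<open>
  \<open>0 \<rightarrow> X \<rightarrow> E 0 \<rightarrow> E 1 \<rightarrow> \<dots>\<close> is exact.
\<close>

definition injective_resolution ::
  "('a, 'r) ring_scheme \<Rightarrow> ('a, 'b, 'm) module_scheme \<Rightarrow>
   (nat \<Rightarrow> ('a, 'c) module) \<Rightarrow> (nat \<Rightarrow> 'c \<Rightarrow> 'c) \<Rightarrow> bool"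
  where "injective_resolution R X E d \<longleftrightarrow>
    (\<forall>n. injective_module R (E n)) \<and>
    (\<forall>n. d n \<in> mod_hom R (E n) (E (Suc n))) \<and>
    (\<exists>\<eta> \<in> mod_hom R X (E 0). inj_on \<eta> (carrier X) \<and>
        \<eta> ` carrier X = a_kernel (E 0) (E 1) (d 0)) \<and>
    (\<forall>n. d n ` carrier (E n) = a_kernel (E (Suc n)) (E (Suc (Suc n))) (d (Suc n)))"

type_synonym ('a, 'b) res = "('a + 'b) list set"

text \<open>
  A universe for resolutions of a module \<^term>\<open>X\<close> with elements in \<^typ>\<open>'b\<close> over a ring with
  elements in \<^typ>\<open>'a\<close>.  If \<open>\<mu>\<close> is its cardinality, then \<open>\<mu>\<close> is infinite, the cardinalities of
  \<^typ>\<open>'a\<close> and \<^typ>\<open>'b\<close> are at most \<open>\<mu>\<close>, and the cardinality of \<^typ>\<open>'a \<Rightarrow> ('a, 'b) res\<close> is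
  again \<open>\<mu>\<close>.  A module \<open>M\<close> of cardinality at most \<open>\<mu>\<close> embeds, by \<open>x \<mapsto> (r \<mapsto> r x)\<close>, into the
  injective module of additive maps from the ring to the divisible hull of \<open>M\<close>, and this module
  too has cardinality at most \<open>\<mu>\<close>.  So there are enough injectives among the modules carried by
  this type, and \<^term>\<open>X\<close> has an injective resolution there.  The ring embeds by
  \<^term>\<open>\<lambda>r. {[Inl r]}\<close>, so \<open>injective_module_extend\<close> applies.  The isomorphism type of the
  cohomology below does not depend on the chosen resolution, by the comparison theorem.
\<close>

definition the_injective_resolution ::
  "('a, 'r) ring_scheme \<Rightarrow> ('a, 'b, 'm) module_scheme \<Rightarrow>
   (nat \<Rightarrow> ('a, ('a, 'b) res) module) \<times> (nat \<Rightarrow> ('a, 'b) res \<Rightarrow> ('a, 'b) res)"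
  where "the_injective_resolution R X = (SOME (E, d). injective_resolution R X E d)"


section \<open>Local cohomology\<close>

definition torsion_part ::
  "('a, 'r) ring_scheme \<Rightarrow> 'a set \<Rightarrow> ('a, 'b, 'm) module_scheme \<Rightarrow> 'b set"
  where "torsion_part R I M =
    {x \<in> carrier M. \<exists>n::nat. \<forall>r \<in> I [^]\<^bsub>ideals_set R\<^esub> n. r \<odot>\<^bsub>M\<^esub> x = \<zero>\<^bsub>M\<^esub>}"

text \<open>On homomorphisms the torsion functor is restriction, so it leaves the underlying function
  of a homomorphism unchanged.\<close>

definition torsion_functor ::
  "('a, 'r) ring_scheme \<Rightarrow> 'a set \<Rightarrow> ('a, 'b, 'm) module_scheme \<Rightarrow> ('a, 'b, 'm) module_scheme"
  where "torsion_functor R I M = M\<lparr>carrier := torsion_part R I M\<rparr>"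

definition cocycles :: "(nat \<Rightarrow> ('a, 'c, 'm) module_scheme) \<Rightarrow> (nat \<Rightarrow> 'c \<Rightarrow> 'c) \<Rightarrow> nat \<Rightarrow> 'c set"
  where "cocycles C d i = a_kernel (C i) (C (Suc i)) (d i)"

definition coboundaries :: "(nat \<Rightarrow> ('a, 'c, 'm) module_scheme) \<Rightarrow> (nat \<Rightarrow> 'c \<Rightarrow> 'c) \<Rightarrow> nat \<Rightarrow> 'c set"
  where "coboundaries C d i =
    (case i of 0 \<Rightarrow> {\<zero>\<^bsub>C 0\<^esub>} | Suc j \<Rightarrow> d j ` carrier (C j))"

definition cohomology ::
  "(nat \<Rightarrow> ('a, 'c, 'm) module_scheme) \<Rightarrow> (nat \<Rightarrow> 'c \<Rightarrow> 'c) \<Rightarrow> nat \<Rightarrow> ('a, 'c set) module"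
  where "cohomology C d i = quot_module ((C i)\<lparr>carrier := cocycles C d i\<rparr>) (coboundaries C d i)"

definition local_cohomology ::
  "('a, 'r) ring_scheme \<Rightarrow> 'a set \<Rightarrow> nat \<Rightarrow> ('a, 'b, 'm) module_scheme \<Rightarrow>
   ('a, ('a, 'b) res set) module"
  where "local_cohomology R I i X =
    (case the_injective_resolution R X of
       (E, d) \<Rightarrow> cohomology (\<lambda>n. torsion_functor R I (E n)) d i)"

text \<open>
  On natural numbers \<^term>\<open>Sup {} = (0::nat)\<close>, as wanted; the supremum of an unbounded set is
  unspecified, but over a noetherian ring \<^term>\<open>local_cohomology R I i X\<close> is zero for \<^term>\<open>i\<close>
  greater than the arithmetic rank of \<^term>\<open>I\<close>.
\<close>

definition cohomological_dim ::
  "('a, 'r) ring_scheme \<Rightarrow> 'a set \<Rightarrow> ('a, 'b, 'm) module_scheme \<Rightarrow> nat"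
  where "cohomological_dim R I X =
    Sup {i. carrier (local_cohomology R I i X) \<noteq> {\<zero>\<^bsub>local_cohomology R I i X\<^esub>}}"


section \<open>Arithmetic rank\<close>

definition ideal_radical :: "('a, 'r) ring_scheme \<Rightarrow> 'a set \<Rightarrow> 'a set"
  where "ideal_radical R I = {r \<in> carrier R. \<exists>n::nat. r [^]\<^bsub>R\<^esub> n \<in> I}"

definition arith_rank :: "('a, 'r) ring_scheme \<Rightarrow> 'a set \<Rightarrow> nat"
  where "arith_rank R I =
    (LEAST n. \<exists>xs. length xs = n \<and> set xs \<subseteq> carrier R \<and>
       ideal_radical R I = ideal_radical R (genideal R (set xs)))"

end

theory Submission
  imports Defs "HOL-Library.Poly_Mapping" "HOL-Library.Countable" "HOL-Algebra.IntRing"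
begin

text \<open>
  Write \<open>c = cd(\<bb>, X)\<close>, let \<open>H = H\<^sup>c_\<bb>(X)\<close> be the top local cohomology module, and choose
  \<open>x\<^sub>1, \<dots>, x\<^sub>n\<close> with \<open>n = ara(\<aa>)\<close> that generate \<open>\<aa>\<close> up to radical.  The isomorphism is usually read
  off a corner of the spectral sequence
  \<open>H\<^sup>p_\<aa>(H\<^sup>q_\<bb>(X)) \<Rightarrow> H\<^sup>p\<^sup>+\<^sup>q_(\<aa> + \<bb>)(X)\<close>.
  Here both sides are computed by the same operation, applied \<open>n\<close> times.

  For an element \<open>x\<close> and a module \<open>N\<close>, let \<open>T_x(N)\<close> be the cokernel of \<open>N \<rightarrow> N_x\<close>.  Let \<open>C\<close> be a complex
  without cohomology above degree \<open>c\<close> such that every \<open>C\<^sup>i \<rightarrow> (C\<^sup>i)_x\<close> is surjective.  The long exact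
  sequence of \<open>0 \<rightarrow> \<Gamma>_x(C) \<rightarrow> C \<rightarrow> C_x \<rightarrow> 0\<close> shows that \<open>\<Gamma>_x(C)\<close> has no cohomology above degree
  \<open>c + 1\<close> (\<open>tors_exact_at\<close>) and that its cohomology in degree \<open>c + 1\<close> is \<open>T_x(H\<^sup>c(C))\<close>; in
  particular it depends only on \<open>H\<^sup>c(C)\<close> (\<open>cohomology_corr_tors\<close>).

  Take an injective resolution \<open>E\<close> of \<open>X\<close>.  The complex \<open>\<Gamma>_\<bb>(E)\<close> has top cohomology \<open>H\<close> in degree \<open>c\<close>,
  and cutting it down to torsion for \<open>x\<^sub>1, \<dots>, x\<^sub>n\<close> in turn ends with \<open>\<Gamma>_(\<aa> + \<bb>)(E)\<close>.  An injective
  resolution \<open>E'\<close> of \<open>H\<close> has cohomology \<open>H\<close> in degree 0 only, and the same cuts end with \<open>\<Gamma>_\<aa>(E')\<close>.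
  So both modules in (i) are \<open>T_(x\<^sub>n) \<dots> T_(x\<^sub>1)(H)\<close>.  Moreover \<open>n + c\<close> and \<open>n\<close> bound the degrees with
  non-zero cohomology on the two sides, so for \<open>n > 0\<close> each equation in (ii) says that the modules
  in (i) are not zero.  For \<open>n = 0\<close> the ideal \<open>\<aa>\<close> is nilpotent and both equations hold.

  Two ingredients take work.  The surjectivity of \<open>\<Gamma>_\<bb>(E\<^sup>i) \<rightarrow> \<Gamma>_\<bb>(E\<^sup>i)_x\<close> for an injective module
  over a noetherian ring is \<open>baer_tors_divisible\<close>.  The existence of resolutions within the type
  on which local cohomology is defined is \<open>injective_resolution_exists\<close>.
\<close>

section \<open>Modules and homomorphisms\<close>

lemma mod_homI:
  assumes "\<And>x. x \<in> carrier M \<Longrightarrow> f x \<in> carrier N"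
    and "\<And>x y. x \<in> carrier M \<Longrightarrow> y \<in> carrier M \<Longrightarrow> f (x \<oplus>\<^bsub>M\<^esub> y) = f x \<oplus>\<^bsub>N\<^esub> f y"
    and "\<And>r x. r \<in> carrier R \<Longrightarrow> x \<in> carrier M \<Longrightarrow> f (r \<odot>\<^bsub>M\<^esub> x) = r \<odot>\<^bsub>N\<^esub> f x"
  shows "f \<in> mod_hom R M N"
  using assms by (auto simp: mod_hom_def)

lemma mod_homD:
  assumes "f \<in> mod_hom R M N"
  shows "x \<in> carrier M \<Longrightarrow> f x \<in> carrier N"
    and "x \<in> carrier M \<Longrightarrow> y \<in> carrier M \<Longrightarrow> f (x \<oplus>\<^bsub>M\<^esub> y) = f x \<oplus>\<^bsub>N\<^esub> f y"
    and "r \<in> carrier R \<Longrightarrow> x \<in> carrier M \<Longrightarrow> f (r \<odot>\<^bsub>M\<^esub> x) = r \<odot>\<^bsub>N\<^esub> f x"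
  using assms by (auto simp: mod_hom_def)

lemma mod_hom_zero:
  assumes "module R M" "module R N" "f \<in> mod_hom R M N"
  shows "f \<zero>\<^bsub>M\<^esub> = \<zero>\<^bsub>N\<^esub>"
proof -
  interpret M: module R M by fact
  interpret N: module R N by fact
  have "f (\<zero>\<^bsub>R\<^esub> \<odot>\<^bsub>M\<^esub> \<zero>\<^bsub>M\<^esub>) = \<zero>\<^bsub>R\<^esub> \<odot>\<^bsub>N\<^esub> f \<zero>\<^bsub>M\<^esub>"
    by (rule mod_homD[OF assms(3)]) auto
  then show ?thesis using mod_homD(1)[OF assms(3)] by simp
qed

lemma mod_hom_minus:
  assumes "module R M" "module R N" "f \<in> mod_hom R M N" "x \<in> carrier M" "y \<in> carrier M"
  shows "f (x \<ominus>\<^bsub>M\<^esub> y) = f x \<ominus>\<^bsub>N\<^esub> f y"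
proof -
  interpret M: module R M by fact
  interpret N: module R N by fact
  have "f (\<ominus>\<^bsub>M\<^esub> y) = f ((\<ominus>\<^bsub>R\<^esub> \<one>\<^bsub>R\<^esub>) \<odot>\<^bsub>M\<^esub> y)" using assms by (simp add: M.smult_l_minus)
  also have "\<dots> = (\<ominus>\<^bsub>R\<^esub> \<one>\<^bsub>R\<^esub>) \<odot>\<^bsub>N\<^esub> f y"
    using assms by (intro mod_homD(3)[OF assms(3)]) auto
  also have "\<dots> = \<ominus>\<^bsub>N\<^esub> f y" using mod_homD(1)[OF assms(3)] assms by (simp add: N.smult_l_minus)
  finally show ?thesis using assms mod_homD(2)[OF assms(3)] by (simp add: a_minus_def)
qed

lemma mod_hom_comp:
  assumes "f \<in> mod_hom R L M" "g \<in> mod_hom R M N"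
  shows "(\<lambda>x. g (f x)) \<in> mod_hom R L N"
  using mod_homD[OF assms(1)] mod_homD[OF assms(2)] by (intro mod_homI) auto

context module begin

lemma minus_eq_zero_iff:
  "x \<in> carrier M \<Longrightarrow> y \<in> carrier M \<Longrightarrow> x \<ominus>\<^bsub>M\<^esub> y = \<zero>\<^bsub>M\<^esub> \<longleftrightarrow> x = y"
  by (metis M.minus_eq M.r_neg M.minus_equality M.minus_minus M.a_inv_closed)

lemma neg_zero: "\<ominus>\<^bsub>M\<^esub> \<zero>\<^bsub>M\<^esub> = \<zero>\<^bsub>M\<^esub>"
  by (rule M.minus_equality) auto

lemma diff_zero: "x \<in> carrier M \<Longrightarrow> x \<ominus>\<^bsub>M\<^esub> \<zero>\<^bsub>M\<^esub> = x"
  using M.minus_equality[of "\<zero>\<^bsub>M\<^esub>" "\<zero>\<^bsub>M\<^esub>"] by (simp add: M.minus_eq)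

lemma smult_r_diff:
  "r \<in> carrier R \<Longrightarrow> x \<in> carrier M \<Longrightarrow> y \<in> carrier M \<Longrightarrow>
    r \<odot>\<^bsub>M\<^esub> (x \<ominus>\<^bsub>M\<^esub> y) = r \<odot>\<^bsub>M\<^esub> x \<ominus>\<^bsub>M\<^esub> r \<odot>\<^bsub>M\<^esub> y"
  by (simp add: M.minus_eq smult_r_distr smult_r_minus)

lemma pow_smult_add:
  fixes i k :: nat
  assumes "x \<in> carrier R" "v \<in> carrier M"
  shows "x [^]\<^bsub>R\<^esub> i \<odot>\<^bsub>M\<^esub> (x [^]\<^bsub>R\<^esub> k \<odot>\<^bsub>M\<^esub> v) = x [^]\<^bsub>R\<^esub> (i + k) \<odot>\<^bsub>M\<^esub> v"
  using assms by (simp add: smult_assoc1[symmetric] R.nat_pow_mult)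

lemma smult_comm:
  "r \<in> carrier R \<Longrightarrow> s \<in> carrier R \<Longrightarrow> v \<in> carrier M \<Longrightarrow>
    r \<odot>\<^bsub>M\<^esub> (s \<odot>\<^bsub>M\<^esub> v) = s \<odot>\<^bsub>M\<^esub> (r \<odot>\<^bsub>M\<^esub> v)"
  by (metis R.m_comm smult_assoc1)

lemma pow_smult_zero_mono:
  fixes i k :: nat
  assumes "x \<in> carrier R" "v \<in> carrier M" "x [^]\<^bsub>R\<^esub> i \<odot>\<^bsub>M\<^esub> v = \<zero>\<^bsub>M\<^esub>" "i \<le> k"
  shows "x [^]\<^bsub>R\<^esub> k \<odot>\<^bsub>M\<^esub> v = \<zero>\<^bsub>M\<^esub>"
  using pow_smult_add[of x v "k - i" i] assms by simp

end

section \<open>Quotients and linear relations\<close>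

locale module_pair = module R M for R (structure) and M :: "('a, 'b, 'm) module_scheme" (structure) +
  fixes H
  assumes sub: "submodule H R M"
begin

sublocale abelian_subgroup H M
proof (rule abelian_subgroupI3[OF _ M.abelian_group_axioms])
  show "additive_subgroup H M" 
    using sub by (intro additive_subgroupI) (simp add: submodule_def)
qed

lemma coset_eq_iff:
  assumes "x \<in> carrier M" "y \<in> carrier M"
  shows "H +>\<^bsub>M\<^esub> x = H +>\<^bsub>M\<^esub> y \<longleftrightarrow> x \<ominus>\<^bsub>M\<^esub> y \<in> H"
proof
  assume "H +>\<^bsub>M\<^esub> x = H +>\<^bsub>M\<^esub> y"
  then have "x \<in> H +>\<^bsub>M\<^esub> y" using a_rcos_self[OF assms(1)] by simp
  then show "x \<ominus>\<^bsub>M\<^esub> y \<in> H" using a_rcos_module assms by (simp add: M.minus_eq)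
qed (metis a_repr_independence' a_rcos_module assms M.minus_eq)

lemma quot_carrier: "carrier (quot_module M H) = (\<lambda>x. H +>\<^bsub>M\<^esub> x) ` carrier M"
  by (auto simp: quot_module_def A_RCOSETS_def')

lemma quot_carrierI: "x \<in> carrier M \<Longrightarrow> H +>\<^bsub>M\<^esub> x \<in> carrier (quot_module M H)"
  by (simp add: quot_carrier)

lemma quot_zero: "\<zero>\<^bsub>quot_module M H\<^esub> = H"
  by (simp add: quot_module_def)

lemma quot_zero_coset: "H +>\<^bsub>M\<^esub> \<zero>\<^bsub>M\<^esub> = H"
  using a_subset by simp

lemma quot_eq_zero_iff: "x \<in> carrier M \<Longrightarrow> H +>\<^bsub>M\<^esub> x = H \<longleftrightarrow> x \<in> H"
  using coset_eq_iff[of x "\<zero>\<^bsub>M\<^esub>"] by (simp add: diff_zero quot_zero_coset)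

lemma quot_add:
  assumes "x \<in> carrier M" "y \<in> carrier M"
  shows "(H +>\<^bsub>M\<^esub> x) \<oplus>\<^bsub>quot_module M H\<^esub> (H +>\<^bsub>M\<^esub> y) = H +>\<^bsub>M\<^esub> (x \<oplus>\<^bsub>M\<^esub> y)"
  using a_rcos_sum[OF assms] by (simp add: quot_module_def)

lemma quot_smult:
  assumes r: "r \<in> carrier R" and x: "x \<in> carrier M"
  shows "r \<odot>\<^bsub>quot_module M H\<^esub> (H +>\<^bsub>M\<^esub> x) = H +>\<^bsub>M\<^esub> (r \<odot>\<^bsub>M\<^esub> x)"
proof -
  have "H +>\<^bsub>M\<^esub> (r \<odot>\<^bsub>M\<^esub> y) = H +>\<^bsub>M\<^esub> (r \<odot>\<^bsub>M\<^esub> x)" if y: "y \<in> H +>\<^bsub>M\<^esub> x" for y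
  proof -
    have yc: "y \<in> carrier M" using y x a_r_coset_subset_G[OF a_subset x] by blast
    have "H +>\<^bsub>M\<^esub> x = H +>\<^bsub>M\<^esub> y" by (rule a_repr_independence'[OF y x])
    then have "x \<ominus>\<^bsub>M\<^esub> y \<in> H" using coset_eq_iff x yc by blast
    then have "r \<odot>\<^bsub>M\<^esub> (x \<ominus>\<^bsub>M\<^esub> y) \<in> H" using sub r by (simp add: submodule.smult_closed)
    then have "r \<odot>\<^bsub>M\<^esub> x \<ominus>\<^bsub>M\<^esub> r \<odot>\<^bsub>M\<^esub> y \<in> H" using r x yc by (simp add: smult_r_diff)
    then have "H +>\<^bsub>M\<^esub> (r \<odot>\<^bsub>M\<^esub> x) = H +>\<^bsub>M\<^esub> (r \<odot>\<^bsub>M\<^esub> y)"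
      by (intro iffD2[OF coset_eq_iff]) (use r x yc in auto)
    then show ?thesis ..
  qed
  then have "(\<Union>y\<in>H +>\<^bsub>M\<^esub> x. H +>\<^bsub>M\<^esub> (r \<odot>\<^bsub>M\<^esub> y)) = (\<Union>y\<in>H +>\<^bsub>M\<^esub> x. H +>\<^bsub>M\<^esub> (r \<odot>\<^bsub>M\<^esub> x))"
    by (intro SUP_cong) auto
  moreover have "x \<in> H +>\<^bsub>M\<^esub> x" using x by (rule a_rcos_self)
  then have "H +>\<^bsub>M\<^esub> x \<noteq> {}" by blast
  ultimately show ?thesis by (simp add: quot_module_def)
qed

lemma quot_is_module: "module R (quot_module M H)"
proof (rule moduleI[OF R.cring_axioms])
  show "abelian_group (quot_module M H)"
  proof (rule abelian_groupI)
    fix x assume "x \<in> carrier (quot_module M H)"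
    then obtain a where a: "a \<in> carrier M" "x = H +>\<^bsub>M\<^esub> a" by (auto simp: quot_carrier)
    show "\<exists>y\<in>carrier (quot_module M H). y \<oplus>\<^bsub>quot_module M H\<^esub> x = \<zero>\<^bsub>quot_module M H\<^esub>"
      using a quot_add[of "\<ominus>\<^bsub>M\<^esub> a" a] quot_zero_coset
      by (intro bexI[of _ "H +>\<^bsub>M\<^esub> (\<ominus>\<^bsub>M\<^esub> a)"]) (auto simp: quot_carrierI quot_zero M.l_neg)
    show "\<zero>\<^bsub>quot_module M H\<^esub> \<oplus>\<^bsub>quot_module M H\<^esub> x = x"
      using a quot_add[of "\<zero>\<^bsub>M\<^esub>" a] quot_zero_coset by (simp add: quot_zero)
    fix y assume "y \<in> carrier (quot_module M H)"
    then obtain b where b: "b \<in> carrier M" "y = H +>\<^bsub>M\<^esub> b" by (auto simp: quot_carrier)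
    show "x \<oplus>\<^bsub>quot_module M H\<^esub> y = y \<oplus>\<^bsub>quot_module M H\<^esub> x"
      using a b M.a_comm[OF a(1) b(1)] by (simp add: quot_add)
  next
    show "\<zero>\<^bsub>quot_module M H\<^esub> \<in> carrier (quot_module M H)"
      using quot_carrierI[of "\<zero>\<^bsub>M\<^esub>"] quot_zero_coset by (simp add: quot_zero)
  qed (auto simp: quot_carrier quot_add M.a_assoc)
qed (auto simp: quot_carrier quot_add quot_smult smult_l_distr smult_r_distr smult_assoc1)

lemma quot_trivial_iff:
  "carrier (quot_module M H) = {\<zero>\<^bsub>quot_module M H\<^esub>} \<longleftrightarrow> carrier M \<subseteq> H"
proof
  assume *: "carrier (quot_module M H) = {\<zero>\<^bsub>quot_module M H\<^esub>}"
  show "carrier M \<subseteq> H"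
  proof
    fix x assume x: "x \<in> carrier M"
    then have "H +>\<^bsub>M\<^esub> x = H" using quot_carrierI * by (auto simp: quot_zero)
    then show "x \<in> H" using quot_eq_zero_iff x by blast
  qed
next
  assume "carrier M \<subseteq> H"
  then have "\<And>x. x \<in> carrier M \<Longrightarrow> H +>\<^bsub>M\<^esub> x = H" using quot_eq_zero_iff by blast
  then show "carrier (quot_module M H) = {\<zero>\<^bsub>quot_module M H\<^esub>}"
    using M.zero_closed unfolding quot_carrier quot_zero by blast
qed

end

text \<open>
  Isomorphisms between quotients \<open>M/H\<close> and \<open>M'/H'\<close> are given by linear relations between \<open>M\<close> and
  \<open>M'\<close> that are total on both sides and match \<open>H\<close> with \<open>H'\<close>.  Comparisons of cohomology can thus be
  made on cocycles: a relation may list all possible choices in a diagram chase, where a map would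
  have to select one of them and be shown to be independent of the selection.
\<close>

definition quot_corr ::
  "('a, 'r) ring_scheme \<Rightarrow> ('a, 'b, 'm) module_scheme \<Rightarrow> 'b set \<Rightarrow>
   ('a, 'c, 'n) module_scheme \<Rightarrow> 'c set \<Rightarrow> ('b \<times> 'c) set \<Rightarrow> bool"
  where "quot_corr R M H M' H' \<sigma> \<longleftrightarrow>
    \<sigma> \<subseteq> carrier M \<times> carrier M' \<and>
    (\<forall>x \<in> carrier M. \<exists>y. (x, y) \<in> \<sigma>) \<and>
    (\<forall>y \<in> carrier M'. \<exists>x. (x, y) \<in> \<sigma>) \<and>
    (\<forall>x y x' y'. (x, y) \<in> \<sigma> \<longrightarrow> (x', y') \<in> \<sigma> \<longrightarrow> (x \<oplus>\<^bsub>M\<^esub> x', y \<oplus>\<^bsub>M'\<^esub> y') \<in> \<sigma>) \<and>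
    (\<forall>r x y. r \<in> carrier R \<longrightarrow> (x, y) \<in> \<sigma> \<longrightarrow> (r \<odot>\<^bsub>M\<^esub> x, r \<odot>\<^bsub>M'\<^esub> y) \<in> \<sigma>) \<and>
    (\<forall>x y. (x, y) \<in> \<sigma> \<longrightarrow> (x \<in> H \<longleftrightarrow> y \<in> H'))"

lemma quot_corrD:
  assumes "quot_corr R M H M' H' \<sigma>"
  shows "(x, y) \<in> \<sigma> \<Longrightarrow> x \<in> carrier M" "(x, y) \<in> \<sigma> \<Longrightarrow> y \<in> carrier M'"
    "x \<in> carrier M \<Longrightarrow> \<exists>y. (x, y) \<in> \<sigma>" "y \<in> carrier M' \<Longrightarrow> \<exists>x. (x, y) \<in> \<sigma>"
    "(x, y) \<in> \<sigma> \<Longrightarrow> (x', y') \<in> \<sigma> \<Longrightarrow> (x \<oplus>\<^bsub>M\<^esub> x', y \<oplus>\<^bsub>M'\<^esub> y') \<in> \<sigma>"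
    "r \<in> carrier R \<Longrightarrow> (x, y) \<in> \<sigma> \<Longrightarrow> (r \<odot>\<^bsub>M\<^esub> x, r \<odot>\<^bsub>M'\<^esub> y) \<in> \<sigma>"
    "(x, y) \<in> \<sigma> \<Longrightarrow> x \<in> H \<longleftrightarrow> y \<in> H'"
  using assms unfolding quot_corr_def by auto

lemma quot_corr_diff:
  assumes "module R M" "module R M'" and q: "quot_corr R M H M' H' \<sigma>"
    and 1: "(x, y) \<in> \<sigma>" and 2: "(x', y') \<in> \<sigma>"
  shows "(x \<ominus>\<^bsub>M\<^esub> x', y \<ominus>\<^bsub>M'\<^esub> y') \<in> \<sigma>"
proof -
  interpret M: module R M by fact
  interpret M': module R M' by fact
  note D = quot_corrD[OF q]
  have "((\<ominus>\<^bsub>R\<^esub> \<one>\<^bsub>R\<^esub>) \<odot>\<^bsub>M\<^esub> x', (\<ominus>\<^bsub>R\<^esub> \<one>\<^bsub>R\<^esub>) \<odot>\<^bsub>M'\<^esub> y') \<in> \<sigma>" by (rule D(6)[OF _ 2]) auto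
  then have "(\<ominus>\<^bsub>M\<^esub> x', \<ominus>\<^bsub>M'\<^esub> y') \<in> \<sigma>"
    using D(1)[OF 2] D(2)[OF 2] by (simp add: M.smult_l_minus M'.smult_l_minus)
  from D(5)[OF 1 this] show ?thesis by (simp add: a_minus_def)
qed

lemma quot_corr_imp_mod_iso:
  fixes M :: "('a, 'b, 'm) module_scheme" and M' :: "('a, 'c, 'n) module_scheme"
  assumes "module_pair R M H" "module_pair R M' H'" and q: "quot_corr R M H M' H' \<sigma>"
  shows "mod_iso R (quot_module M H) (quot_module M' H')"
proof -
  interpret M: module_pair R M H by fact
  interpret M': module_pair R M' H' by fact
  note D = quot_corrD[OF q]
  have coset: "H +>\<^bsub>M\<^esub> x = H +>\<^bsub>M\<^esub> x' \<longleftrightarrow> H' +>\<^bsub>M'\<^esub> y = H' +>\<^bsub>M'\<^esub> y'"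
    if "(x, y) \<in> \<sigma>" "(x', y') \<in> \<sigma>" for x y x' y'
    using quot_corr_diff[OF M.module_axioms M'.module_axioms q that] that D(1,2,7)
    by (metis M.coset_eq_iff M'.coset_eq_iff)
  define f where "f A = (SOME B. \<exists>x y. (x, y) \<in> \<sigma> \<and> A = H +>\<^bsub>M\<^esub> x \<and> B = H' +>\<^bsub>M'\<^esub> y)" for A
  have f: "f (H +>\<^bsub>M\<^esub> x) = H' +>\<^bsub>M'\<^esub> y" if "(x, y) \<in> \<sigma>" for x y
  proof -
    have "\<exists>x' y'. (x', y') \<in> \<sigma> \<and> H +>\<^bsub>M\<^esub> x = H +>\<^bsub>M\<^esub> x' \<and> f (H +>\<^bsub>M\<^esub> x) = H' +>\<^bsub>M'\<^esub> y'"
      unfolding f_def by (rule someI[of _ "H' +>\<^bsub>M'\<^esub> y"]) (use that in blast)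
    then show ?thesis using coset that by metis
  qed
  have ex: "\<exists>x y. (x, y) \<in> \<sigma> \<and> A = H +>\<^bsub>M\<^esub> x" if "A \<in> carrier (quot_module M H)" for A
    using that D(3) unfolding M.quot_carrier by blast
  have hom: "f \<in> mod_hom R (quot_module M H) (quot_module M' H')"
  proof (rule mod_homI)
    fix A assume "A \<in> carrier (quot_module M H)"
    then obtain x y where xy: "(x, y) \<in> \<sigma>" "A = H +>\<^bsub>M\<^esub> x" using ex by blast
    then show "f A \<in> carrier (quot_module M' H')" using f D(2) M'.quot_carrierI by simp
    show "f (r \<odot>\<^bsub>quot_module M H\<^esub> A) = r \<odot>\<^bsub>quot_module M' H'\<^esub> f A" if r: "r \<in> carrier R" for r
      using xy r f[OF xy(1)] f[OF D(6)[OF r xy(1)]] D(1,2)[OF xy(1)]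
      by (simp add: M.quot_smult M'.quot_smult)
    fix B assume "B \<in> carrier (quot_module M H)"
    then obtain x' y' where xy': "(x', y') \<in> \<sigma>" "B = H +>\<^bsub>M\<^esub> x'" using ex by blast
    show "f (A \<oplus>\<^bsub>quot_module M H\<^esub> B) = f A \<oplus>\<^bsub>quot_module M' H'\<^esub> f B"
      using xy xy' f[OF xy(1)] f[OF xy'(1)] f[OF D(5)[OF xy(1) xy'(1)]] D(1,2)[OF xy(1)] D(1,2)[OF xy'(1)]
      by (simp add: M.quot_add M'.quot_add)
  qed
  have "inj_on f (carrier (quot_module M H))"
    by (rule inj_onI) (metis coset ex f)
  moreover have "f ` carrier (quot_module M H) = carrier (quot_module M' H')"
  proof
    show "f ` carrier (quot_module M H) \<subseteq> carrier (quot_module M' H')"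
      using mod_homD(1)[OF hom] by blast
    show "carrier (quot_module M' H') \<subseteq> f ` carrier (quot_module M H)"
    proof
      fix B assume "B \<in> carrier (quot_module M' H')"
      then obtain x y where xy: "(x, y) \<in> \<sigma>" "B = H' +>\<^bsub>M'\<^esub> y"
        using D(4) unfolding M'.quot_carrier by blast
      then show "B \<in> f ` carrier (quot_module M H)"
        using f D(1) M.quot_carrierI by (intro image_eqI[of _ _ "H +>\<^bsub>M\<^esub> x"]) auto
    qed
  qed
  ultimately show ?thesis using hom unfolding mod_iso_def bij_betw_def by blast
qed

section \<open>Torsion with respect to a set of elements\<close>

definition tors :: "('a, 'r) ring_scheme \<Rightarrow> 'a set \<Rightarrow> ('a, 'b, 'm) module_scheme \<Rightarrow> 'b set"
  where "tors R S M = {v \<in> carrier M. \<forall>s \<in> S. \<exists>n::nat. s [^]\<^bsub>R\<^esub> n \<odot>\<^bsub>M\<^esub> v = \<zero>\<^bsub>M\<^esub>}"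

lemma tors_empty: "tors R {} M = carrier M"
  by (simp add: tors_def)

lemma tors_Un: "tors R (S \<union> T) M = tors R S M \<inter> tors R T M"
  by (auto simp: tors_def)

lemma (in module) tors_submodule:
  assumes S: "S \<subseteq> carrier R"
  shows "submodule (tors R S M) R M"
proof (rule submoduleI)
  fix v assume v: "v \<in> tors R S M"
  show "\<ominus>\<^bsub>M\<^esub> v \<in> tors R S M"
    using v S by (fastforce simp: tors_def smult_r_minus M.minus_equality[of "\<zero>\<^bsub>M\<^esub>" "\<zero>\<^bsub>M\<^esub>"])
  show "r \<odot>\<^bsub>M\<^esub> v \<in> tors R S M" if r: "r \<in> carrier R" for r
    unfolding tors_def
  proof (intro CollectI conjI ballI)
    show "r \<odot>\<^bsub>M\<^esub> v \<in> carrier M" using r v by (simp add: tors_def)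
    fix s assume s: "s \<in> S"
    then obtain n :: nat where "s [^]\<^bsub>R\<^esub> n \<odot>\<^bsub>M\<^esub> v = \<zero>\<^bsub>M\<^esub>" using v by (auto simp: tors_def)
    then show "\<exists>n::nat. s [^]\<^bsub>R\<^esub> n \<odot>\<^bsub>M\<^esub> (r \<odot>\<^bsub>M\<^esub> v) = \<zero>\<^bsub>M\<^esub>"
      using r s S v smult_comm[of "s [^]\<^bsub>R\<^esub> n" r v]
      by (intro exI[of _ n]) (auto simp: tors_def)
  qed
  fix w assume w: "w \<in> tors R S M"
  show "v \<oplus>\<^bsub>M\<^esub> w \<in> tors R S M"
    unfolding tors_def
  proof (intro CollectI conjI ballI)
    show "v \<oplus>\<^bsub>M\<^esub> w \<in> carrier M" using v w by (simp add: tors_def)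
    fix s assume s: "s \<in> S"
    then obtain n k :: nat where "s [^]\<^bsub>R\<^esub> n \<odot>\<^bsub>M\<^esub> v = \<zero>\<^bsub>M\<^esub>" "s [^]\<^bsub>R\<^esub> k \<odot>\<^bsub>M\<^esub> w = \<zero>\<^bsub>M\<^esub>"
      using v w unfolding tors_def by blast
    then have "s [^]\<^bsub>R\<^esub> (n + k) \<odot>\<^bsub>M\<^esub> v = \<zero>\<^bsub>M\<^esub>" "s [^]\<^bsub>R\<^esub> (n + k) \<odot>\<^bsub>M\<^esub> w = \<zero>\<^bsub>M\<^esub>"
      using s S v w pow_smult_zero_mono[of s v n "n + k"] pow_smult_zero_mono[of s w k "n + k"]
      by (auto simp: tors_def)
    then show "\<exists>n::nat. s [^]\<^bsub>R\<^esub> n \<odot>\<^bsub>M\<^esub> (v \<oplus>\<^bsub>M\<^esub> w) = \<zero>\<^bsub>M\<^esub>"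
      using s S v w by (intro exI[of _ "n + k"]) (auto simp: tors_def smult_r_distr)
  qed
qed (use S in \<open>auto simp: tors_def\<close>)

lemma ideals_set_simps [simp]:
  "\<one>\<^bsub>ideals_set R\<^esub> = carrier R" "I \<otimes>\<^bsub>ideals_set R\<^esub> J = ideal_prod R I J"
  by (simp_all add: ideals_set_def)

lemma ideal_pow_0: "I [^]\<^bsub>ideals_set R\<^esub> (0::nat) = carrier R"
  by simp

lemma ideal_pow_Suc: "I [^]\<^bsub>ideals_set R\<^esub> Suc n = ideal_prod R (I [^]\<^bsub>ideals_set R\<^esub> n) I"
  by simp

lemma (in ring) ideal_pow_ideal: "ideal I R \<Longrightarrow> ideal (I [^]\<^bsub>ideals_set R\<^esub> (n::nat)) R"
  by (induction n) (simp_all add: ideal_pow_0 ideal_pow_Suc oneideal ideal_prod_is_ideal)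

lemma (in ring) elem_pow_in_ideal_pow:
  "ideal I R \<Longrightarrow> y \<in> I \<Longrightarrow> y [^] n \<in> I [^]\<^bsub>ideals_set R\<^esub> (n::nat)"
  by (induction n) (auto simp: ideal_pow_0 ideal_pow_Suc intro: ideal_prod.prod)

context module begin

definition kills :: "'a set \<Rightarrow> nat \<Rightarrow> 'c \<Rightarrow> bool"
  where "kills I n v \<longleftrightarrow> (\<forall>r \<in> I [^]\<^bsub>ideals_set R\<^esub> n. r \<odot>\<^bsub>M\<^esub> v = \<zero>\<^bsub>M\<^esub>)"

lemma torsion_part_kills: "torsion_part R I M = {v \<in> carrier M. \<exists>n. kills I n v}"
  by (simp add: torsion_part_def kills_def)

lemma kills_mono:
  assumes "ideal I R" "kills I n v" "n \<le> k"
  shows "kills I k v"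
  using assms(3,2)
proof (induction rule: dec_induct)
  case (step k)
  then show ?case
    using ideal_prod_inter[OF ideal_pow_ideal[OF assms(1), of k] assms(1)]
    by (auto simp: kills_def)
qed

lemma kills_Suc_I:
  assumes I: "ideal I R" and v: "v \<in> carrier M" and *: "\<And>y. y \<in> I \<Longrightarrow> kills I n (y \<odot>\<^bsub>M\<^esub> v)"
  shows "kills I (Suc n) v"
  unfolding kills_def ideal_pow_Suc
proof
  fix r assume "r \<in> ideal_prod R (I [^]\<^bsub>ideals_set R\<^esub> n) I"
  then have "r \<in> carrier R \<and> r \<odot>\<^bsub>M\<^esub> v = \<zero>\<^bsub>M\<^esub>"
  proof induction
    case (prod i j)
    have "i \<in> carrier R" "j \<in> carrier R"
      using prod ideal.Icarr[OF I] ideal.Icarr[OF ideal_pow_ideal[OF I]] by auto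
    then show ?case using prod * v by (simp add: smult_assoc1 kills_def)
  next
    case (sum s1 s2)
    then show ?case using v by (simp add: smult_l_distr)
  qed
  then show "r \<odot>\<^bsub>M\<^esub> v = \<zero>\<^bsub>M\<^esub>" ..
qed

lemma kills_ideal:
  assumes I: "ideal I R" and v: "v \<in> carrier M"
  shows "ideal {r \<in> carrier R. kills I n (r \<odot>\<^bsub>M\<^esub> v)} R"
proof -
  have t: "t \<in> carrier R" if "t \<in> I [^]\<^bsub>ideals_set R\<^esub> n" for t
    using ideal.Icarr[OF ideal_pow_ideal[OF I] that] .
  have *: "kills I n ((s \<otimes> r) \<odot>\<^bsub>M\<^esub> v)" if "r \<in> carrier R" "s \<in> carrier R" "kills I n (r \<odot>\<^bsub>M\<^esub> v)" for r s
  proof -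
    have "q \<odot>\<^bsub>M\<^esub> ((s \<otimes> r) \<odot>\<^bsub>M\<^esub> v) = \<zero>\<^bsub>M\<^esub>" if q: "q \<in> I [^]\<^bsub>ideals_set R\<^esub> n" for q
      using t[OF q] q that v \<open>kills I n (r \<odot>\<^bsub>M\<^esub> v)\<close> \<open>s \<in> carrier R\<close> \<open>r \<in> carrier R\<close>
        smult_comm[of q s "r \<odot>\<^bsub>M\<^esub> v"] by (simp add: smult_assoc1 kills_def)
    then show ?thesis by (simp add: kills_def)
  qed
  show ?thesis
  proof (rule idealI[OF R.ring_axioms])
    show "subgroup {r \<in> carrier R. kills I n (r \<odot>\<^bsub>M\<^esub> v)} (add_monoid R)"
    proof (rule R.add.subgroupI)
      show "{r \<in> carrier R. kills I n (r \<odot>\<^bsub>M\<^esub> v)} \<noteq> {}"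
        using v t by (auto simp: kills_def intro!: exI[of _ \<zero>])
      fix a assume a: "a \<in> {r \<in> carrier R. kills I n (r \<odot>\<^bsub>M\<^esub> v)}"
      show "\<ominus> a \<in> {r \<in> carrier R. kills I n (r \<odot>\<^bsub>M\<^esub> v)}"
        using a *[of a "\<ominus> \<one>"] by (simp add: R.l_minus)
      fix b assume b: "b \<in> {r \<in> carrier R. kills I n (r \<odot>\<^bsub>M\<^esub> v)}"
      show "a \<oplus> b \<in> {r \<in> carrier R. kills I n (r \<odot>\<^bsub>M\<^esub> v)}"
        using a b v t by (simp add: kills_def smult_l_distr smult_r_distr)
    qed auto
  qed (use * R.m_comm in auto)
qed

text \<open>
  A pigeonhole argument on products of generators is avoided by induction on the sum of the
  exponents: every \<open>s v\<close> needs a smaller exponent at \<open>s\<close>, and if \<open>I\<^sup>K\<close> kills \<open>s v\<close> for all generators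
  \<open>s\<close> of \<open>I\<close>, then \<open>I\<^sup>K\<^sup>+\<^sup>1\<close> kills \<open>v\<close>.
\<close>

lemma generators_kill_imp_kills:
  assumes fin: "finite S" and S: "S \<subseteq> carrier R" and v: "v \<in> carrier M"
    and n: "\<And>s. s \<in> S \<Longrightarrow> s [^]\<^bsub>R\<^esub> (n s :: nat) \<odot>\<^bsub>M\<^esub> v = \<zero>\<^bsub>M\<^esub>"
  shows "\<exists>N. kills (Idl S) N v"
  using v n
proof (induction "\<Sum>s\<in>S. n s" arbitrary: n v rule: less_induct)
  case less
  have I: "ideal (Idl S) R" by (rule R.genideal_ideal[OF S])
  show ?case
  proof (cases "v = \<zero>\<^bsub>M\<^esub>")
    case True
    then have "kills (Idl S) 0 v" by (simp add: kills_def)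
    then show ?thesis ..
  next
    case False
    have "\<exists>N. kills (Idl S) N (s \<odot>\<^bsub>M\<^esub> v)" if s: "s \<in> S" for s
    proof -
      have sR: "s \<in> carrier R" using s S by blast
      have "n s \<noteq> 0"
        using less.prems(2)[OF s] less.prems(1) False by (metis R.nat_pow_0 smult_one)
      then obtain k where k: "n s = Suc k" by (cases "n s") auto
      show ?thesis
      proof (rule less.hyps)
        show "(\<Sum>t\<in>S. (n(s := k)) t) < (\<Sum>t\<in>S. n t)"
          by (rule sum_strict_mono_ex1[OF fin]) (use k s in auto)
        show "s \<odot>\<^bsub>M\<^esub> v \<in> carrier M" using sR less.prems by simp
        fix t assume t: "t \<in> S"
        show "t [^]\<^bsub>R\<^esub> (n(s := k)) t \<odot>\<^bsub>M\<^esub> (s \<odot>\<^bsub>M\<^esub> v) = \<zero>\<^bsub>M\<^esub>"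
        proof (cases "t = s")
          case True
          then show ?thesis using less.prems(1) less.prems(2)[OF s] k sR
            by (simp add: smult_assoc1[symmetric])
        next
          case False
          then show ?thesis
            using less.prems(1) less.prems(2)[OF t] t S sR smult_comm[of "t [^]\<^bsub>R\<^esub> n t" s v] by auto
        qed
      qed
    qed
    then obtain N where N: "\<And>s. s \<in> S \<Longrightarrow> kills (Idl S) (N s) (s \<odot>\<^bsub>M\<^esub> v)" by metis
    define K where "K = (\<Sum>s\<in>S. N s)"
    have "kills (Idl S) K (s \<odot>\<^bsub>M\<^esub> v)" if "s \<in> S" for s
      by (rule kills_mono[OF I N[OF that]]) (use fin that in \<open>simp add: K_def member_le_sum\<close>)
    then have "Idl S \<subseteq> {r \<in> carrier R. kills (Idl S) K (r \<odot>\<^bsub>M\<^esub> v)}"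
      using S by (intro R.genideal_minimal kills_ideal I less.prems) auto
    then have "kills (Idl S) (Suc K) v"
      by (intro kills_Suc_I I less.prems) auto
    then show ?thesis ..
  qed
qed

lemma torsion_part_genideal:
  assumes fin: "finite S" and S: "S \<subseteq> carrier R"
  shows "torsion_part R (Idl S) M = tors R S M"
proof (intro equalityI subsetI)
  fix v assume "v \<in> torsion_part R (Idl S) M"
  then obtain n where v: "v \<in> carrier M" and n: "kills (Idl S) n v" by (auto simp: torsion_part_kills)
  have "s [^]\<^bsub>R\<^esub> n \<odot>\<^bsub>M\<^esub> v = \<zero>\<^bsub>M\<^esub>" if "s \<in> S" for s
    using n R.elem_pow_in_ideal_pow[OF R.genideal_ideal[OF S], of s n] R.genideal_self[OF S] that
    by (auto simp: kills_def)
  then show "v \<in> tors R S M" using v by (auto simp: tors_def)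
next
  fix v assume "v \<in> tors R S M"
  then have v: "v \<in> carrier M" and "\<forall>s\<in>S. \<exists>n::nat. s [^]\<^bsub>R\<^esub> n \<odot>\<^bsub>M\<^esub> v = \<zero>\<^bsub>M\<^esub>" by (auto simp: tors_def)
  then obtain n :: "'a \<Rightarrow> nat" where "\<And>s. s \<in> S \<Longrightarrow> s [^]\<^bsub>R\<^esub> n s \<odot>\<^bsub>M\<^esub> v = \<zero>\<^bsub>M\<^esub>" by metis
  from generators_kill_imp_kills[OF fin S v this]
  show "v \<in> torsion_part R (Idl S) M" using v by (auto simp: torsion_part_kills)
qed

text \<open>
  By \<open>torsion_part_genideal\<close>, a power of the ideal generated by \<open>S\<close> kills a given torsion element;
  a power of each \<open>t \<in> T\<close> lies in that ideal.
\<close>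

lemma tors_mono_radical:
  assumes S: "finite S" "S \<subseteq> carrier R" and T: "T \<subseteq> carrier R"
    and rad: "ideal_radical R (Idl T) \<subseteq> ideal_radical R (Idl S)"
  shows "tors R S M \<subseteq> tors R T M"
proof
  fix v assume v': "v \<in> tors R S M"
  then have v: "v \<in> carrier M" by (simp add: tors_def)
  obtain N where N: "kills (Idl S) N v"
    using v' torsion_part_genideal[OF S] by (auto simp: torsion_part_kills)
  have "\<exists>n::nat. t [^]\<^bsub>R\<^esub> n \<odot>\<^bsub>M\<^esub> v = \<zero>\<^bsub>M\<^esub>" if t: "t \<in> T" for t
  proof -
    have tR: "t \<in> carrier R" using t T by blast
    have "t [^]\<^bsub>R\<^esub> (1::nat) \<in> Idl T" using R.genideal_self[OF T] t tR by auto
    then have "t \<in> ideal_radical R (Idl S)" using rad tR unfolding ideal_radical_def by blast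
    then obtain k :: nat where "t [^]\<^bsub>R\<^esub> k \<in> Idl S" by (auto simp: ideal_radical_def)
    from R.elem_pow_in_ideal_pow[OF R.genideal_ideal[OF S(2)] this, of N]
    have "t [^]\<^bsub>R\<^esub> (k * N) \<odot>\<^bsub>M\<^esub> v = \<zero>\<^bsub>M\<^esub>" using N tR by (simp add: kills_def R.nat_pow_pow)
    then show ?thesis ..
  qed
  then show "v \<in> tors R T M" using v by (simp add: tors_def)
qed

end

section \<open>Divisibility of the torsion of an injective module\<close>

text \<open>
  For a module this is injectivity, by Baer's criterion.  In contrast to \<^const>\<open>injective_module\<close>, no
  type of test modules enters, so that the property can be moved between types.
\<close>

definition baer :: "('a, 'r) ring_scheme \<Rightarrow> ('a, 'c, 'm) module_scheme \<Rightarrow> bool"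
  where "baer R E \<longleftrightarrow> module R E \<and>
    (\<forall>I h. ideal I R \<longrightarrow> h \<in> I \<rightarrow> carrier E \<longrightarrow>
      (\<forall>r \<in> I. \<forall>s \<in> I. h (r \<oplus>\<^bsub>R\<^esub> s) = h r \<oplus>\<^bsub>E\<^esub> h s) \<longrightarrow>
      (\<forall>r \<in> carrier R. \<forall>s \<in> I. h (r \<otimes>\<^bsub>R\<^esub> s) = r \<odot>\<^bsub>E\<^esub> h s) \<longrightarrow>
      (\<exists>e \<in> carrier E. \<forall>r \<in> I. h r = r \<odot>\<^bsub>E\<^esub> e))"

lemma (in noetherian_ring) ideal_sequence_stabilizes:
  fixes A :: "nat \<Rightarrow> 'a set"
  assumes A: "\<And>n. ideal (A n) R" and inc: "\<And>m n. m \<le> n \<Longrightarrow> A m \<subseteq> A n"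
  shows "\<exists>m. \<forall>n. A n \<subseteq> A m"
proof -
  have "subset.chain {I. ideal I R} (range A)"
  proof -
    have "A m \<subseteq> A n \<or> A n \<subseteq> A m" for m n using inc[of m n] inc[of n m] by linarith
    then show ?thesis using A by (auto simp: subset_chain_def)
  qed
  then have "\<Union>(range A) \<in> range A" by (intro ideal_chain_is_trivial) auto
  then show ?thesis by blast
qed

lemma (in noetherian_ring) maximal_ideal_with:
  assumes "ideal K0 R" "P K0"
  shows "\<exists>K. ideal K R \<and> P K \<and> K0 \<subseteq> K \<and> (\<forall>K'. ideal K' R \<longrightarrow> P K' \<longrightarrow> K \<subseteq> K' \<longrightarrow> K' = K)"
proof -
  define F where "F = {K. ideal K R \<and> P K \<and> K0 \<subseteq> K}"
  have "\<exists>M\<in>F. \<forall>X\<in>F. M \<subseteq> X \<longrightarrow> X = M"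
  proof (rule subset_Zorn_nonempty)
    show "F \<noteq> {}" using assms by (auto simp: F_def)
    fix C assume C: "C \<noteq> {}" "subset.chain F C"
    then have "subset.chain {I. ideal I R} C" by (auto simp: subset_chain_def F_def)
    then have "\<Union>C \<in> C" by (rule ideal_chain_is_trivial[OF C(1)])
    then show "\<Union>C \<in> F" using C(2) by (auto simp: subset_chain_def)
  qed
  then obtain K where "K \<in> F" "\<And>X. X \<in> F \<Longrightarrow> K \<subseteq> X \<Longrightarrow> X = K" by blast
  then show ?thesis unfolding F_def by (intro exI[of _ K]) auto
qed

lemma (in cring) colon_ideal:
  assumes K: "ideal K R" and y: "y \<in> carrier R"
  shows "ideal {r \<in> carrier R. y \<otimes> r \<in> K} R"
proof -
  interpret K: ideal K R by fact
  show ?thesis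
  proof (rule idealI[OF ring_axioms])
    show "subgroup {r \<in> carrier R. y \<otimes> r \<in> K} (add_monoid R)"
      by (rule add.subgroupI) (use y in \<open>auto simp: r_distr r_minus intro!: exI[of _ \<zero>]\<close>)
    fix a x assume a: "a \<in> {r \<in> carrier R. y \<otimes> r \<in> K}" and x: "x \<in> carrier R"
    then have "y \<otimes> (x \<otimes> a) = x \<otimes> (y \<otimes> a)" using y by (simp add: m_lcomm)
    then show 1: "x \<otimes> a \<in> {r \<in> carrier R. y \<otimes> r \<in> K}" using a x K.I_l_closed by simp
    then show "a \<otimes> x \<in> {r \<in> carrier R. y \<otimes> r \<in> K}" using a x m_comm by simp
  qed
qed

lemma colon_stabilizes:
  fixes R (structure)
  assumes "cring R" "noetherian_ring R" and K: "ideal K R" and y: "y \<in> carrier R"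
  shows "\<exists>k::nat. \<forall>j::nat. \<forall>r \<in> carrier R. y [^] j \<otimes> r \<in> K \<longrightarrow> y [^] k \<otimes> r \<in> K"
proof -
  interpret cring R by fact
  interpret noetherian_ring R by fact
  interpret K: ideal K R by fact
  define A where "A j = {r \<in> carrier R. y [^] j \<otimes> r \<in> K}" for j :: nat
  have "\<exists>m. \<forall>n. A n \<subseteq> A m"
  proof (rule ideal_sequence_stabilizes)
    show "ideal (A n) R" for n unfolding A_def by (rule colon_ideal[OF K]) (use y in simp)
    fix m n :: nat assume "m \<le> n"
    then have "y [^] n \<otimes> r = y [^] (n - m) \<otimes> (y [^] m \<otimes> r)" if "r \<in> carrier R" for r
      using y that by (simp add: m_assoc[symmetric] nat_pow_mult)
    then show "A m \<subseteq> A n" using K.I_l_closed y by (auto simp: A_def)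
  qed
  then show ?thesis by (auto simp: A_def)
qed

lemma baerE:
  assumes "baer R E" "ideal I R" "\<And>r. r \<in> I \<Longrightarrow> h r \<in> carrier E"
    and "\<And>r s. r \<in> I \<Longrightarrow> s \<in> I \<Longrightarrow> h (r \<oplus>\<^bsub>R\<^esub> s) = h r \<oplus>\<^bsub>E\<^esub> h s"
    and "\<And>r s. r \<in> carrier R \<Longrightarrow> s \<in> I \<Longrightarrow> h (r \<otimes>\<^bsub>R\<^esub> s) = r \<odot>\<^bsub>E\<^esub> h s"
  obtains e where "e \<in> carrier E" "\<And>r. r \<in> I \<Longrightarrow> h r = r \<odot>\<^bsub>E\<^esub> e"
  using assms unfolding baer_def by (metis Pi_I)

text \<open>
  The ideal \<open>K\<close> makes \<open>x\<^sup>m\<^sup>+\<^sup>n r + a \<mapsto> x\<^sup>m r e\<close> a well-defined map on \<open>x\<^sup>m\<^sup>+\<^sup>n R + K\<close>, while it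
  contains a power of each element that is nilpotent on \<open>e\<close>.  The Artin-Rees lemma would give such an
  ideal; a maximality argument is shorter.  Put \<open>q = x\<^sup>m\<^sup>+\<^sup>n\<close>, with \<open>m\<close> so large that the annihilator of
  \<open>x\<^sup>m\<close> has become stable.  Then \<open>K0 = q Ann(e)\<close> makes the map well defined.  Let \<open>K\<close> be maximal among
  the ideals above \<open>K0\<close> that do so.  If \<open>y\<close> is nilpotent on \<open>e\<close>, then a high power \<open>z\<close> of \<open>y\<close> has
  \<open>z e = 0\<close> and \<open>(K : z\<^sup>2) = (K : z)\<close>.  Whenever \<open>q r = a + s z\<close> with \<open>a \<in> K\<close>, multiplication by \<open>z\<close>
  gives \<open>z\<^sup>2 s \<in> K\<close>, because \<open>q z \<in> K0\<close>; hence \<open>s z \<in> K\<close> and \<open>q r \<in> K\<close>.  So \<open>K + z R\<close> has the property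
  as well, and \<open>z \<in> K\<close> by maximality.
\<close>

lemma separating_ideal:
  fixes R (structure) and E (structure) and n :: nat
  assumes "noetherian_ring R" and "module R E" and x: "x \<in> carrier R" and e: "e \<in> carrier E"
  shows "\<exists>K m. ideal K R \<and>
    (\<forall>r \<in> carrier R. x [^] (m + n) \<otimes> r \<in> K \<longrightarrow> (x [^] m \<otimes> r) \<odot>\<^bsub>E\<^esub> e = \<zero>\<^bsub>E\<^esub>) \<and>
    (\<forall>y \<in> carrier R. (\<exists>p::nat. y [^] p \<odot>\<^bsub>E\<^esub> e = \<zero>\<^bsub>E\<^esub>) \<longrightarrow> (\<exists>k::nat. y [^] k \<in> K))"
proof -
  interpret E: module R E by fact
  interpret noetherian_ring R by fact
  obtain m :: nat where "\<forall>j::nat. \<forall>r \<in> carrier R. x [^] j \<otimes> r \<in> {\<zero>} \<longrightarrow> x [^] m \<otimes> r \<in> {\<zero>}"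
    using colon_stabilizes[OF E.R.cring_axioms noetherian_ring_axioms E.R.zeroideal x] by blast
  then have m: "x [^] m \<otimes> r = \<zero>" if "r \<in> carrier R" "x [^] j \<otimes> r = \<zero>" for r and j :: nat
    using that by blast
  define q where "q = x [^] (m + n)"
  have q: "q \<in> carrier R" using x by (simp add: q_def)
  define A where "A = {r \<in> carrier R. r \<odot>\<^bsub>E\<^esub> e = \<zero>\<^bsub>E\<^esub>}"
  have "ideal A R"
    unfolding A_def
  proof (rule idealI[OF E.R.ring_axioms])
    show "subgroup {r \<in> carrier R. r \<odot>\<^bsub>E\<^esub> e = \<zero>\<^bsub>E\<^esub>} (add_monoid R)"
    proof (rule E.R.add.subgroupI)
      show "{r \<in> carrier R. r \<odot>\<^bsub>E\<^esub> e = \<zero>\<^bsub>E\<^esub>} \<noteq> {}" using e by (auto intro!: exI[of _ \<zero>])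
    qed (use e in \<open>auto simp: E.smult_l_distr E.smult_l_minus E.M.minus_equality[of "\<zero>\<^bsub>E\<^esub>" "\<zero>\<^bsub>E\<^esub>"]\<close>)
    fix a r assume "a \<in> {r \<in> carrier R. r \<odot>\<^bsub>E\<^esub> e = \<zero>\<^bsub>E\<^esub>}" "r \<in> carrier R"
    then show "r \<otimes> a \<in> {r \<in> carrier R. r \<odot>\<^bsub>E\<^esub> e = \<zero>\<^bsub>E\<^esub>}"
      and "a \<otimes> r \<in> {r \<in> carrier R. r \<odot>\<^bsub>E\<^esub> e = \<zero>\<^bsub>E\<^esub>}"
      using e E.R.m_comm[of a r] by (auto simp: E.smult_assoc1)
  qed
  define K0 where "K0 = ideal_prod R (PIdl q) A"
  have K0: "ideal K0 R"
    unfolding K0_def by (intro E.R.ideal_prod_is_ideal E.R.cgenideal_ideal q \<open>ideal A R\<close>)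
  have K0_mem: "\<exists>s \<in> A. z = q \<otimes> s" if "z \<in> K0" for z
    using that unfolding K0_def
  proof induction
    case (prod i j)
    then obtain t where t: "t \<in> carrier R" "i = t \<otimes> q" by (auto simp: cgenideal_def)
    have "t \<otimes> j \<in> A" using ideal.I_l_closed[OF \<open>ideal A R\<close>] t prod by blast
    moreover have "i \<otimes> j = q \<otimes> (t \<otimes> j)"
      using t prod(2) q unfolding A_def by (simp add: E.R.m_ac)
    ultimately show ?case by blast
  next
    case (sum s1 s2)
    then obtain a b where "a \<in> A" "b \<in> A" "s1 = q \<otimes> a" "s2 = q \<otimes> b" by blast
    moreover from this have "a \<oplus> b \<in> A"
      using additive_subgroup.a_closed[OF ideal.axioms(1)[OF \<open>ideal A R\<close>]] by blast
    ultimately show ?case using q unfolding A_def by (intro bexI[of _ "a \<oplus> b"]) (auto simp: E.R.r_distr)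
  qed
  define P where "P K \<longleftrightarrow> (\<forall>r \<in> carrier R. q \<otimes> r \<in> K \<longrightarrow> (x [^] m \<otimes> r) \<odot>\<^bsub>E\<^esub> e = \<zero>\<^bsub>E\<^esub>)" for K
  have "P K0"
    unfolding P_def
  proof (intro ballI impI)
    fix r assume r: "r \<in> carrier R" "q \<otimes> r \<in> K0"
    then obtain s where s: "s \<in> carrier R" "s \<odot>\<^bsub>E\<^esub> e = \<zero>\<^bsub>E\<^esub>" "q \<otimes> r = q \<otimes> s"
      using K0_mem unfolding A_def by blast
    then have "q \<otimes> (r \<ominus> s) = \<zero>" using r q by (simp add: E.R.minus_eq E.R.r_distr E.R.r_minus E.R.r_neg)
    then have "x [^] m \<otimes> (r \<ominus> s) = \<zero>" using m r s unfolding q_def by simp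
    then have "x [^] m \<otimes> r = x [^] m \<otimes> s"
      using r s x by (simp add: E.R.minus_eq E.R.r_distr E.R.r_minus) (metis E.R.add.inv_closed E.R.add.m_closed E.R.m_closed E.R.nat_pow_closed E.R.minus_equality E.R.minus_minus)
    then show "(x [^] m \<otimes> r) \<odot>\<^bsub>E\<^esub> e = \<zero>\<^bsub>E\<^esub>" using s x e by (simp add: E.smult_assoc1)
  qed
  then obtain K where K: "ideal K R" "P K" "K0 \<subseteq> K"
    and max: "\<And>K'. ideal K' R \<Longrightarrow> P K' \<Longrightarrow> K \<subseteq> K' \<Longrightarrow> K' = K"
    using maximal_ideal_with[of K0 P] K0 by metis
  interpret K: ideal K R by fact
  have "\<exists>k::nat. y [^] k \<in> K" if y: "y \<in> carrier R" and p: "y [^] (p::nat) \<odot>\<^bsub>E\<^esub> e = \<zero>\<^bsub>E\<^esub>" for y p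
  proof -
    obtain k :: nat where "\<forall>j::nat. \<forall>r \<in> carrier R. y [^] j \<otimes> r \<in> K \<longrightarrow> y [^] k \<otimes> r \<in> K"
      using colon_stabilizes[OF E.R.cring_axioms noetherian_ring_axioms K(1) y] by blast
    then have k: "y [^] k \<otimes> r \<in> K" if "y [^] j \<otimes> r \<in> K" "r \<in> carrier R" for r and j :: nat
      using that by blast
    define z where "z = y [^] (p + k)"
    have z: "z \<in> carrier R" using y by (simp add: z_def)
    have zk: "z \<otimes> r \<in> K" if r: "r \<in> carrier R" and zz: "z \<otimes> (z \<otimes> r) \<in> K" for r
    proof -
      have "y [^] (p + k + (p + k)) \<otimes> r \<in> K"
        using zz r y unfolding z_def by (simp add: E.R.m_assoc[symmetric] E.R.nat_pow_mult)
      then have "y [^] p \<otimes> (y [^] k \<otimes> r) \<in> K" using k r y K.I_l_closed by simp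
      then show ?thesis using r y unfolding z_def by (simp add: E.R.m_assoc[symmetric] E.R.nat_pow_mult)
    qed
    have zA: "z \<in> A"
    proof -
      have "y [^] k \<odot>\<^bsub>E\<^esub> (y [^] p \<odot>\<^bsub>E\<^esub> e) = \<zero>\<^bsub>E\<^esub>" using p y by simp
      then show ?thesis using y e unfolding A_def z_def by (simp add: E.pow_smult_add add.commute)
    qed
    define K' where "K' = K <+>\<^bsub>R\<^esub> PIdl z"
    have K': "ideal K' R"
      unfolding K'_def by (intro E.R.add_ideals K(1) E.R.cgenideal_ideal z)
    have "P K'"
      unfolding P_def
    proof (intro ballI impI)
      fix r assume r: "r \<in> carrier R" and "q \<otimes> r \<in> K'"
      then obtain a s where a: "a \<in> K" and s: "s \<in> carrier R" and eq: "q \<otimes> r = a \<oplus> s \<otimes> z"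
        unfolding K'_def set_add_def' cgenideal_def by blast
      have aR: "a \<in> carrier R" using K.Icarr a by blast
      have "q \<otimes> z \<in> K0" unfolding K0_def
        by (rule ideal_prod.prod) (use E.R.cgenideal_self[OF q] zA in auto)
      then have "r \<otimes> (q \<otimes> z) \<in> K" using K(3) K.I_l_closed r by blast
      moreover have "r \<otimes> (q \<otimes> z) = z \<otimes> (q \<otimes> r)" using r q z by (simp add: E.R.m_ac)
      ultimately have "z \<otimes> a \<oplus> z \<otimes> (z \<otimes> s) \<in> K"
        using r q z s aR unfolding eq by (simp add: E.R.r_distr E.R.m_comm)
      moreover have "\<ominus> (z \<otimes> a) \<in> K" using K.I_l_closed a z by simp
      ultimately have "\<ominus> (z \<otimes> a) \<oplus> (z \<otimes> a \<oplus> z \<otimes> (z \<otimes> s)) \<in> K" by blast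
      then have "z \<otimes> (z \<otimes> s) \<in> K" using z s aR by (simp add: E.R.r_neg1)
      then have "s \<otimes> z \<in> K" using zk[OF s] z s by (simp add: E.R.m_comm)
      then have "q \<otimes> r \<in> K" unfolding eq using a by blast
      then show "(x [^] m \<otimes> r) \<odot>\<^bsub>E\<^esub> e = \<zero>\<^bsub>E\<^esub>" using K(2) r by (auto simp: P_def)
    qed
    moreover have "K \<subseteq> K'"
    proof
      fix a assume "a \<in> K"
      moreover have "\<zero> \<in> PIdl z"
        using additive_subgroup.zero_closed[OF ideal.axioms(1)[OF E.R.cgenideal_ideal[OF z]]] .
      ultimately have "a \<oplus> \<zero> \<in> K'" unfolding K'_def set_add_def' by blast
      then show "a \<in> K'" using K.Icarr[OF \<open>a \<in> K\<close>] by simp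
    qed
    ultimately have "K' = K" using max K' by blast
    moreover have "\<zero> \<oplus> z \<in> K'"
      unfolding K'_def set_add_def' using K.zero_closed E.R.cgenideal_self[OF z] by blast
    ultimately show ?thesis using z unfolding z_def by auto
  qed
  then show ?thesis using K unfolding P_def q_def by blast
qed

text \<open>
  In the localization at \<open>x\<close> this reads \<open>e / x\<^sup>n = e' / 1\<close>.  The map
  \<open>x\<^sup>m\<^sup>+\<^sup>n r + a \<mapsto> x\<^sup>m r e\<close> on \<open>x\<^sup>m\<^sup>+\<^sup>n R + K\<close>, with \<open>K\<close> from \<open>separating_ideal\<close>, is multiplication by some
  \<open>e'\<close>.  It vanishes on \<open>K\<close>, and this keeps \<open>e'\<close> in the torsion part.
\<close>

lemma baer_tors_divisible:
  fixes R (structure) and E (structure) and n :: nat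
  assumes noeth: "noetherian_ring R" and baer: "baer R E" and S: "S \<subseteq> carrier R"
    and x: "x \<in> carrier R" and e: "e \<in> tors R S E"
  shows "\<exists>e' \<in> tors R S E. \<exists>j. x [^] (j + n) \<odot>\<^bsub>E\<^esub> e' = x [^] j \<odot>\<^bsub>E\<^esub> e"
proof -
  have E: "module R E" using baer by (simp add: baer_def)
  interpret E: module R E by fact
  have ec: "e \<in> carrier E" using e by (simp add: tors_def)
  obtain K and m :: nat where K: "ideal K R"
    and sep: "\<And>r. r \<in> carrier R \<Longrightarrow> x [^] (m + n) \<otimes> r \<in> K \<Longrightarrow> (x [^] m \<otimes> r) \<odot>\<^bsub>E\<^esub> e = \<zero>\<^bsub>E\<^esub>"
    and nil: "\<And>y p. y \<in> carrier R \<Longrightarrow> y [^] (p::nat) \<odot>\<^bsub>E\<^esub> e = \<zero>\<^bsub>E\<^esub> \<Longrightarrow> \<exists>k::nat. y [^] k \<in> K"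
    using separating_ideal[OF noeth E x ec, of n] by blast
  interpret K: ideal K R by fact
  define q where "q = x [^] (m + n)"
  define t where "t = x [^] m"
  have q: "q \<in> carrier R" and t: "t \<in> carrier R" using x by (simp_all add: q_def t_def)
  define J where "J = {a \<oplus> r \<otimes> q | a r. a \<in> K \<and> r \<in> carrier R}"
  have J: "ideal J R"
  proof -
    have "J = K <+>\<^bsub>R\<^esub> PIdl q" unfolding J_def set_add_def' cgenideal_def by blast
    then show ?thesis using E.R.add_ideals K E.R.cgenideal_ideal q by simp
  qed
  define h where "h z = (THE w. \<exists>a \<in> K. \<exists>r \<in> carrier R. z = a \<oplus> r \<otimes> q \<and> w = (t \<otimes> r) \<odot>\<^bsub>E\<^esub> e)" for z
  have h: "h (a \<oplus> r \<otimes> q) = (t \<otimes> r) \<odot>\<^bsub>E\<^esub> e" if "a \<in> K" "r \<in> carrier R" for a r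
    unfolding h_def
  proof (rule the_equality)
    show "\<exists>a' \<in> K. \<exists>r' \<in> carrier R. a \<oplus> r \<otimes> q = a' \<oplus> r' \<otimes> q \<and> (t \<otimes> r) \<odot>\<^bsub>E\<^esub> e = (t \<otimes> r') \<odot>\<^bsub>E\<^esub> e"
      using that by blast
    fix w assume "\<exists>a' \<in> K. \<exists>r' \<in> carrier R. a \<oplus> r \<otimes> q = a' \<oplus> r' \<otimes> q \<and> w = (t \<otimes> r') \<odot>\<^bsub>E\<^esub> e"
    then obtain a' r' where *: "a' \<in> K" "r' \<in> carrier R" "a \<oplus> r \<otimes> q = a' \<oplus> r' \<otimes> q" "w = (t \<otimes> r') \<odot>\<^bsub>E\<^esub> e"
      by blast
    have c: "a \<in> carrier R" "a' \<in> carrier R" using that(1) *(1) K.Icarr by auto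
    \<comment> \<open>the two presentations differ by an element of \<open>K\<close> that is a multiple of \<open>q\<close>, which \<open>sep\<close> applies to\<close>
    have "q \<otimes> (r \<ominus> r') = r \<otimes> q \<oplus> \<ominus> (r' \<otimes> q)"
      using that *(2) q by (simp add: E.R.minus_eq E.R.r_distr E.R.r_minus E.R.m_comm)
    also have "\<dots> = \<ominus> a \<oplus> (a \<oplus> r \<otimes> q) \<oplus> \<ominus> (r' \<otimes> q)"
      using that c q by (simp add: E.R.r_neg1)
    also have "\<dots> = \<ominus> a \<oplus> a'"
      unfolding *(3) using that *(2) c q by (simp add: E.R.a_assoc E.R.r_neg)
    also have "\<dots> \<in> K" using that(1) *(1) by blast
    finally have "(t \<otimes> (r \<ominus> r')) \<odot>\<^bsub>E\<^esub> e = \<zero>\<^bsub>E\<^esub>"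
      using sep[of "r \<ominus> r'"] that *(2) by (simp add: q_def t_def)
    then have "(t \<otimes> r) \<odot>\<^bsub>E\<^esub> e \<ominus>\<^bsub>E\<^esub> (t \<otimes> r') \<odot>\<^bsub>E\<^esub> e = \<zero>\<^bsub>E\<^esub>"
      using that *(2) t ec by (simp add: E.R.minus_eq E.R.r_distr E.R.r_minus E.smult_l_distr E.smult_l_minus E.M.minus_eq)
    then show "w = (t \<otimes> r) \<odot>\<^bsub>E\<^esub> e" using E.minus_eq_zero_iff that *(2,4) t ec by simp
  qed
  have "\<exists>e' \<in> carrier E. \<forall>r \<in> J. h r = r \<odot>\<^bsub>E\<^esub> e'"
  proof (rule baerE[OF baer J, of h])
    fix u assume "u \<in> J"
    then obtain a r where u: "a \<in> K" "r \<in> carrier R" "u = a \<oplus> r \<otimes> q" by (auto simp: J_def)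
    have ac: "a \<in> carrier R" using u K.Icarr by blast
    show "h u \<in> carrier E" using u h t ec by simp
    show "h (s \<otimes> u) = s \<odot>\<^bsub>E\<^esub> h u" if s: "s \<in> carrier R" for s
    proof -
      have "s \<otimes> u = s \<otimes> a \<oplus> (s \<otimes> r) \<otimes> q" using u ac q s by (simp add: E.R.r_distr E.R.m_assoc)
      moreover have "s \<otimes> a \<in> K" using u s K.I_l_closed by blast
      ultimately have "h (s \<otimes> u) = (t \<otimes> (s \<otimes> r)) \<odot>\<^bsub>E\<^esub> e" using h u s by simp
      also have "t \<otimes> (s \<otimes> r) = s \<otimes> (t \<otimes> r)" using t s u by (simp add: E.R.m_lcomm)
      finally show ?thesis using h u s t ec by (simp add: E.smult_assoc1)
    qed
    fix v assume "v \<in> J"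
    then obtain b p where v: "b \<in> K" "p \<in> carrier R" "v = b \<oplus> p \<otimes> q" by (auto simp: J_def)
    have bc: "b \<in> carrier R" using v K.Icarr by blast
    have "u \<oplus> v = (a \<oplus> b) \<oplus> (r \<oplus> p) \<otimes> q"
      using u v ac bc q by (simp add: E.R.l_distr E.R.a_ac)
    then have "h (u \<oplus> v) = (t \<otimes> (r \<oplus> p)) \<odot>\<^bsub>E\<^esub> e" using h u v K.a_closed by simp
    then show "h (u \<oplus> v) = h u \<oplus>\<^bsub>E\<^esub> h v"
      using h u v t ec by (simp add: E.R.r_distr E.smult_l_distr)
  qed blast
  then obtain e' where e': "e' \<in> carrier E" and he: "\<And>r. r \<in> J \<Longrightarrow> h r = r \<odot>\<^bsub>E\<^esub> e'" by blast
  have "\<zero> \<oplus> \<one> \<otimes> q \<in> J" unfolding J_def using K.zero_closed by blast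
  from he[OF this] have qe: "q \<odot>\<^bsub>E\<^esub> e' = t \<odot>\<^bsub>E\<^esub> e" using h[of \<zero> \<one>] q t by simp
  have Ke: "a \<odot>\<^bsub>E\<^esub> e' = \<zero>\<^bsub>E\<^esub>" if a: "a \<in> K" for a
  proof -
    have "a \<oplus> \<zero> \<otimes> q \<in> J" unfolding J_def using a by blast
    from he[OF this] show ?thesis using h[OF a, of \<zero>] K.Icarr[OF a] q t ec by simp
  qed
  have "e' \<in> tors R S E"
    unfolding tors_def
  proof (intro CollectI conjI ballI)
    fix s assume s: "s \<in> S"
    then have "\<exists>k::nat. s [^] k \<in> K" using e S nil unfolding tors_def by blast
    then show "\<exists>k::nat. s [^] k \<odot>\<^bsub>E\<^esub> e' = \<zero>\<^bsub>E\<^esub>" using Ke by blast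
  qed (rule e')
  then show ?thesis using qe unfolding q_def t_def by blast
qed

section \<open>Cutting a complex down to its torsion\<close>

definition cocycle_module ::
  "(nat \<Rightarrow> ('a, 'c, 'm) module_scheme) \<Rightarrow> (nat \<Rightarrow> 'c \<Rightarrow> 'c) \<Rightarrow> nat \<Rightarrow> ('a, 'c, 'm) module_scheme"
  where "cocycle_module C d i = (C i)\<lparr>carrier := cocycles C d i\<rparr>"

lemma cohomology_eq_quot: "cohomology C d i = quot_module (cocycle_module C d i) (coboundaries C d i)"
  by (simp add: cohomology_def cocycle_module_def)

definition exact_at :: "(nat \<Rightarrow> ('a, 'c, 'm) module_scheme) \<Rightarrow> (nat \<Rightarrow> 'c \<Rightarrow> 'c) \<Rightarrow> nat \<Rightarrow> bool"
  where "exact_at C d i \<longleftrightarrow> cocycles C d i \<subseteq> coboundaries C d i"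

definition tors_complex ::
  "('a, 'r) ring_scheme \<Rightarrow> 'a set \<Rightarrow> (nat \<Rightarrow> ('a, 'c, 'm) module_scheme) \<Rightarrow> nat \<Rightarrow> ('a, 'c, 'm) module_scheme"
  where "tors_complex R S C = (\<lambda>n. (C n)\<lparr>carrier := tors R S (C n)\<rparr>)"

lemma tors_complex_carrier: "carrier (tors_complex R S C n) = tors R S (C n)"
  and tors_complex_simps [simp]:
    "\<zero>\<^bsub>tors_complex R S C n\<^esub> = \<zero>\<^bsub>C n\<^esub>" "v \<oplus>\<^bsub>tors_complex R S C n\<^esub> w = v \<oplus>\<^bsub>C n\<^esub> w"
    "r \<odot>\<^bsub>tors_complex R S C n\<^esub> v = r \<odot>\<^bsub>C n\<^esub> v"
  by (simp_all add: tors_complex_def)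

lemma tors_complex_insert: "tors_complex R {x} (tors_complex R S C) = tors_complex R (insert x S) C"
proof -
  have "tors R {x} (tors_complex R S C n) = tors R (insert x S) (C n)" for n
    by (auto simp: tors_def tors_complex_carrier)
  then show ?thesis by (simp add: tors_complex_def)
qed

lemma tors_complex_empty: "tors_complex R {} C = C"
  by (simp add: tors_complex_def tors_empty)

lemma cocycles_iff: "v \<in> cocycles C d i \<longleftrightarrow> v \<in> carrier (C i) \<and> d i v = \<zero>\<^bsub>C (Suc i)\<^esub>"
  by (simp add: cocycles_def a_kernel_def' kernel_def)

lemma coboundaries_0: "coboundaries C d 0 = {\<zero>\<^bsub>C 0\<^esub>}"
  and coboundaries_Suc: "coboundaries C d (Suc i) = d i ` carrier (C i)"
  by (simp_all add: coboundaries_def)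

locale cochain =
  fixes R :: "('a, 'r) ring_scheme" and C :: "nat \<Rightarrow> ('a, 'c, 'm) module_scheme"
    and d :: "nat \<Rightarrow> 'c \<Rightarrow> 'c"
  assumes mod: "module R (C n)"
    and d_hom: "d n \<in> mod_hom R (C n) (C (Suc n))"
    and dd: "v \<in> carrier (C n) \<Longrightarrow> d (Suc n) (d n v) = \<zero>\<^bsub>C (Suc (Suc n))\<^esub>"
begin

sublocale C: module R "C n" for n by (rule mod)

lemmas d_closed [simp, intro] = mod_homD(1)[OF d_hom]
  and d_add = mod_homD(2)[OF d_hom]
  and d_smult = mod_homD(3)[OF d_hom]
  and d_zero = mod_hom_zero[OF mod mod d_hom]
  and d_diff = mod_hom_minus[OF mod mod d_hom]

lemma cocycles_submodule: "submodule (cocycles C d i) R (C i)"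
proof (rule C.submoduleI)
  fix v assume v: "v \<in> cocycles C d i"
  have "d i (\<zero>\<^bsub>C i\<^esub> \<ominus>\<^bsub>C i\<^esub> v) = \<zero>\<^bsub>C (Suc i)\<^esub>"
    using v by (simp add: d_diff cocycles_iff d_zero C.diff_zero)
  then show "\<ominus>\<^bsub>C i\<^esub> v \<in> cocycles C d i" using v by (simp add: cocycles_iff C.M.minus_eq)
qed (auto simp: cocycles_iff d_zero d_add d_smult)

lemma zero_in_coboundaries: "\<zero>\<^bsub>C i\<^esub> \<in> coboundaries C d i"
proof (cases i)
  case (Suc j)
  have "\<zero>\<^bsub>C (Suc j)\<^esub> = d j \<zero>\<^bsub>C j\<^esub>" by (simp add: d_zero)
  then show ?thesis unfolding Suc coboundaries_Suc by (rule image_eqI) simp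
qed (simp add: coboundaries_0)

lemma cocycle_module_pair: "module_pair R (cocycle_module C d i) (coboundaries C d i)"
proof -
  have Z: "module R (cocycle_module C d i)"
    unfolding cocycle_module_def by (rule submodule.submodule_is_module[OF cocycles_submodule mod])
  have BZ: "coboundaries C d i \<subseteq> cocycles C d i"
    by (cases i) (auto simp: coboundaries_0 coboundaries_Suc cocycles_iff d_zero dd)
  have *: "submodule (coboundaries C d i) R (C i)"
  proof (cases i)
    case 0
    then show ?thesis
      by (intro C.submoduleI) (auto simp: coboundaries_0 C.neg_zero)
  next
    case (Suc j)
    show ?thesis
      unfolding Suc coboundaries_Suc
    proof (rule C.submoduleI)
      fix v assume "v \<in> d j ` carrier (C j)"
      then obtain a where a: "a \<in> carrier (C j)" "v = d j a" by blast
      have "d j (\<zero>\<^bsub>C j\<^esub> \<ominus>\<^bsub>C j\<^esub> a) = \<ominus>\<^bsub>C (Suc j)\<^esub> v"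
        using a d_diff[OF C.M.zero_closed a(1)] d_zero by (simp add: C.M.minus_eq)
      then show "\<ominus>\<^bsub>C (Suc j)\<^esub> v \<in> d j ` carrier (C j)"
        using a by (intro image_eqI[of _ _ "\<zero>\<^bsub>C j\<^esub> \<ominus>\<^bsub>C j\<^esub> a"]) auto
      show "r \<odot>\<^bsub>C (Suc j)\<^esub> v \<in> d j ` carrier (C j)" if "r \<in> carrier R" for r
        using a that by (intro image_eqI[of _ _ "r \<odot>\<^bsub>C j\<^esub> a"]) (auto simp: d_smult)
      fix w assume "w \<in> d j ` carrier (C j)"
      then obtain b where b: "b \<in> carrier (C j)" "w = d j b" by blast
      show "v \<oplus>\<^bsub>C (Suc j)\<^esub> w \<in> d j ` carrier (C j)"
        using a b by (intro image_eqI[of _ _ "a \<oplus>\<^bsub>C j\<^esub> b"]) (auto simp: d_add)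
    next
      show "\<zero>\<^bsub>C (Suc j)\<^esub> \<in> d j ` carrier (C j)" using zero_in_coboundaries[of "Suc j"] by (simp add: coboundaries_Suc)
    qed auto
  qed
  interpret Z: module R "cocycle_module C d i" by (rule Z)
  have "module R ((cocycle_module C d i)\<lparr>carrier := coboundaries C d i\<rparr>)"
    using submodule.submodule_is_module[OF * mod] by (simp add: cocycle_module_def)
  then have "submodule (coboundaries C d i) R (cocycle_module C d i)"
    using BZ by (intro Z.module_incl_imp_submodule) (simp_all add: cocycle_module_def)
  then show ?thesis by (intro module_pair.intro module_pair_axioms.intro Z)
qed

lemma tors_cochain:
  assumes S: "S \<subseteq> carrier R"
  shows "cochain R (tors_complex R S C) d"
proof (rule cochain.intro)
  show "module R (tors_complex R S C n)" for n
    unfolding tors_complex_def by (rule submodule.submodule_is_module[OF C.tors_submodule[OF S] mod])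
  show "d (Suc n) (d n v) = \<zero>\<^bsub>tors_complex R S C (Suc (Suc n))\<^esub>"
    if "v \<in> carrier (tors_complex R S C n)" for n v
    using that dd by (simp add: tors_complex_carrier tors_def)
  show "d n \<in> mod_hom R (tors_complex R S C n) (tors_complex R S C (Suc n))" for n
  proof (rule mod_homI)
    fix v assume v: "v \<in> carrier (tors_complex R S C n)"
    show "d n v \<in> carrier (tors_complex R S C (Suc n))"
      unfolding tors_complex_carrier tors_def
    proof (intro CollectI conjI ballI)
      fix s assume s: "s \<in> S"
      then obtain k :: nat where "s [^]\<^bsub>R\<^esub> k \<odot>\<^bsub>C n\<^esub> v = \<zero>\<^bsub>C n\<^esub>"
        using v by (auto simp: tors_complex_carrier tors_def)
      then have "s [^]\<^bsub>R\<^esub> k \<odot>\<^bsub>C (Suc n)\<^esub> d n v = \<zero>\<^bsub>C (Suc n)\<^esub>"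
        using d_smult[of "s [^]\<^bsub>R\<^esub> k" v n] s S v
        by (auto simp: tors_complex_carrier tors_def d_zero)
      then show "\<exists>k::nat. s [^]\<^bsub>R\<^esub> k \<odot>\<^bsub>C (Suc n)\<^esub> d n v = \<zero>\<^bsub>C (Suc n)\<^esub>" ..
    qed (use v in \<open>simp add: tors_complex_carrier tors_def\<close>)
  qed (auto simp: tors_complex_carrier tors_def d_add d_smult)
qed

end

text \<open>
  Every term of the complex maps onto its localization at \<open>x\<close>: the element \<open>v / x\<^sup>n\<close> of the
  localization is the image of \<open>v'\<close>.
\<close>

locale divisible_cochain = cochain R C d for R C d +
  fixes x
  assumes x: "x \<in> carrier R"
    and divisible: "v \<in> carrier (C i) \<Longrightarrow>
      \<exists>v' \<in> carrier (C i). \<exists>j. x [^]\<^bsub>R\<^esub> (j + n) \<odot>\<^bsub>C i\<^esub> v' = x [^]\<^bsub>R\<^esub> (j::nat) \<odot>\<^bsub>C i\<^esub> v"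
begin

abbreviation D where "D \<equiv> tors_complex R {x} C"

lemma xp [simp, intro]: "x [^]\<^bsub>R\<^esub> (k::nat) \<in> carrier R"
  using x by simp

lemma d_xp: "v \<in> carrier (C i) \<Longrightarrow> d i (x [^]\<^bsub>R\<^esub> (k::nat) \<odot>\<^bsub>C i\<^esub> v) = x [^]\<^bsub>R\<^esub> k \<odot>\<^bsub>C (Suc i)\<^esub> d i v"
  by (rule d_smult) auto

lemma D_iff: "v \<in> carrier (D i) \<longleftrightarrow> v \<in> carrier (C i) \<and> (\<exists>k::nat. x [^]\<^bsub>R\<^esub> k \<odot>\<^bsub>C i\<^esub> v = \<zero>\<^bsub>C i\<^esub>)"
  by (simp add: tors_complex_carrier tors_def)

lemma D_cocycles_iff:
  "v \<in> cocycles D d i \<longleftrightarrow> v \<in> cocycles C d i \<and> (\<exists>k::nat. x [^]\<^bsub>R\<^esub> k \<odot>\<^bsub>C i\<^esub> v = \<zero>\<^bsub>C i\<^esub>)"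
  by (auto simp: cocycles_iff D_iff)

text \<open>
  An \<open>x\<close>-torsion cocycle \<open>z = d w\<close> satisfies \<open>x\<^sup>k z = 0\<close>, so \<open>x\<^sup>k w\<close> is a cocycle, hence \<open>x\<^sup>k w = d v\<close>.
  Dividing \<open>v\<close> by \<open>x\<^sup>k\<close> gives \<open>v'\<close> such that \<open>w - d v'\<close> is torsion and still a preimage of \<open>z\<close>.
\<close>

lemma tors_exact_at:
  assumes exact: "\<And>i. c < i \<Longrightarrow> exact_at C d i" and i: "Suc c < i"
  shows "exact_at D d i"
  unfolding exact_at_def
proof
  fix z assume z: "z \<in> cocycles D d i"
  obtain p where p: "i = Suc (Suc p)" using i by (metis Suc_lessD less_imp_Suc_add add_Suc_right Suc_lessE)
  obtain k :: nat where zc: "z \<in> cocycles C d i" and k: "x [^]\<^bsub>R\<^esub> k \<odot>\<^bsub>C i\<^esub> z = \<zero>\<^bsub>C i\<^esub>"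
    using z by (auto simp: D_cocycles_iff)
  obtain w where w: "w \<in> carrier (C (Suc p))" "z = d (Suc p) w"
    using exact[of i] i zc unfolding exact_at_def p coboundaries_Suc by auto
  have "x [^]\<^bsub>R\<^esub> k \<odot>\<^bsub>C (Suc p)\<^esub> w \<in> cocycles C d (Suc p)"
    using w k by (simp add: cocycles_iff d_xp p)
  then obtain v where v: "v \<in> carrier (C p)" "x [^]\<^bsub>R\<^esub> k \<odot>\<^bsub>C (Suc p)\<^esub> w = d p v"
    using exact[of "Suc p"] i unfolding exact_at_def p coboundaries_Suc by auto
  obtain v' and j :: nat where v': "v' \<in> carrier (C p)"
    and j: "x [^]\<^bsub>R\<^esub> (j + k) \<odot>\<^bsub>C p\<^esub> v' = x [^]\<^bsub>R\<^esub> j \<odot>\<^bsub>C p\<^esub> v"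
    using divisible[OF v(1)] by blast
  define t where "t = w \<ominus>\<^bsub>C (Suc p)\<^esub> d p v'"
  have "x [^]\<^bsub>R\<^esub> (j + k) \<odot>\<^bsub>C (Suc p)\<^esub> w = x [^]\<^bsub>R\<^esub> j \<odot>\<^bsub>C (Suc p)\<^esub> d p v"
    using w x by (simp add: v(2)[symmetric] C.pow_smult_add)
  also have "\<dots> = x [^]\<^bsub>R\<^esub> (j + k) \<odot>\<^bsub>C (Suc p)\<^esub> d p v'"
    using v v' j by (simp add: d_xp[symmetric])
  finally have "x [^]\<^bsub>R\<^esub> (j + k) \<odot>\<^bsub>C (Suc p)\<^esub> t = \<zero>\<^bsub>C (Suc p)\<^esub>"
    using w v' by (simp add: t_def C.smult_r_diff C.minus_eq_zero_iff)
  then have "t \<in> carrier (D (Suc p))" using w v' by (auto simp: D_iff t_def)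
  moreover have "d (Suc p) t = z" using w v' by (simp add: t_def d_diff dd C.diff_zero)
  ultimately show "z \<in> coboundaries D d i" unfolding p coboundaries_Suc by blast
qed

text \<open>
  The element \<open>v\<close> is a lift of \<open>u / x\<^sup>n\<close>, for a cocycle \<open>u\<close>.  The connecting homomorphism
  \<open>H\<^sup>c(C_x) \<rightarrow> H\<^sup>c\<^sup>+\<^sup>1(\<Gamma>_x(C))\<close> takes the class of \<open>u / x\<^sup>n\<close> to that of \<open>d v\<close>.
\<close>

definition fraction :: "nat \<Rightarrow> nat \<Rightarrow> 'c \<Rightarrow> 'c \<Rightarrow> bool"
  where "fraction c n u v \<longleftrightarrow> u \<in> cocycles C d c \<and> v \<in> carrier (C c) \<and>
    (\<exists>j. x [^]\<^bsub>R\<^esub> (j + n) \<odot>\<^bsub>C c\<^esub> v = x [^]\<^bsub>R\<^esub> (j::nat) \<odot>\<^bsub>C c\<^esub> u)"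

lemma fraction_exists: "u \<in> cocycles C d c \<Longrightarrow> \<exists>v. fraction c n u v"
  using divisible[of u c n] by (auto simp: fraction_def cocycles_iff)

lemma fraction_carrier: "fraction c n u v \<Longrightarrow> u \<in> carrier (C c)" "fraction c n u v \<Longrightarrow> v \<in> carrier (C c)"
  by (auto simp: fraction_def cocycles_iff)

lemma fraction_cocycle:
  assumes "fraction c n u v"
  shows "d c v \<in> cocycles D d (Suc c)"
proof -
  obtain j :: nat where u: "u \<in> carrier (C c)" "d c u = \<zero>\<^bsub>C (Suc c)\<^esub>" and v: "v \<in> carrier (C c)"
    and j: "x [^]\<^bsub>R\<^esub> (j + n) \<odot>\<^bsub>C c\<^esub> v = x [^]\<^bsub>R\<^esub> j \<odot>\<^bsub>C c\<^esub> u"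
    using assms by (auto simp: fraction_def cocycles_iff)
  have "x [^]\<^bsub>R\<^esub> (j + n) \<odot>\<^bsub>C (Suc c)\<^esub> d c v = \<zero>\<^bsub>C (Suc c)\<^esub>"
    using u v by (simp add: d_xp[symmetric] j) (simp add: d_xp)
  then show ?thesis using v dd[OF v] unfolding D_cocycles_iff unfolding cocycles_iff by auto
qed

text \<open>
  The connecting homomorphism is surjective, because \<open>H\<^sup>c\<^sup>+\<^sup>1(C)\<close> vanishes.
\<close>

lemma cocycle_fraction:
  assumes "exact_at C d (Suc c)" and z: "z \<in> cocycles D d (Suc c)"
  shows "\<exists>n u v. fraction c n u v \<and> z = d c v"
proof -
  obtain k :: nat where zc: "z \<in> cocycles C d (Suc c)" and k: "x [^]\<^bsub>R\<^esub> k \<odot>\<^bsub>C (Suc c)\<^esub> z = \<zero>\<^bsub>C (Suc c)\<^esub>"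
    using z by (auto simp: D_cocycles_iff)
  obtain v where v: "v \<in> carrier (C c)" "z = d c v"
    using assms(1) zc unfolding exact_at_def coboundaries_Suc by auto
  have "fraction c k (x [^]\<^bsub>R\<^esub> k \<odot>\<^bsub>C c\<^esub> v) v"
    using v k x by (auto simp: fraction_def cocycles_iff d_xp C.pow_smult_add intro!: exI[of _ 0])
  then show ?thesis using v by blast
qed

lemma fraction_scale:
  assumes "fraction c n u v"
  shows "fraction c (n + k) (x [^]\<^bsub>R\<^esub> k \<odot>\<^bsub>C c\<^esub> u) v"
proof -
  obtain j :: nat where u: "u \<in> carrier (C c)" "d c u = \<zero>\<^bsub>C (Suc c)\<^esub>" and v: "v \<in> carrier (C c)"
    and j: "x [^]\<^bsub>R\<^esub> (j + n) \<odot>\<^bsub>C c\<^esub> v = x [^]\<^bsub>R\<^esub> j \<odot>\<^bsub>C c\<^esub> u"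
    using assms by (auto simp: fraction_def cocycles_iff)
  have "x [^]\<^bsub>R\<^esub> (j + (n + k)) \<odot>\<^bsub>C c\<^esub> v = x [^]\<^bsub>R\<^esub> k \<odot>\<^bsub>C c\<^esub> (x [^]\<^bsub>R\<^esub> (j + n) \<odot>\<^bsub>C c\<^esub> v)"
    using v x by (simp add: C.pow_smult_add ac_simps)
  also have "\<dots> = x [^]\<^bsub>R\<^esub> j \<odot>\<^bsub>C c\<^esub> (x [^]\<^bsub>R\<^esub> k \<odot>\<^bsub>C c\<^esub> u)"
    unfolding j using u x by (simp add: C.pow_smult_add ac_simps)
  finally show ?thesis using u v by (auto simp: fraction_def cocycles_iff d_xp)
qed

lemma fraction_add:
  assumes "fraction c n u v" "fraction c n u' v'"
  shows "fraction c n (u \<oplus>\<^bsub>C c\<^esub> u') (v \<oplus>\<^bsub>C c\<^esub> v')"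
proof -
  obtain j :: nat where u: "u \<in> carrier (C c)" "d c u = \<zero>\<^bsub>C (Suc c)\<^esub>" and v: "v \<in> carrier (C c)"
    and j: "x [^]\<^bsub>R\<^esub> (j + n) \<odot>\<^bsub>C c\<^esub> v = x [^]\<^bsub>R\<^esub> j \<odot>\<^bsub>C c\<^esub> u"
    using assms(1) by (auto simp: fraction_def cocycles_iff)
  obtain j' :: nat where u': "u' \<in> carrier (C c)" "d c u' = \<zero>\<^bsub>C (Suc c)\<^esub>" and v': "v' \<in> carrier (C c)"
    and j': "x [^]\<^bsub>R\<^esub> (j' + n) \<odot>\<^bsub>C c\<^esub> v' = x [^]\<^bsub>R\<^esub> j' \<odot>\<^bsub>C c\<^esub> u'"
    using assms(2) by (auto simp: fraction_def cocycles_iff)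
  have "x [^]\<^bsub>R\<^esub> (j' + (j + n)) \<odot>\<^bsub>C c\<^esub> v = x [^]\<^bsub>R\<^esub> (j' + j) \<odot>\<^bsub>C c\<^esub> u"
    using u v x by (simp add: C.pow_smult_add[symmetric] j[symmetric])
  moreover have "x [^]\<^bsub>R\<^esub> (j + (j' + n)) \<odot>\<^bsub>C c\<^esub> v' = x [^]\<^bsub>R\<^esub> (j + j') \<odot>\<^bsub>C c\<^esub> u'"
    using u' v' x by (simp add: C.pow_smult_add[symmetric] j'[symmetric])
  ultimately have "x [^]\<^bsub>R\<^esub> (j + j' + n) \<odot>\<^bsub>C c\<^esub> (v \<oplus>\<^bsub>C c\<^esub> v') = x [^]\<^bsub>R\<^esub> (j + j') \<odot>\<^bsub>C c\<^esub> (u \<oplus>\<^bsub>C c\<^esub> u')"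
    using u v u' v' by (simp add: C.smult_r_distr ac_simps)
  then show ?thesis using u v u' v' by (auto simp: fraction_def cocycles_iff d_add)
qed

lemma fraction_smult:
  assumes "fraction c n u v" and r: "r \<in> carrier R"
  shows "fraction c n (r \<odot>\<^bsub>C c\<^esub> u) (r \<odot>\<^bsub>C c\<^esub> v)"
proof -
  obtain j :: nat where u: "u \<in> carrier (C c)" "d c u = \<zero>\<^bsub>C (Suc c)\<^esub>" and v: "v \<in> carrier (C c)"
    and j: "x [^]\<^bsub>R\<^esub> (j + n) \<odot>\<^bsub>C c\<^esub> v = x [^]\<^bsub>R\<^esub> j \<odot>\<^bsub>C c\<^esub> u"
    using assms(1) by (auto simp: fraction_def cocycles_iff)
  have "x [^]\<^bsub>R\<^esub> (j + n) \<odot>\<^bsub>C c\<^esub> (r \<odot>\<^bsub>C c\<^esub> v) = x [^]\<^bsub>R\<^esub> j \<odot>\<^bsub>C c\<^esub> (r \<odot>\<^bsub>C c\<^esub> u)"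
    using C.smult_comm[OF xp r v] C.smult_comm[OF xp r u(1)] j by simp
  then show ?thesis using u v r by (auto simp: fraction_def cocycles_iff d_smult)
qed

text \<open>
  The kernel of the connecting homomorphism is the image of \<open>H\<^sup>c(C)\<close>: the right-hand side says that
  \<open>u / x\<^sup>n = w / 1\<close> in the localization of \<open>H\<^sup>c(C)\<close> for some class \<open>w\<close>.  It is stated within \<open>H\<^sup>c(C)\<close>
  alone and therefore transfers along an isomorphism.
\<close>

lemma fraction_coboundary_iff:
  assumes f: "fraction c n u v"
  shows "d c v \<in> coboundaries D d (Suc c) \<longleftrightarrow>
    (\<exists>k::nat. \<exists>w \<in> cocycles C d c.
      x [^]\<^bsub>R\<^esub> k \<odot>\<^bsub>C c\<^esub> u \<ominus>\<^bsub>C c\<^esub> x [^]\<^bsub>R\<^esub> (n + k) \<odot>\<^bsub>C c\<^esub> w \<in> coboundaries C d c)" (is "?L \<longleftrightarrow> ?R")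
proof -
  obtain j :: nat where u: "u \<in> carrier (C c)" "d c u = \<zero>\<^bsub>C (Suc c)\<^esub>" and v: "v \<in> carrier (C c)"
    and j: "x [^]\<^bsub>R\<^esub> (j + n) \<odot>\<^bsub>C c\<^esub> v = x [^]\<^bsub>R\<^esub> j \<odot>\<^bsub>C c\<^esub> u"
    using f by (auto simp: fraction_def cocycles_iff)
  show ?thesis
  proof
    assume ?L
    then obtain t and p :: nat where t: "t \<in> carrier (C c)" "d c v = d c t"
      and p: "x [^]\<^bsub>R\<^esub> p \<odot>\<^bsub>C c\<^esub> t = \<zero>\<^bsub>C c\<^esub>"
      by (auto simp: coboundaries_Suc D_iff)
    define w where "w = v \<ominus>\<^bsub>C c\<^esub> t"
    have w: "w \<in> cocycles C d c"
      using v t by (simp add: w_def cocycles_iff d_diff C.minus_eq_zero_iff)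
    have "x [^]\<^bsub>R\<^esub> (n + (p + j)) \<odot>\<^bsub>C c\<^esub> t = \<zero>\<^bsub>C c\<^esub>"
      by (rule C.pow_smult_zero_mono[OF x t(1) p]) simp
    then have "x [^]\<^bsub>R\<^esub> (n + (p + j)) \<odot>\<^bsub>C c\<^esub> w = x [^]\<^bsub>R\<^esub> (n + (p + j)) \<odot>\<^bsub>C c\<^esub> v"
      using v t x by (simp add: w_def C.smult_r_diff C.diff_zero)
    also have "x [^]\<^bsub>R\<^esub> (n + (p + j)) \<odot>\<^bsub>C c\<^esub> v = x [^]\<^bsub>R\<^esub> p \<odot>\<^bsub>C c\<^esub> (x [^]\<^bsub>R\<^esub> (j + n) \<odot>\<^bsub>C c\<^esub> v)"
      using C.pow_smult_add[OF x v, of p "j + n"] by (simp add: add.left_commute add.commute)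
    also have "\<dots> = x [^]\<^bsub>R\<^esub> (p + j) \<odot>\<^bsub>C c\<^esub> u" using u x by (simp add: j C.pow_smult_add)
    finally have "x [^]\<^bsub>R\<^esub> (p + j) \<odot>\<^bsub>C c\<^esub> u \<ominus>\<^bsub>C c\<^esub> x [^]\<^bsub>R\<^esub> (n + (p + j)) \<odot>\<^bsub>C c\<^esub> w = \<zero>\<^bsub>C c\<^esub>"
      using u by (simp add: C.minus_eq_zero_iff)
    then show ?R using w zero_in_coboundaries[of c] by metis
  next
    assume ?R
    then obtain k :: nat and w where w: "w \<in> carrier (C c)" "d c w = \<zero>\<^bsub>C (Suc c)\<^esub>"
      and b: "x [^]\<^bsub>R\<^esub> k \<odot>\<^bsub>C c\<^esub> u \<ominus>\<^bsub>C c\<^esub> x [^]\<^bsub>R\<^esub> (n + k) \<odot>\<^bsub>C c\<^esub> w \<in> coboundaries C d c"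
      by (auto simp: cocycles_iff)
    define b where "b = x [^]\<^bsub>R\<^esub> k \<odot>\<^bsub>C c\<^esub> u \<ominus>\<^bsub>C c\<^esub> x [^]\<^bsub>R\<^esub> (n + k) \<odot>\<^bsub>C c\<^esub> w"
    have bB: "b \<in> coboundaries C d c" using b by (simp add: b_def)
    have bc: "b \<in> carrier (C c)" using u w by (simp add: b_def)
    \<comment> \<open>a coboundary can be divided by \<open>x\<close> within the coboundaries, by dividing a preimage; in degree 0 it is zero\<close>
    have "\<exists>g q. g \<in> carrier (C c) \<and> d c g = \<zero>\<^bsub>C (Suc c)\<^esub> \<and>
        x [^]\<^bsub>R\<^esub> (q + (n + k)) \<odot>\<^bsub>C c\<^esub> g = x [^]\<^bsub>R\<^esub> (q::nat) \<odot>\<^bsub>C c\<^esub> b"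
    proof (cases c)
      case 0
      then have "b = \<zero>\<^bsub>C c\<^esub>" using bB by (simp add: coboundaries_0)
      then show ?thesis by (intro exI[of _ "\<zero>\<^bsub>C c\<^esub>"] exI[of _ 0]) (simp add: d_zero)
    next
      case (Suc c')
      then obtain s where s: "s \<in> carrier (C c')" "b = d c' s"
        using bB by (auto simp: coboundaries_Suc)
      obtain s' and q :: nat where s': "s' \<in> carrier (C c')"
        and q: "x [^]\<^bsub>R\<^esub> (q + (n + k)) \<odot>\<^bsub>C c'\<^esub> s' = x [^]\<^bsub>R\<^esub> q \<odot>\<^bsub>C c'\<^esub> s"
        using divisible[OF s(1)] by blast
      have "x [^]\<^bsub>R\<^esub> (q + (n + k)) \<odot>\<^bsub>C c\<^esub> d c' s' = x [^]\<^bsub>R\<^esub> q \<odot>\<^bsub>C c\<^esub> b"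
        unfolding Suc s(2) using s(1) s' q by (simp only: d_xp[symmetric])
      then show ?thesis using s' dd by (intro exI[of _ "d c' s'"] exI[of _ q]) (simp add: Suc)
    qed
    then obtain g and q :: nat where g: "g \<in> carrier (C c)" "d c g = \<zero>\<^bsub>C (Suc c)\<^esub>"
      and q: "x [^]\<^bsub>R\<^esub> (q + (n + k)) \<odot>\<^bsub>C c\<^esub> g = x [^]\<^bsub>R\<^esub> q \<odot>\<^bsub>C c\<^esub> b" by blast
    define t where "t = v \<ominus>\<^bsub>C c\<^esub> w \<ominus>\<^bsub>C c\<^esub> g"
    define N where "N = j + (q + (n + k))"
    have 1: "x [^]\<^bsub>R\<^esub> N \<odot>\<^bsub>C c\<^esub> v = x [^]\<^bsub>R\<^esub> (j + q) \<odot>\<^bsub>C c\<^esub> (x [^]\<^bsub>R\<^esub> k \<odot>\<^bsub>C c\<^esub> u)"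
    proof -
      have "x [^]\<^bsub>R\<^esub> N \<odot>\<^bsub>C c\<^esub> v = x [^]\<^bsub>R\<^esub> (q + k) \<odot>\<^bsub>C c\<^esub> (x [^]\<^bsub>R\<^esub> (j + n) \<odot>\<^bsub>C c\<^esub> v)"
        using v x by (simp add: C.pow_smult_add N_def ac_simps)
      then show ?thesis using u x by (simp add: j C.pow_smult_add ac_simps)
    qed
    have 2: "x [^]\<^bsub>R\<^esub> N \<odot>\<^bsub>C c\<^esub> w = x [^]\<^bsub>R\<^esub> (j + q) \<odot>\<^bsub>C c\<^esub> (x [^]\<^bsub>R\<^esub> (n + k) \<odot>\<^bsub>C c\<^esub> w)"
      using w x by (simp add: C.pow_smult_add N_def ac_simps)
    have 3: "x [^]\<^bsub>R\<^esub> N \<odot>\<^bsub>C c\<^esub> g = x [^]\<^bsub>R\<^esub> (j + q) \<odot>\<^bsub>C c\<^esub> b"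
      using C.pow_smult_add[OF x g(1), of j "q + (n + k)"] C.pow_smult_add[OF x bc, of j q]
      by (simp add: N_def q)
    have "x [^]\<^bsub>R\<^esub> N \<odot>\<^bsub>C c\<^esub> t
        = x [^]\<^bsub>R\<^esub> (j + q) \<odot>\<^bsub>C c\<^esub> b \<ominus>\<^bsub>C c\<^esub> x [^]\<^bsub>R\<^esub> (j + q) \<odot>\<^bsub>C c\<^esub> b"
      using u v w g bc 1 2 3 by (simp add: t_def C.smult_r_diff) (simp add: b_def C.smult_r_diff)
    then have "x [^]\<^bsub>R\<^esub> N \<odot>\<^bsub>C c\<^esub> t = \<zero>\<^bsub>C c\<^esub>" using bc by (simp add: C.minus_eq_zero_iff)
    then have "t \<in> carrier (D c)" using v w g by (auto simp: D_iff t_def)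
    moreover have "d c v = d c t" using v w g by (simp add: t_def d_diff C.diff_zero)
    ultimately show ?L by (auto simp: coboundaries_Suc)
  qed
qed

end

text \<open>
  The class of \<open>d v\<close>, for a lift \<open>v\<close> of \<open>u / x\<^sup>n\<close>, corresponds to that of \<open>d' v'\<close>, for a lift \<open>v'\<close> of
  \<open>u' / x\<^sup>n\<close>, if \<open>u\<close> and \<open>u'\<close> correspond.  All such pairs form the required relation.
\<close>

lemma cohomology_corr_tors:
  fixes C :: "nat \<Rightarrow> ('a, 'c, 'm) module_scheme" and C' :: "nat \<Rightarrow> ('a, 'e, 'n) module_scheme"
  assumes "divisible_cochain R C d x" "divisible_cochain R C' d' x"
    and ex: "exact_at C d (Suc c)" and ex': "exact_at C' d' (Suc c')"
    and q: "quot_corr R (cocycle_module C d c) (coboundaries C d c)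
                        (cocycle_module C' d' c') (coboundaries C' d' c') \<sigma>"
  shows "\<exists>\<tau>. quot_corr R
    (cocycle_module (tors_complex R {x} C) d (Suc c)) (coboundaries (tors_complex R {x} C) d (Suc c))
    (cocycle_module (tors_complex R {x} C') d' (Suc c')) (coboundaries (tors_complex R {x} C') d' (Suc c')) \<tau>"
proof -
  interpret C: divisible_cochain R C d x by fact
  interpret C': divisible_cochain R C' d' x by fact
  interpret Z: module_pair R "cocycle_module C d c" "coboundaries C d c" by (rule C.cocycle_module_pair)
  interpret Z': module_pair R "cocycle_module C' d' c'" "coboundaries C' d' c'" by (rule C'.cocycle_module_pair)
  note [simp] = cocycle_module_def
  note D = quot_corrD[OF q, simplified]
  have diff: "(a \<ominus>\<^bsub>C c\<^esub> b, a' \<ominus>\<^bsub>C' c'\<^esub> b') \<in> \<sigma>" if "(a, a') \<in> \<sigma>" "(b, b') \<in> \<sigma>" for a a' b b'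
  proof -
    have "((\<ominus>\<^bsub>R\<^esub> \<one>\<^bsub>R\<^esub>) \<odot>\<^bsub>C c\<^esub> b, (\<ominus>\<^bsub>R\<^esub> \<one>\<^bsub>R\<^esub>) \<odot>\<^bsub>C' c'\<^esub> b') \<in> \<sigma>"
      using D(6) that(2) by simp
    then have "(\<ominus>\<^bsub>C c\<^esub> b, \<ominus>\<^bsub>C' c'\<^esub> b') \<in> \<sigma>"
      using D(1,2)[OF that(2)] by (simp add: cocycles_iff C.C.smult_l_minus C'.C.smult_l_minus)
    from D(5)[OF that(1) this] show ?thesis by (simp add: a_minus_def)
  qed
  define \<tau> where "\<tau> = {(d c v, d' c' v') | v v'. \<exists>n u u'. (u, u') \<in> \<sigma> \<and> C.fraction c n u v \<and> C'.fraction c' n u' v'}"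
  have \<tau>I: "(d c v, d' c' v') \<in> \<tau>" if "(u, u') \<in> \<sigma>" "C.fraction c n u v" "C'.fraction c' n u' v'" for n u u' v v'
    using that unfolding \<tau>_def by blast
  have \<tau>E: "\<exists>n u u' v v'. z = d c v \<and> z' = d' c' v' \<and> (u, u') \<in> \<sigma> \<and> C.fraction c n u v \<and> C'.fraction c' n u' v'"
    if "(z, z') \<in> \<tau>" for z z'
    using that unfolding \<tau>_def by blast
  have scale: "(x [^]\<^bsub>R\<^esub> (k::nat) \<odot>\<^bsub>C c\<^esub> u, x [^]\<^bsub>R\<^esub> k \<odot>\<^bsub>C' c'\<^esub> u') \<in> \<sigma>" if "(u, u') \<in> \<sigma>" for k u u'
    by (rule D(6)[OF _ that]) simp
  have "quot_corr R
    (cocycle_module C.D d (Suc c)) (coboundaries C.D d (Suc c))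
    (cocycle_module C'.D d' (Suc c')) (coboundaries C'.D d' (Suc c')) \<tau>"
    unfolding quot_corr_def
  proof (intro conjI ballI allI impI)
    show "\<tau> \<subseteq> carrier (cocycle_module C.D d (Suc c)) \<times> carrier (cocycle_module C'.D d' (Suc c'))"
      using C.fraction_cocycle C'.fraction_cocycle unfolding \<tau>_def by auto
  next
    fix z assume "z \<in> carrier (cocycle_module C.D d (Suc c))"
    then have "z \<in> cocycles C.D d (Suc c)" by simp
    then obtain n u v where f: "C.fraction c n u v" "z = d c v" using C.cocycle_fraction[OF ex] by blast
    obtain u' where u': "(u, u') \<in> \<sigma>" using D(3) f by (auto simp: C.fraction_def)
    obtain v' where "C'.fraction c' n u' v'" using C'.fraction_exists D(2)[OF u'] by blast
    then show "\<exists>z'. (z, z') \<in> \<tau>" using \<tau>I[OF u' f(1)] f(2) by blast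
  next
    fix z' assume "z' \<in> carrier (cocycle_module C'.D d' (Suc c'))"
    then have "z' \<in> cocycles C'.D d' (Suc c')" by simp
    then obtain n u' v' where f: "C'.fraction c' n u' v'" "z' = d' c' v'" using C'.cocycle_fraction[OF ex'] by blast
    obtain u where u: "(u, u') \<in> \<sigma>" using D(4) f by (auto simp: C'.fraction_def)
    obtain v where "C.fraction c n u v" using C.fraction_exists D(1)[OF u] by blast
    then show "\<exists>z. (z, z') \<in> \<tau>" using \<tau>I[OF u _ f(1)] f(2) by blast
  next
    fix y y' z z' assume "(y, y') \<in> \<tau>" "(z, z') \<in> \<tau>"
    then obtain n u u' v v' m a a' b b' where
      1: "y = d c v" "y' = d' c' v'" "(u, u') \<in> \<sigma>" "C.fraction c n u v" "C'.fraction c' n u' v'" and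
      2: "z = d c b" "z' = d' c' b'" "(a, a') \<in> \<sigma>" "C.fraction c m a b" "C'.fraction c' m a' b'"
      using \<tau>E by meson
    \<comment> \<open>over the common denominator \<open>x\<^sup>n\<^sup>+\<^sup>m\<close> the numerators are \<open>x\<^sup>m u\<close> and \<open>x\<^sup>n a\<close>\<close>
    have "(d c (v \<oplus>\<^bsub>C c\<^esub> b), d' c' (v' \<oplus>\<^bsub>C' c'\<^esub> b')) \<in> \<tau>"
    proof (rule \<tau>I[OF D(5)[OF scale[OF 1(3), of m] scale[OF 2(3), of n]]])
      show "C.fraction c (n + m) (x [^]\<^bsub>R\<^esub> m \<odot>\<^bsub>C c\<^esub> u \<oplus>\<^bsub>C c\<^esub> x [^]\<^bsub>R\<^esub> n \<odot>\<^bsub>C c\<^esub> a) (v \<oplus>\<^bsub>C c\<^esub> b)"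
        using C.fraction_add[OF C.fraction_scale[OF 1(4), of m]] C.fraction_scale[OF 2(4), of n]
        by (simp add: add.commute)
      show "C'.fraction c' (n + m) (x [^]\<^bsub>R\<^esub> m \<odot>\<^bsub>C' c'\<^esub> u' \<oplus>\<^bsub>C' c'\<^esub> x [^]\<^bsub>R\<^esub> n \<odot>\<^bsub>C' c'\<^esub> a') (v' \<oplus>\<^bsub>C' c'\<^esub> b')"
        using C'.fraction_add[OF C'.fraction_scale[OF 1(5), of m]] C'.fraction_scale[OF 2(5), of n]
        by (simp add: add.commute)
    qed
    then show "(y \<oplus>\<^bsub>cocycle_module C.D d (Suc c)\<^esub> z, y' \<oplus>\<^bsub>cocycle_module C'.D d' (Suc c')\<^esub> z') \<in> \<tau>"
      using 1 2 C.fraction_carrier C'.fraction_carrier by (simp add: C.d_add C'.d_add)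
  next
    fix r z z' assume r: "r \<in> carrier R" and "(z, z') \<in> \<tau>"
    then obtain n u u' v v' where
      1: "z = d c v" "z' = d' c' v'" "(u, u') \<in> \<sigma>" "C.fraction c n u v" "C'.fraction c' n u' v'"
      using \<tau>E by meson
    have "(d c (r \<odot>\<^bsub>C c\<^esub> v), d' c' (r \<odot>\<^bsub>C' c'\<^esub> v')) \<in> \<tau>"
      by (rule \<tau>I[OF D(6)[OF r 1(3)] C.fraction_smult[OF 1(4) r] C'.fraction_smult[OF 1(5) r]])
    then show "(r \<odot>\<^bsub>cocycle_module C.D d (Suc c)\<^esub> z, r \<odot>\<^bsub>cocycle_module C'.D d' (Suc c')\<^esub> z') \<in> \<tau>"
      using 1 r C.fraction_carrier C'.fraction_carrier by (simp add: C.d_smult C'.d_smult)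
  next
    fix z z' assume "(z, z') \<in> \<tau>"
    then obtain n u u' v v' where
      1: "z = d c v" "z' = d' c' v'" "(u, u') \<in> \<sigma>" "C.fraction c n u v" "C'.fraction c' n u' v'"
      using \<tau>E by meson
    have *: "x [^]\<^bsub>R\<^esub> k \<odot>\<^bsub>C c\<^esub> u \<ominus>\<^bsub>C c\<^esub> x [^]\<^bsub>R\<^esub> (n + k) \<odot>\<^bsub>C c\<^esub> w \<in> coboundaries C d c \<longleftrightarrow>
        x [^]\<^bsub>R\<^esub> k \<odot>\<^bsub>C' c'\<^esub> u' \<ominus>\<^bsub>C' c'\<^esub> x [^]\<^bsub>R\<^esub> (n + k) \<odot>\<^bsub>C' c'\<^esub> w' \<in> coboundaries C' d' c'"
      if "(w, w') \<in> \<sigma>" for w w' and k :: nat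
      by (rule D(7)[OF diff[OF scale[OF 1(3)] scale[OF that]]])
    show "z \<in> coboundaries C.D d (Suc c) \<longleftrightarrow> z' \<in> coboundaries C'.D d' (Suc c')"
      unfolding 1(1,2) C.fraction_coboundary_iff[OF 1(4)] C'.fraction_coboundary_iff[OF 1(5)]
      using * D(1-4) by metis
  qed
  then show ?thesis by blast
qed

lemma divisible_cochain_tors:
  assumes "noetherian_ring R" "cochain R E d" "\<And>n. baer R (E n)" "S \<subseteq> carrier R" "x \<in> carrier R"
  shows "divisible_cochain R (tors_complex R S E) d x"
proof -
  interpret E: cochain R E d by fact
  interpret T: cochain R "tors_complex R S E" d by (rule E.tors_cochain) fact
  show ?thesis
  proof
    fix v i n assume "v \<in> carrier (tors_complex R S E i)"
    then show "\<exists>v' \<in> carrier (tors_complex R S E i). \<exists>j.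
        x [^]\<^bsub>R\<^esub> (j + n) \<odot>\<^bsub>tors_complex R S E i\<^esub> v' = x [^]\<^bsub>R\<^esub> (j::nat) \<odot>\<^bsub>tors_complex R S E i\<^esub> v"
      using baer_tors_divisible[OF assms(1,3,4,5)] by (simp add: tors_complex_carrier)
  qed fact
qed

text \<open>
  Each element of the list raises the bound for the cohomology by one.
\<close>

lemma exact_at_tors_above:
  assumes "noetherian_ring R" "cochain R E d" "\<And>n. baer R (E n)"
    and "S \<subseteq> carrier R" "set xs \<subseteq> carrier R"
    and "\<And>i. c < i \<Longrightarrow> exact_at (tors_complex R S E) d i" and "c + length xs < i"
  shows "exact_at (tors_complex R (S \<union> set xs) E) d i"
  using assms(4-)
proof (induction xs arbitrary: S c)
  case (Cons x xs)
  interpret divisible_cochain R "tors_complex R S E" d x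
    using divisible_cochain_tors[OF assms(1-3)] Cons.prems by simp
  have "exact_at (tors_complex R (insert x S \<union> set xs) E) d i"
  proof (rule Cons.IH)
    show "exact_at (tors_complex R (insert x S) E) d i" if "Suc c < i" for i
      using tors_exact_at[OF Cons.prems(3) that] by (simp add: tors_complex_insert)
  qed (use Cons.prems in auto)
  then show ?case by simp
qed simp

lemma cohomology_corr_tors_list:
  assumes "noetherian_ring R" "cochain R E d" "\<And>n. baer R (E n)"
    and "cochain R E' d'" "\<And>n. baer R (E' n)"
    and "S \<subseteq> carrier R" "S' \<subseteq> carrier R" "set xs \<subseteq> carrier R"
    and "\<And>i. c < i \<Longrightarrow> exact_at (tors_complex R S E) d i"
    and "\<And>i. c' < i \<Longrightarrow> exact_at (tors_complex R S' E') d' i"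
    and "quot_corr R (cocycle_module (tors_complex R S E) d c) (coboundaries (tors_complex R S E) d c)
      (cocycle_module (tors_complex R S' E') d' c') (coboundaries (tors_complex R S' E') d' c') \<sigma>"
  shows "\<exists>\<tau>. quot_corr R
      (cocycle_module (tors_complex R (S \<union> set xs) E) d (c + length xs))
      (coboundaries (tors_complex R (S \<union> set xs) E) d (c + length xs))
      (cocycle_module (tors_complex R (S' \<union> set xs) E') d' (c' + length xs))
      (coboundaries (tors_complex R (S' \<union> set xs) E') d' (c' + length xs)) \<tau>"
  using assms(6-)
proof (induction xs arbitrary: S S' c c' \<sigma>)
  case (Cons x xs)
  interpret T: divisible_cochain R "tors_complex R S E" d x
    using divisible_cochain_tors[OF assms(1-3)] Cons.prems by simp
  interpret T': divisible_cochain R "tors_complex R S' E'" d' x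
    using divisible_cochain_tors[OF assms(1,4,5)] Cons.prems by simp
  obtain \<tau> where \<tau>: "quot_corr R
      (cocycle_module (tors_complex R (insert x S) E) d (Suc c))
      (coboundaries (tors_complex R (insert x S) E) d (Suc c))
      (cocycle_module (tors_complex R (insert x S') E') d' (Suc c'))
      (coboundaries (tors_complex R (insert x S') E') d' (Suc c')) \<tau>"
    using cohomology_corr_tors[OF T.divisible_cochain_axioms T'.divisible_cochain_axioms _ _ Cons.prems(6)]
      Cons.prems(4,5) by (auto simp: tors_complex_insert)
  have ex: "exact_at (tors_complex R (insert x S) E) d i" if "Suc c < i" for i
    using T.tors_exact_at[OF Cons.prems(4) that] by (simp add: tors_complex_insert)
  have ex': "exact_at (tors_complex R (insert x S') E') d' i" if "Suc c' < i" for i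
    using T'.tors_exact_at[OF Cons.prems(5) that] by (simp add: tors_complex_insert)
  from Cons.IH[OF _ _ _ ex ex' \<tau>] show ?case using Cons.prems by simp
qed auto

section \<open>Enough injectives\<close>

subsection \<open>Baer's criterion\<close>

lemma baer_imp_injective:
  fixes E :: "('a, 'c) module"
  assumes "baer R E"
  shows "injective_module R E"
  unfolding injective_module_def
proof (intro conjI allI impI)
  show E: "module R E" using assms by (simp add: baer_def)
  fix A B :: "('a, 'c) module" and i f
  assume "module R A" "module R B" "i \<in> mod_hom R A B" "inj_on i (carrier A)" "f \<in> mod_hom R A E"
  then show "\<exists>g\<in>mod_hom R B E. \<forall>x\<in>carrier A. g (i x) = f x"
  proof (intro baer_extend[OF E])
    fix I h assume "ideal I R" "h \<in> I \<rightarrow> carrier E"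
      "\<And>r s. r \<in> I \<Longrightarrow> s \<in> I \<Longrightarrow> h (r \<oplus>\<^bsub>R\<^esub> s) = h r \<oplus>\<^bsub>E\<^esub> h s"
      "\<And>r s. r \<in> carrier R \<Longrightarrow> s \<in> I \<Longrightarrow> h (r \<otimes>\<^bsub>R\<^esub> s) = r \<odot>\<^bsub>E\<^esub> h s"
    then show "\<exists>e\<in>carrier E. \<forall>r\<in>I. h r = r \<odot>\<^bsub>E\<^esub> e" using assms by (simp add: baer_def)
  qed
qed

definition ideal_module :: "('a, 'r) ring_scheme \<Rightarrow> 'a set \<Rightarrow> ('a, 'a) module"
  where "ideal_module R I = \<lparr>carrier = I, monoid.mult = (\<otimes>\<^bsub>R\<^esub>), monoid.one = \<one>\<^bsub>R\<^esub>,
    ring.zero = \<zero>\<^bsub>R\<^esub>, ring.add = (\<oplus>\<^bsub>R\<^esub>), smult = (\<otimes>\<^bsub>R\<^esub>)\<rparr>"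

lemma (in cring) ideal_module:
  assumes "ideal I R"
  shows "module R (ideal_module R I)"
proof -
  interpret I: ideal I R by fact
  have "abelian_group (ideal_module R I)"
  proof (rule abelian_groupI)
    fix x assume "x \<in> carrier (ideal_module R I)"
    then show "\<exists>y\<in>carrier (ideal_module R I). y \<oplus>\<^bsub>ideal_module R I\<^esub> x = \<zero>\<^bsub>ideal_module R I\<^esub>"
      by (intro bexI[of _ "\<ominus> x"]) (auto simp: ideal_module_def l_neg I.Icarr)
  qed (auto simp: ideal_module_def I.Icarr a_ac)
  then show ?thesis
    by (rule moduleI[OF cring_axioms])
      (auto simp: ideal_module_def I.Icarr I.I_l_closed l_distr r_distr m_assoc)
qed

lemma injective_imp_baer:
  fixes E :: "('a, 'c) module" and \<phi> :: "'a \<Rightarrow> 'c"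
  assumes inj: "injective_module R E" and \<phi>: "inj_on \<phi> (carrier R)"
  shows "baer R E"
proof -
  have E: "module R E" using inj by (simp add: injective_module_def)
  interpret E: module R E by fact
  show ?thesis
    unfolding baer_def
  proof (intro conjI allI impI E)
    fix I h assume I: "ideal I R" and h: "h \<in> I \<rightarrow> carrier E"
      "\<forall>r\<in>I. \<forall>s\<in>I. h (r \<oplus>\<^bsub>R\<^esub> s) = h r \<oplus>\<^bsub>E\<^esub> h s"
      "\<forall>r\<in>carrier R. \<forall>s\<in>I. h (r \<otimes>\<^bsub>R\<^esub> s) = r \<odot>\<^bsub>E\<^esub> h s"
    interpret I: ideal I R by fact
    have 1: "h \<in> mod_hom R (ideal_module R I) E"
      using h by (auto simp: mod_hom_def ideal_module_def)
    have 2: "(\<lambda>x. x) \<in> mod_hom R (ideal_module R I) (ideal_module R (carrier R))"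
      by (auto simp: mod_hom_def ideal_module_def I.Icarr)
    have "\<exists>g \<in> mod_hom R (ideal_module R (carrier R)) E. \<forall>x \<in> carrier (ideal_module R I). g x = h x"
      by (rule injective_module_extend[OF inj \<phi> E.R.ideal_module[OF I] E.R.ideal_module[OF E.R.oneideal] 2 _ 1]) simp
    then obtain g where g: "g \<in> mod_hom R (ideal_module R (carrier R)) E"
      and gh: "\<And>x. x \<in> I \<Longrightarrow> g x = h x"
      by (auto simp: ideal_module_def)
    have "h r = r \<odot>\<^bsub>E\<^esub> g \<one>\<^bsub>R\<^esub>" if "r \<in> I" for r
      using mod_homD(3)[OF g, of r "\<one>\<^bsub>R\<^esub>"] gh[OF that] I.Icarr[OF that] by (simp add: ideal_module_def)
    moreover have "g \<one>\<^bsub>R\<^esub> \<in> carrier E"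
      using mod_homD(1)[OF g, of "\<one>\<^bsub>R\<^esub>"] by (simp add: ideal_module_def)
    ultimately show "\<exists>e\<in>carrier E. \<forall>r\<in>I. h r = r \<odot>\<^bsub>E\<^esub> e" by blast
  qed
qed

subsection \<open>Divisible groups\<close>

definition int_module :: "('g, 'q) ring_scheme \<Rightarrow> (int, 'g) module"
  where "int_module G = \<lparr>carrier = carrier G, monoid.mult = undefined, monoid.one = undefined,
    ring.zero = \<zero>\<^bsub>G\<^esub>, ring.add = (\<oplus>\<^bsub>G\<^esub>), smult = (\<lambda>n x. add_pow G n x)\<rparr>"

lemma int_module_simps [simp]:
  "carrier (int_module G) = carrier G" "\<zero>\<^bsub>int_module G\<^esub> = \<zero>\<^bsub>G\<^esub>"
  "x \<oplus>\<^bsub>int_module G\<^esub> y = x \<oplus>\<^bsub>G\<^esub> y" "n \<odot>\<^bsub>int_module G\<^esub> x = add_pow G n x"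
  by (simp_all add: int_module_def)

lemma (in abelian_group) int_module: "module \<Z> (int_module G)"
proof (rule moduleI)
  show "cring \<Z>" by (rule int_is_cring)
  show "abelian_group (int_module G)"
  proof (rule abelian_groupI)
    fix x assume "x \<in> carrier (int_module G)"
    then show "\<exists>y\<in>carrier (int_module G). y \<oplus>\<^bsub>int_module G\<^esub> x = \<zero>\<^bsub>int_module G\<^esub>"
      by (intro bexI[of _ "\<ominus> x"]) (auto simp: l_neg)
  qed (auto simp: a_ac)
qed (simp_all add: add.int_pow_mult add.int_pow_distrib add.int_pow_pow mult.commute)

lemma additive_imp_int_hom:
  assumes "abelian_group G" "abelian_group H" and "\<And>x. x \<in> carrier G \<Longrightarrow> f x \<in> carrier H"
    and "\<And>x y. x \<in> carrier G \<Longrightarrow> y \<in> carrier G \<Longrightarrow> f (x \<oplus>\<^bsub>G\<^esub> y) = f x \<oplus>\<^bsub>H\<^esub> f y"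
  shows "f \<in> mod_hom \<Z> (int_module G) (int_module H)"
proof -
  interpret G: abelian_group G by fact
  interpret H: abelian_group H by fact
  have "f \<in> hom (add_monoid G) (add_monoid H)" using assms by (auto simp: hom_def)
  then show ?thesis
    using assms hom_int_pow[OF _ _ G.a_group H.a_group]
    by (auto simp: mod_hom_def add_pow_def)
qed

text \<open>
  An ideal of the integers consists of the multiples of its least positive element \<open>n\<close>, if there is
  one; then \<open>h n = n e\<close> determines \<open>h\<close>.
\<close>

lemma divisible_imp_baer:
  assumes G: "abelian_group G"
    and div: "\<And>x n. x \<in> carrier G \<Longrightarrow> 0 < n \<Longrightarrow> \<exists>y \<in> carrier G. add_pow G (n :: int) y = x"
  shows "baer \<Z> (int_module G)"
proof -
  interpret G: abelian_group G by fact
  interpret M: module \<Z> "int_module G" by (rule G.int_module)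
  show ?thesis
    unfolding baer_def
  proof (intro conjI allI impI M.module_axioms)
    fix I :: "int set" and h assume I: "ideal I \<Z>" and h: "h \<in> I \<rightarrow> carrier (int_module G)"
      "\<forall>r\<in>I. \<forall>s\<in>I. h (r \<oplus>\<^bsub>\<Z>\<^esub> s) = h r \<oplus>\<^bsub>int_module G\<^esub> h s"
      "\<forall>r\<in>carrier \<Z>. \<forall>s\<in>I. h (r \<otimes>\<^bsub>\<Z>\<^esub> s) = r \<odot>\<^bsub>int_module G\<^esub> h s"
    interpret I: ideal I \<Z> by fact
    show "\<exists>e\<in>carrier (int_module G). \<forall>r\<in>I. h r = r \<odot>\<^bsub>int_module G\<^esub> e"
    proof (cases "\<exists>n::nat. 0 < n \<and> int n \<in> I")
      case False
      have "r = 0" if r: "r \<in> I" for r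
      proof (rule ccontr)
        assume "r \<noteq> 0"
        have "- 1 * r \<in> I" using I.I_l_closed[OF r, of "- 1"] by simp
        then show False using False r \<open>r \<noteq> 0\<close>
          by (metis int_nat_eq mult_minus1 neg_0_less_iff_less not_less_iff_gr_or_eq order_less_imp_le zero_less_nat_eq)
      qed
      moreover have "h 0 = \<zero>\<^bsub>G\<^esub>" if "0 \<in> I"
        using bspec[OF bspec[OF h(3), of 0], of 0] that h(1) M.smult_l_null[of "h 0"] by auto
      ultimately show ?thesis by (intro bexI[of _ "\<zero>\<^bsub>G\<^esub>"]) auto
    next
      case True
      define n where "n = (LEAST n::nat. 0 < n \<and> int n \<in> I)"
      have n: "0 < n" "int n \<in> I" using LeastI_ex[OF True] by (simp_all add: n_def)
      obtain e where e: "e \<in> carrier G" "add_pow G (int n) e = h (int n)"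
        using div[of "h (int n)" "int n"] n h(1) by auto
      have "h r = add_pow G r e" if r: "r \<in> I" for r
      proof -
        have "r + (- (r div int n)) * int n \<in> I"
          using I.a_closed[OF r I.I_l_closed[OF n(2), of "- (r div int n)"]] by simp
        then have "r mod int n \<in> I" by (simp add: minus_div_mult_eq_mod[symmetric])
        moreover have "0 \<le> r mod int n" "r mod int n < int n" using n by auto
        ultimately have "r mod int n = 0"
          using not_less_Least[of "nat (r mod int n)" "\<lambda>n. 0 < n \<and> int n \<in> I"]
          by (fold n_def) (auto simp: nat_less_iff)
        then have r: "r = r div int n * int n" by auto
        have "h (r div int n * int n) = add_pow G (r div int n) (h (int n))" using h(3) n(2) by auto
        also have "\<dots> = add_pow G (r div int n * int n) e"
          using M.smult_assoc1[of "r div int n" "int n" e] e by simp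
        finally show ?thesis using r by simp
      qed
      then show ?thesis using e by auto
    qed
  qed
qed

subsection \<open>Coinduced modules\<close>

text \<open>
  The module \<open>Hom_\<int>(R, G)\<close>.  Its elements are extensional functions, so that two of them are equal as
  soon as they agree on the ring.
\<close>

definition coinduced :: "('a, 'r) ring_scheme \<Rightarrow> ('g, 'q) ring_scheme \<Rightarrow> ('a, 'a \<Rightarrow> 'g) module"
  where "coinduced R G =
    \<lparr>carrier = {f \<in> carrier R \<rightarrow>\<^sub>E carrier G. \<forall>r \<in> carrier R. \<forall>s \<in> carrier R. f (r \<oplus>\<^bsub>R\<^esub> s) = f r \<oplus>\<^bsub>G\<^esub> f s},
     monoid.mult = undefined, monoid.one = undefined, ring.zero = (\<lambda>r\<in>carrier R. \<zero>\<^bsub>G\<^esub>),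
     ring.add = (\<lambda>f g. \<lambda>r\<in>carrier R. f r \<oplus>\<^bsub>G\<^esub> g r), smult = (\<lambda>s f. \<lambda>r\<in>carrier R. f (r \<otimes>\<^bsub>R\<^esub> s))\<rparr>"

lemma coinduced_simps:
  "f \<in> carrier (coinduced R G) \<longleftrightarrow> f \<in> carrier R \<rightarrow>\<^sub>E carrier G \<and>
     (\<forall>r \<in> carrier R. \<forall>s \<in> carrier R. f (r \<oplus>\<^bsub>R\<^esub> s) = f r \<oplus>\<^bsub>G\<^esub> f s)"
  "\<zero>\<^bsub>coinduced R G\<^esub> = (\<lambda>r\<in>carrier R. \<zero>\<^bsub>G\<^esub>)"
  "f \<oplus>\<^bsub>coinduced R G\<^esub> g = (\<lambda>r\<in>carrier R. f r \<oplus>\<^bsub>G\<^esub> g r)"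
  "s \<odot>\<^bsub>coinduced R G\<^esub> f = (\<lambda>r\<in>carrier R. f (r \<otimes>\<^bsub>R\<^esub> s))"
  by (simp_all add: coinduced_def)

lemma coinduced_module:
  assumes "cring R" "abelian_group G"
  shows "module R (coinduced R G)"
proof -
  interpret R: cring R by fact
  interpret G: abelian_group G by fact
  have c: "f r \<in> carrier G" if "f \<in> carrier (coinduced R G)" "r \<in> carrier R" for f r
    using that by (auto simp: coinduced_simps)
  have a: "f (r \<oplus>\<^bsub>R\<^esub> s) = f r \<oplus>\<^bsub>G\<^esub> f s" if "f \<in> carrier (coinduced R G)" "r \<in> carrier R" "s \<in> carrier R" for f r s
    using that by (auto simp: coinduced_simps)
  have ext: "f = g" if "f \<in> carrier (coinduced R G)" "g \<in> carrier (coinduced R G)"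
    "\<And>r. r \<in> carrier R \<Longrightarrow> f r = g r" for f g
    using that by (auto simp: coinduced_simps intro: PiE_ext)
  have add: "f \<oplus>\<^bsub>coinduced R G\<^esub> g \<in> carrier (coinduced R G)"
    if "f \<in> carrier (coinduced R G)" "g \<in> carrier (coinduced R G)" for f g
  proof -
    have "f r \<oplus>\<^bsub>G\<^esub> f s \<oplus>\<^bsub>G\<^esub> (g r \<oplus>\<^bsub>G\<^esub> g s) = f r \<oplus>\<^bsub>G\<^esub> g r \<oplus>\<^bsub>G\<^esub> (f s \<oplus>\<^bsub>G\<^esub> g s)"
      if "r \<in> carrier R" "s \<in> carrier R" for r s
      using c \<open>f \<in> _\<close> \<open>g \<in> _\<close> that by (simp add: G.a_ac)
    then show ?thesis using c[OF that(1)] c[OF that(2)] a[OF that(1)] a[OF that(2)]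
      by (auto simp: coinduced_simps)
  qed
  have smult: "s \<odot>\<^bsub>coinduced R G\<^esub> f \<in> carrier (coinduced R G)"
    if "f \<in> carrier (coinduced R G)" "s \<in> carrier R" for f s
    using c[OF that(1)] a[OF that(1)] that(2) by (auto simp: coinduced_simps R.l_distr)
  have zero: "\<zero>\<^bsub>coinduced R G\<^esub> \<in> carrier (coinduced R G)" by (auto simp: coinduced_simps)
  have ag: "abelian_group (coinduced R G)"
  proof (rule abelian_groupI)
    fix f assume f: "f \<in> carrier (coinduced R G)"
    have neg: "(\<lambda>r\<in>carrier R. \<ominus>\<^bsub>G\<^esub> f r) \<in> carrier (coinduced R G)"
      using c[OF f] a[OF f] by (auto simp: coinduced_simps G.minus_add)
    have "(\<lambda>r\<in>carrier R. \<ominus>\<^bsub>G\<^esub> f r) \<oplus>\<^bsub>coinduced R G\<^esub> f = \<zero>\<^bsub>coinduced R G\<^esub>"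
      by (rule ext[OF add[OF neg f] zero]) (simp add: coinduced_simps G.l_neg c[OF f])
    then show "\<exists>g\<in>carrier (coinduced R G). g \<oplus>\<^bsub>coinduced R G\<^esub> f = \<zero>\<^bsub>coinduced R G\<^esub>" using neg by blast
    show "\<zero>\<^bsub>coinduced R G\<^esub> \<oplus>\<^bsub>coinduced R G\<^esub> f = f"
      by (rule ext[OF add[OF zero f] f]) (simp add: coinduced_simps c[OF f])
    fix g assume g: "g \<in> carrier (coinduced R G)"
    show "f \<oplus>\<^bsub>coinduced R G\<^esub> g = g \<oplus>\<^bsub>coinduced R G\<^esub> f"
      by (rule ext[OF add[OF f g] add[OF g f]]) (simp add: coinduced_simps G.a_comm c[OF f] c[OF g])
    fix h assume h: "h \<in> carrier (coinduced R G)"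
    show "f \<oplus>\<^bsub>coinduced R G\<^esub> g \<oplus>\<^bsub>coinduced R G\<^esub> h = f \<oplus>\<^bsub>coinduced R G\<^esub> (g \<oplus>\<^bsub>coinduced R G\<^esub> h)"
      by (rule ext[OF add[OF add[OF f g] h] add[OF f add[OF g h]]])
        (simp add: coinduced_simps G.a_assoc c[OF f] c[OF g] c[OF h])
  qed (use add zero in auto)
  show ?thesis
  proof (rule moduleI[OF assms(1) ag])
    fix f assume f: "f \<in> carrier (coinduced R G)"
    show "\<one>\<^bsub>R\<^esub> \<odot>\<^bsub>coinduced R G\<^esub> f = f"
      by (rule ext[OF smult[OF f R.one_closed] f]) (simp add: coinduced_simps)
  next
    fix s f assume s: "s \<in> carrier R" and f: "f \<in> carrier (coinduced R G)"
    show "s \<odot>\<^bsub>coinduced R G\<^esub> f \<in> carrier (coinduced R G)" by (rule smult[OF f s])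
    fix g assume g: "g \<in> carrier (coinduced R G)"
    show "s \<odot>\<^bsub>coinduced R G\<^esub> (f \<oplus>\<^bsub>coinduced R G\<^esub> g) = s \<odot>\<^bsub>coinduced R G\<^esub> f \<oplus>\<^bsub>coinduced R G\<^esub> s \<odot>\<^bsub>coinduced R G\<^esub> g"
      by (rule ext[OF smult[OF add[OF f g] s] add[OF smult[OF f s] smult[OF g s]]])
        (simp add: coinduced_simps s)
  next
    fix s t f assume s: "s \<in> carrier R" and t: "t \<in> carrier R" and f: "f \<in> carrier (coinduced R G)"
    have st: "s \<oplus>\<^bsub>R\<^esub> t \<in> carrier R" "s \<otimes>\<^bsub>R\<^esub> t \<in> carrier R" using s t by auto
    show "(s \<oplus>\<^bsub>R\<^esub> t) \<odot>\<^bsub>coinduced R G\<^esub> f = s \<odot>\<^bsub>coinduced R G\<^esub> f \<oplus>\<^bsub>coinduced R G\<^esub> t \<odot>\<^bsub>coinduced R G\<^esub> f"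
      by (rule ext[OF smult[OF f st(1)] add[OF smult[OF f s] smult[OF f t]]])
        (simp add: coinduced_simps(2-) s t R.r_distr a[OF f])
    show "(s \<otimes>\<^bsub>R\<^esub> t) \<odot>\<^bsub>coinduced R G\<^esub> f = s \<odot>\<^bsub>coinduced R G\<^esub> (t \<odot>\<^bsub>coinduced R G\<^esub> f)"
      by (rule ext[OF smult[OF f st(2)] smult[OF smult[OF f t] s]])
        (simp add: coinduced_simps(2-) s t R.m_assoc)
  qed
qed

text \<open>
  For an ideal \<open>I\<close> of \<open>R\<close>, evaluation at 1 identifies the \<open>R\<close>-linear maps from \<open>I\<close> to
  \<open>Hom_\<int>(R, G)\<close> with the additive maps from \<open>I\<close> to \<open>G\<close>, and these extend to \<open>R\<close>.
\<close>

lemma coinduced_baer: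
  assumes "cring R" "abelian_group G" and G: "baer \<Z> (int_module G)"
  shows "baer R (coinduced R G)"
proof -
  interpret R: cring R by fact
  interpret G: abelian_group G by fact
  interpret C: module R "coinduced R G" by (rule coinduced_module) fact+
  show ?thesis
    unfolding baer_def
  proof (intro conjI allI impI C.module_axioms)
    fix I h assume I: "ideal I R" and h: "h \<in> I \<rightarrow> carrier (coinduced R G)"
      "\<forall>r\<in>I. \<forall>s\<in>I. h (r \<oplus>\<^bsub>R\<^esub> s) = h r \<oplus>\<^bsub>coinduced R G\<^esub> h s"
      "\<forall>r\<in>carrier R. \<forall>s\<in>I. h (r \<otimes>\<^bsub>R\<^esub> s) = r \<odot>\<^bsub>coinduced R G\<^esub> h s"
    interpret I: ideal I R by fact
    interpret J: module R "ideal_module R I" by (rule R.ideal_module[OF I])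
    have "\<exists>g \<in> mod_hom \<Z> (int_module R) (int_module G).
        \<forall>r \<in> carrier (int_module (ideal_module R I)). g ((\<lambda>r. r) r) = (\<lambda>r. h r \<one>\<^bsub>R\<^esub>) r"
    proof (rule baer_extend)
      show "module \<Z> (int_module G)" using G by (simp add: baer_def)
      show "module \<Z> (int_module R)" by (rule R.int_module)
      show "module \<Z> (int_module (ideal_module R I))" by (rule J.M.int_module)
      show "(\<lambda>r. r) \<in> mod_hom \<Z> (int_module (ideal_module R I)) (int_module R)"
        by (rule additive_imp_int_hom[OF J.M.abelian_group_axioms R.abelian_group_axioms])
          (auto simp: ideal_module_def I.Icarr)
      show "(\<lambda>r. h r \<one>\<^bsub>R\<^esub>) \<in> mod_hom \<Z> (int_module (ideal_module R I)) (int_module G)"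
        by (rule additive_imp_int_hom[OF J.M.abelian_group_axioms G.abelian_group_axioms])
          (use h(1,2) in \<open>auto simp: ideal_module_def coinduced_simps Pi_iff\<close>)
    qed (use G in \<open>auto simp: baer_def\<close>)
    then obtain g where g: "g \<in> mod_hom \<Z> (int_module R) (int_module G)"
      and gh: "\<And>r. r \<in> I \<Longrightarrow> g r = h r \<one>\<^bsub>R\<^esub>" by (auto simp: ideal_module_def)
    define e where "e = restrict g (carrier R)"
    have e: "e \<in> carrier (coinduced R G)"
      using mod_homD(1,2)[OF g] by (auto simp: e_def coinduced_simps)
    have "h r = r \<odot>\<^bsub>coinduced R G\<^esub> e" if r: "r \<in> I" for r
    proof (rule PiE_ext)
      have "h r \<in> carrier (coinduced R G)" using h(1) r by blast
      then show "h r \<in> carrier R \<rightarrow>\<^sub>E carrier G" by (simp add: coinduced_simps)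
      show "r \<odot>\<^bsub>coinduced R G\<^esub> e \<in> carrier R \<rightarrow>\<^sub>E carrier G"
        using C.smult_closed[OF I.Icarr[OF r] e] by (simp add: coinduced_simps)
      fix s assume s: "s \<in> carrier R"
      have "h r s = (s \<odot>\<^bsub>coinduced R G\<^esub> h r) \<one>\<^bsub>R\<^esub>" using s by (simp add: coinduced_simps)
      also have "\<dots> = g (s \<otimes>\<^bsub>R\<^esub> r)" using h(3) r s gh I.I_l_closed by simp
      also have "\<dots> = (r \<odot>\<^bsub>coinduced R G\<^esub> e) s" using s I.Icarr[OF r] by (simp add: coinduced_simps e_def)
      finally show "h r s = (r \<odot>\<^bsub>coinduced R G\<^esub> e) s" .
    qed
    then show "\<exists>e\<in>carrier (coinduced R G). \<forall>r\<in>I. h r = r \<odot>\<^bsub>coinduced R G\<^esub> e" using e by blast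
  qed
qed

subsection \<open>Divisible hulls\<close>

text \<open>
  A quotient group is carried by a set of chosen representatives rather than by cosets: passing to
  sets would raise the cardinality of the underlying type.
\<close>

definition coset_rep :: "'f::ab_group_add set \<Rightarrow> 'f \<Rightarrow> 'f"
  where "coset_rep K f = (SOME g. g - f \<in> K)"

definition rep_group :: "'f::ab_group_add set \<Rightarrow> 'f ring"
  where "rep_group K = \<lparr>carrier = range (coset_rep K), monoid.mult = undefined, monoid.one = undefined,
    ring.zero = coset_rep K 0, ring.add = (\<lambda>f g. coset_rep K (f + g))\<rparr>"

context
  fixes K :: "'f::ab_group_add set"
  assumes K0: "0 \<in> K" and Kd: "\<And>f g. f \<in> K \<Longrightarrow> g \<in> K \<Longrightarrow> f - g \<in> K"
begin

lemma K_add_closed: "f \<in> K \<Longrightarrow> g \<in> K \<Longrightarrow> f + g \<in> K"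
  using Kd[OF _ Kd[OF K0], of f g] by simp

lemma coset_rep_diff: "coset_rep K f - f \<in> K"
  unfolding coset_rep_def by (rule someI[of _ f]) (simp add: K0)

lemma coset_rep_eq_iff: "coset_rep K f = coset_rep K g \<longleftrightarrow> f - g \<in> K"
proof
  assume "coset_rep K f = coset_rep K g"
  then show "f - g \<in> K" using Kd[OF coset_rep_diff[of g] coset_rep_diff[of f]] by simp
next
  assume fg: "f - g \<in> K"
  have "h - f \<in> K \<longleftrightarrow> h - g \<in> K" for h
    using K_add_closed[OF _ fg, of "h - f"] Kd[OF _ fg, of "h - g"] by auto
  then show "coset_rep K f = coset_rep K g" by (simp add: coset_rep_def)
qed

lemma coset_rep_add: "coset_rep K (coset_rep K f + g) = coset_rep K (f + g)"
  "coset_rep K (f + coset_rep K g) = coset_rep K (f + g)"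
  using coset_rep_diff[of f] coset_rep_diff[of g] by (simp_all add: coset_rep_eq_iff)

lemma coset_rep_idem: "coset_rep K (coset_rep K f) = coset_rep K f"
  using coset_rep_add(1)[of f 0] by simp

lemma rep_group_hom: "coset_rep K f \<oplus>\<^bsub>rep_group K\<^esub> coset_rep K g = coset_rep K (f + g)"
  by (simp add: rep_group_def coset_rep_add)

lemma rep_group_zero_iff: "coset_rep K f = \<zero>\<^bsub>rep_group K\<^esub> \<longleftrightarrow> f \<in> K"
  by (simp add: rep_group_def coset_rep_eq_iff)

lemma rep_group_carrier: "coset_rep K f \<in> carrier (rep_group K)"
  by (simp add: rep_group_def)

lemma rep_group_abelian: "abelian_group (rep_group K)"
proof (rule abelian_groupI)
  fix x assume "x \<in> carrier (rep_group K)"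
  then obtain f where "x = coset_rep K f" by (auto simp: rep_group_def)
  then show "\<exists>y\<in>carrier (rep_group K). y \<oplus>\<^bsub>rep_group K\<^esub> x = \<zero>\<^bsub>rep_group K\<^esub>"
    using rep_group_hom[of "- f" f] rep_group_zero_iff[of 0] K0
    by (intro bexI[of _ "coset_rep K (- f)"]) (auto simp: rep_group_carrier)
qed (auto simp: rep_group_def coset_rep_add coset_rep_idem ac_simps)

lemma rep_group_divisible:
  assumes div: "\<And>f (n::nat). 0 < n \<Longrightarrow> \<exists>g::'f. (\<Sum>i<n. g) = f"
    and x: "x \<in> carrier (rep_group K)" and n: "0 < (n::int)"
  shows "\<exists>y \<in> carrier (rep_group K). add_pow (rep_group K) n y = x"
proof -
  interpret abelian_group "rep_group K" by (rule rep_group_abelian)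
  have pow: "add_pow (rep_group K) k (coset_rep K f) = coset_rep K (\<Sum>i<k. f)" for k :: nat and f
  proof (induction k)
    case 0
    then show ?case by (simp add: rep_group_def add_pow_def)
  next
    case (Suc k)
    then show ?case by (simp add: rep_group_hom)
  qed
  obtain f where f: "x = coset_rep K f" using x by (auto simp: rep_group_def)
  obtain g where g: "(\<Sum>i<nat n. g) = f" using div[of "nat n"] n by auto
  have "add_pow (rep_group K) n (coset_rep K g) = add_pow (rep_group K) (nat n) (coset_rep K g)"
    using n by (simp add: add_pow_int_ge)
  also have "\<dots> = x" by (simp only: pow g f)
  finally have "add_pow (rep_group K) n (coset_rep K g) = x" .
  then show ?thesis by (auto simp: rep_group_def)
qed

end

lemma poly_mapping_divisible:
  fixes n :: nat and f :: "'x \<Rightarrow>\<^sub>0 rat"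
  assumes "0 < n"
  shows "\<exists>g. (\<Sum>i<n. g) = f"
proof
  show "(\<Sum>i<n. Poly_Mapping.map ((*) (1 / of_nat n)) f) = f"
    by (rule poly_mapping_eqI) (use assms in \<open>simp add: lookup_sum Poly_Mapping.map.rep_eq when_def\<close>)
qed

context abelian_group begin

text \<open>
  The divisible group that contains \<open>G / B\<close> is a quotient of the group of finite rational
  combinations of elements of \<open>G\<close>.  The integral combinations form the free abelian group on \<open>G\<close>, which
  maps onto \<open>G\<close> by evaluation, and those with value in \<open>B\<close> make up the kernel of its map to \<open>G / B\<close>.
  Dividing the divisible group of rational combinations by this kernel, one keeps \<open>G / B\<close> as a
  subgroup.
\<close>

definition int_comb :: "('a \<Rightarrow>\<^sub>0 rat) \<Rightarrow> bool"
  where "int_comb f \<longleftrightarrow> Poly_Mapping.keys f \<subseteq> carrier G \<and> (\<forall>k. Poly_Mapping.lookup f k \<in> \<int>)"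

definition comb_value :: "('a \<Rightarrow>\<^sub>0 rat) \<Rightarrow> 'a"
  where "comb_value f = (\<Oplus>k\<in>Poly_Mapping.keys f. add_pow G \<lfloor>Poly_Mapping.lookup f k\<rfloor> k)"

lemma comb_value_superset:
  assumes "finite A" "A \<subseteq> carrier G" "Poly_Mapping.keys f \<subseteq> A"
  shows "comb_value f = (\<Oplus>k\<in>A. add_pow G \<lfloor>Poly_Mapping.lookup f k\<rfloor> k)"
  unfolding comb_value_def
proof (rule add.finprod_mono_neutral_cong_left[OF assms(1,3)])
  fix k assume "k \<in> A - Poly_Mapping.keys f"
  then have "Poly_Mapping.lookup f k = 0" by (simp add: in_keys_iff)
  then show "add_pow G \<lfloor>Poly_Mapping.lookup f k\<rfloor> k = \<zero>" by (simp add: add_pow_def)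
qed (use assms in auto)

lemma comb_value_closed: "int_comb f \<Longrightarrow> comb_value f \<in> carrier G"
  unfolding comb_value_def int_comb_def by (intro finsum_closed) auto

lemma int_comb_diff:
  assumes f: "int_comb f" and g: "int_comb g"
  shows "int_comb (f - g)" "comb_value (f - g) = comb_value f \<ominus> comb_value g"
proof -
  have "Poly_Mapping.keys (f - g) \<subseteq> Poly_Mapping.keys f \<union> Poly_Mapping.keys g" by (auto simp: in_keys_iff lookup_minus)
  then show fg: "int_comb (f - g)" using f g by (auto simp: int_comb_def lookup_minus)
  define A where "A = Poly_Mapping.keys f \<union> Poly_Mapping.keys g"
  have A: "finite A" "A \<subseteq> carrier G" "Poly_Mapping.keys f \<subseteq> A" "Poly_Mapping.keys g \<subseteq> A" "Poly_Mapping.keys (f - g) \<subseteq> A"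
    using f g \<open>Poly_Mapping.keys (f - g) \<subseteq> Poly_Mapping.keys f \<union> Poly_Mapping.keys g\<close> by (auto simp: A_def int_comb_def)
  have "comb_value (f - g) \<oplus> comb_value g =
      (\<Oplus>k\<in>A. add_pow G \<lfloor>Poly_Mapping.lookup (f - g) k\<rfloor> k \<oplus> add_pow G \<lfloor>Poly_Mapping.lookup g k\<rfloor> k)"
    unfolding comb_value_superset[OF A(1,2,4)] comb_value_superset[OF A(1,2,5)]
    by (rule finsum_addf[symmetric]) (use A in auto)
  also have "\<dots> = (\<Oplus>k\<in>A. add_pow G \<lfloor>Poly_Mapping.lookup f k\<rfloor> k)"
  proof (rule finsum_cong')
    fix k assume "k \<in> A"
    then have k: "k \<in> carrier G" using A by blast
    obtain m n :: int where "Poly_Mapping.lookup f k = of_int m" "Poly_Mapping.lookup g k = of_int n"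
      using f g unfolding int_comb_def by (metis Ints_cases)
    then have "\<lfloor>Poly_Mapping.lookup (f - g) k\<rfloor> + \<lfloor>Poly_Mapping.lookup g k\<rfloor> = \<lfloor>Poly_Mapping.lookup f k\<rfloor>" by (simp add: lookup_minus)
    then show "add_pow G \<lfloor>Poly_Mapping.lookup (f - g) k\<rfloor> k \<oplus> add_pow G \<lfloor>Poly_Mapping.lookup g k\<rfloor> k = add_pow G \<lfloor>Poly_Mapping.lookup f k\<rfloor> k"
      using add.int_pow_mult[OF k, of "\<lfloor>Poly_Mapping.lookup (f - g) k\<rfloor>" "\<lfloor>Poly_Mapping.lookup g k\<rfloor>"] by simp
  qed (use A in auto)
  also have "\<dots> = comb_value f" by (rule comb_value_superset[OF A(1,2,3), symmetric])
  finally have "comb_value f = comb_value (f - g) \<oplus> comb_value g" by simp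
  then show "comb_value (f - g) = comb_value f \<ominus> comb_value g"
    using comb_value_closed[OF f] comb_value_closed[OF g] comb_value_closed[OF fg]
    by (simp add: minus_eq a_assoc r_neg)
qed

lemma int_comb_single:
  assumes "x \<in> carrier G"
  shows "int_comb (Poly_Mapping.single x 1)" "comb_value (Poly_Mapping.single x 1) = x"
  using assms by (auto simp: int_comb_def comb_value_def lookup_single when_def)

definition hull_kernel :: "'a set \<Rightarrow> ('a \<Rightarrow>\<^sub>0 rat) set"
  where "hull_kernel B = {f. int_comb f \<and> comb_value f \<in> B}"

lemma hull_kernel_subgroup:
  assumes "subgroup B (add_monoid G)"
  shows "0 \<in> hull_kernel B" "f \<in> hull_kernel B \<Longrightarrow> g \<in> hull_kernel B \<Longrightarrow> f - g \<in> hull_kernel B"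
proof -
  interpret B: additive_subgroup B G using assms by (rule additive_subgroupI)
  show "0 \<in> hull_kernel B" by (simp add: hull_kernel_def int_comb_def comb_value_def)
  show "f - g \<in> hull_kernel B" if "f \<in> hull_kernel B" "g \<in> hull_kernel B"
    using that int_comb_diff[of f g] by (auto simp: hull_kernel_def minus_eq)
qed

lemma divisible_hull:
  assumes B: "subgroup B (add_monoid G)"
  shows "\<exists>(H :: ('a \<Rightarrow>\<^sub>0 rat) ring) j. abelian_group H \<and> baer \<Z> (int_module H) \<and>
    j \<in> carrier G \<rightarrow> carrier H \<and> (\<forall>x \<in> carrier G. \<forall>y \<in> carrier G. j (x \<oplus> y) = j x \<oplus>\<^bsub>H\<^esub> j y) \<and>
    (\<forall>x \<in> carrier G. j x = \<zero>\<^bsub>H\<^esub> \<longleftrightarrow> x \<in> B)"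
proof -
  note K = hull_kernel_subgroup[OF B]
  define H where "H = rep_group (hull_kernel B)"
  define j where "j x = coset_rep (hull_kernel B) (Poly_Mapping.single x 1)" for x
  have H: "abelian_group H" unfolding H_def by (rule rep_group_abelian[OF K])
  have "baer \<Z> (int_module H)"
    by (rule divisible_imp_baer[OF H])
      (use rep_group_divisible[OF K poly_mapping_divisible] in \<open>simp add: H_def\<close>)
  moreover have "j (x \<oplus> y) = j x \<oplus>\<^bsub>H\<^esub> j y" if x: "x \<in> carrier G" and y: "y \<in> carrier G" for x y
  proof -
    let ?s = "\<lambda>x. Poly_Mapping.single x (1 :: rat)"
    have xy: "x \<oplus> y \<in> carrier G" using x y by simp
    note 1 = int_comb_diff[OF int_comb_single(1)[OF xy] int_comb_single(1)[OF x]]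
    note 2 = int_comb_diff[OF 1(1) int_comb_single(1)[OF y]]
    have "comb_value (?s (x \<oplus> y) - ?s x - ?s y) = x \<oplus> y \<ominus> x \<ominus> y"
      using x y xy by (simp add: 2 1 int_comb_single)
    also have "\<dots> = (x \<oplus> y) \<oplus> \<ominus> (x \<oplus> y)" using x y by (simp add: minus_eq minus_add a_assoc)
    also have "\<dots> = \<zero>" using xy by (rule r_neg)
    finally have "?s (x \<oplus> y) - ?s x - ?s y \<in> hull_kernel B"
      using 2(1) subgroup.one_closed[OF B] by (simp add: hull_kernel_def)
    then show ?thesis
      by (simp add: j_def H_def rep_group_hom[OF K] coset_rep_eq_iff[OF K] diff_diff_eq)
  qed
  moreover have "j x = \<zero>\<^bsub>H\<^esub> \<longleftrightarrow> x \<in> B" if "x \<in> carrier G" for x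
    using int_comb_single[OF that]
    by (simp add: j_def H_def rep_group_zero_iff[OF K]) (simp add: hull_kernel_def)
  moreover have "j \<in> carrier G \<rightarrow> carrier H" by (auto simp: j_def H_def rep_group_carrier[OF K])
  ultimately show ?thesis using H by blast
qed

end

text \<open>
  The map \<open>x \<mapsto> (r \<mapsto> r x)\<close> from \<open>M\<close> to \<open>Hom_\<int>(R, H)\<close>, where \<open>H\<close> is a divisible group containing
  \<open>M / B\<close>.
\<close>

lemma (in module) embed_quotient_coinduced:
  assumes B: "submodule B R M"
  shows "\<exists>(E :: ('a, 'a \<Rightarrow> 'c \<Rightarrow>\<^sub>0 rat) module) f. baer R E \<and> f \<in> mod_hom R M E \<and>
    (\<forall>x \<in> carrier M. f x = \<zero>\<^bsub>E\<^esub> \<longleftrightarrow> x \<in> B)"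
proof -
  obtain H :: "('c \<Rightarrow>\<^sub>0 rat) ring" and j where H: "abelian_group H" "baer \<Z> (int_module H)"
    and jc: "j \<in> carrier M \<rightarrow> carrier H"
    and ja: "\<And>x y. x \<in> carrier M \<Longrightarrow> y \<in> carrier M \<Longrightarrow> j (x \<oplus>\<^bsub>M\<^esub> y) = j x \<oplus>\<^bsub>H\<^esub> j y"
    and j0: "\<And>x. x \<in> carrier M \<Longrightarrow> j x = \<zero>\<^bsub>H\<^esub> \<longleftrightarrow> x \<in> B"
    using M.divisible_hull[OF submodule.axioms(1)[OF B]] by blast
  define f where "f x = (\<lambda>r\<in>carrier R. j (r \<odot>\<^bsub>M\<^esub> x))" for x
  have "f \<in> mod_hom R M (coinduced R H)"
  proof (rule mod_homI)
    fix x assume x: "x \<in> carrier M"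
    show "f x \<in> carrier (coinduced R H)"
      using x jc by (auto simp: f_def coinduced_simps smult_l_distr ja)
    show "f (r \<odot>\<^bsub>M\<^esub> x) = r \<odot>\<^bsub>coinduced R H\<^esub> f x" if "r \<in> carrier R" for r
      using x that by (auto simp: f_def coinduced_simps smult_assoc1 fun_eq_iff restrict_def)
    fix y assume y: "y \<in> carrier M"
    show "f (x \<oplus>\<^bsub>M\<^esub> y) = f x \<oplus>\<^bsub>coinduced R H\<^esub> f y"
      using x y by (auto simp: f_def coinduced_simps smult_r_distr ja fun_eq_iff restrict_def)
  qed
  moreover have "f x = \<zero>\<^bsub>coinduced R H\<^esub> \<longleftrightarrow> x \<in> B" if x: "x \<in> carrier M" for x
  proof
    assume "f x = \<zero>\<^bsub>coinduced R H\<^esub>"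
    then have "f x \<one> = \<zero>\<^bsub>coinduced R H\<^esub> \<one>" by simp
    then show "x \<in> B" using x j0 by (simp add: f_def coinduced_simps)
  next
    assume "x \<in> B"
    then have "j (r \<odot>\<^bsub>M\<^esub> x) = \<zero>\<^bsub>H\<^esub>" if "r \<in> carrier R" for r
      using submodule.smult_closed[OF B that] j0[of "r \<odot>\<^bsub>M\<^esub> x"] that x by simp
    then show "f x = \<zero>\<^bsub>coinduced R H\<^esub>" by (auto simp: f_def coinduced_simps fun_eq_iff)
  qed
  ultimately show ?thesis using coinduced_baer[OF R.cring_axioms H] by blast
qed

subsection \<open>Change of the underlying type\<close>

definition image_module :: "('x \<Rightarrow> 'c) \<Rightarrow> ('a, 'x, 'm) module_scheme \<Rightarrow> ('a, 'c) module"
  where "image_module u M = (let v = the_inv_into (carrier M) u in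
    \<lparr>carrier = u ` carrier M, monoid.mult = undefined, monoid.one = undefined, ring.zero = u \<zero>\<^bsub>M\<^esub>,
     ring.add = (\<lambda>x y. u (v x \<oplus>\<^bsub>M\<^esub> v y)), smult = (\<lambda>r x. u (r \<odot>\<^bsub>M\<^esub> v x))\<rparr>)"

lemma image_module_simps:
  assumes "inj_on u (carrier M)"
  shows "carrier (image_module u M) = u ` carrier M" "\<zero>\<^bsub>image_module u M\<^esub> = u \<zero>\<^bsub>M\<^esub>"
    "x \<in> carrier M \<Longrightarrow> y \<in> carrier M \<Longrightarrow> u x \<oplus>\<^bsub>image_module u M\<^esub> u y = u (x \<oplus>\<^bsub>M\<^esub> y)"
    "x \<in> carrier M \<Longrightarrow> r \<odot>\<^bsub>image_module u M\<^esub> u x = u (r \<odot>\<^bsub>M\<^esub> x)"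
  by (simp_all add: image_module_def Let_def the_inv_into_f_f[OF assms])

lemma image_module_baer:
  assumes M: "baer R M" and u: "inj_on u (carrier M)"
  shows "baer R (image_module u M)"
proof -
  interpret M: module R M using M by (simp add: baer_def)
  note S = image_module_simps[OF u]
  have "abelian_group (image_module u M)"
  proof (rule abelian_groupI)
    fix x assume "x \<in> carrier (image_module u M)"
    then obtain a where a: "a \<in> carrier M" "x = u a" by (auto simp: S)
    then show "\<exists>y\<in>carrier (image_module u M). y \<oplus>\<^bsub>image_module u M\<^esub> x = \<zero>\<^bsub>image_module u M\<^esub>"
      by (intro bexI[of _ "u (\<ominus>\<^bsub>M\<^esub> a)"]) (auto simp: S M.M.l_neg)
  qed (auto simp: S M.M.a_ac)
  then have mod: "module R (image_module u M)"
    by (rule moduleI[OF M.R.cring_axioms])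
      (auto simp: S M.smult_l_distr M.smult_r_distr M.smult_assoc1)
  define v where "v = the_inv_into (carrier M) u"
  have v: "v x \<in> carrier M" "u (v x) = x" if "x \<in> carrier (image_module u M)" for x
    using that the_inv_into_f_f[OF u] by (auto simp: v_def S)
  have vu: "v (u a) = a" if "a \<in> carrier M" for a using the_inv_into_f_f[OF u that] by (simp add: v_def)
  show ?thesis
    unfolding baer_def
  proof (intro conjI allI impI mod)
    fix I h assume I: "ideal I R" and h: "h \<in> I \<rightarrow> carrier (image_module u M)"
      "\<forall>r\<in>I. \<forall>s\<in>I. h (r \<oplus>\<^bsub>R\<^esub> s) = h r \<oplus>\<^bsub>image_module u M\<^esub> h s"
      "\<forall>r\<in>carrier R. \<forall>s\<in>I. h (r \<otimes>\<^bsub>R\<^esub> s) = r \<odot>\<^bsub>image_module u M\<^esub> h s"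
    obtain e where e: "e \<in> carrier M" "\<And>r. r \<in> I \<Longrightarrow> v (h r) = r \<odot>\<^bsub>M\<^esub> e"
    proof (rule baerE[OF M I, of "\<lambda>r. v (h r)"])
      show "v (h r) \<in> carrier M" if "r \<in> I" for r using v h(1) that by auto
      show "v (h (r \<oplus>\<^bsub>R\<^esub> s)) = v (h r) \<oplus>\<^bsub>M\<^esub> v (h s)" if "r \<in> I" "s \<in> I" for r s
      proof -
        have c: "h r \<in> carrier (image_module u M)" "h s \<in> carrier (image_module u M)" using h(1) that by auto
        have "h (r \<oplus>\<^bsub>R\<^esub> s) = u (v (h r)) \<oplus>\<^bsub>image_module u M\<^esub> u (v (h s))" using h(2) that c v by simp
        also have "\<dots> = u (v (h r) \<oplus>\<^bsub>M\<^esub> v (h s))" using c v(1) by (simp add: S)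
        finally show ?thesis using vu c v(1) by simp
      qed
      show "v (h (r \<otimes>\<^bsub>R\<^esub> s)) = r \<odot>\<^bsub>M\<^esub> v (h s)" if "r \<in> carrier R" "s \<in> I" for r s
      proof -
        have c: "h s \<in> carrier (image_module u M)" using h(1) that by auto
        have "h (r \<otimes>\<^bsub>R\<^esub> s) = r \<odot>\<^bsub>image_module u M\<^esub> u (v (h s))" using h(3) that c v by simp
        also have "\<dots> = u (r \<odot>\<^bsub>M\<^esub> v (h s))" using c v(1) by (simp add: S)
        finally show ?thesis using vu c v(1) that by simp
      qed
    qed blast
    have "h r = r \<odot>\<^bsub>image_module u M\<^esub> u e" if "r \<in> I" for r
    proof -
      have "h r \<in> carrier (image_module u M)" using h(1) that by blast
      from v(2)[OF this] show ?thesis using e(2)[OF that] by (simp add: S(4)[OF e(1)])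
    qed
    then show "\<exists>e\<in>carrier (image_module u M). \<forall>r\<in>I. h r = r \<odot>\<^bsub>image_module u M\<^esub> e"
      using e(1) by (auto simp: S(1))
  qed
qed

lemma image_module_hom:
  assumes "inj_on u (carrier M)"
  shows "u \<in> mod_hom R M (image_module u M)"
  by (rule mod_homI) (simp_all add: image_module_simps[OF assms])

subsection \<open>Room for injective modules\<close>

text \<open>
  A list of sets of words becomes a single set of words: a word of the \<open>i\<close>-th set is stored behind
  the prefix \<open>a\<^sup>i b\<close>, and the only word without \<open>b\<close> records the length of the list.
\<close>

definition encode_list :: "'l \<Rightarrow> 'l \<Rightarrow> 'l list set list \<Rightarrow> 'l list set"
  where "encode_list a b xs =
    insert (replicate (length xs) a) {replicate i a @ b # l | i l. i < length xs \<and> l \<in> xs ! i}"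

lemma encode_list_inj:
  assumes ab: "a \<noteq> b"
  shows "inj (encode_list a b)"
proof (rule injI)
  have marker: "replicate i a @ b # l = replicate k a @ b # l' \<Longrightarrow> i = k \<and> l = l'" for i k l l'
  proof (induction i arbitrary: k)
    case 0
    then show ?case using ab by (cases k) auto
  next
    case (Suc i)
    then show ?case using ab by (cases k) auto
  qed
  have pure: "replicate k a \<noteq> replicate i a @ b # l" for k i l
    using ab by (metis in_set_conv_decomp in_set_replicate)
  have len: "replicate k a \<in> encode_list a b xs \<longleftrightarrow> k = length xs" for k xs
    using pure by (auto simp: encode_list_def)
  have elem: "replicate i a @ b # l \<in> encode_list a b xs \<longleftrightarrow> i < length xs \<and> l \<in> xs ! i" for i l xs
  proof -
    have "replicate i a @ b # l \<in> encode_list a b xs \<longleftrightarrow>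
        (\<exists>i' l'. replicate i a @ b # l = replicate i' a @ b # l' \<and> i' < length xs \<and> l' \<in> xs ! i')"
      by (simp add: encode_list_def pure[symmetric])
    then show ?thesis using marker by blast
  qed
  fix xs ys assume eq: "encode_list a b xs = encode_list a b ys"
  have l: "length xs = length ys" using len[of "length xs" xs] len[of "length xs" ys] eq by simp
  show "xs = ys"
  proof (rule nth_equalityI[OF l])
    fix i assume "i < length xs"
    then show "xs ! i = ys ! i" using elem[of i _ xs] elem[of i _ ys] eq l by auto
  qed
qed

text \<open>
  The type \<^typ>\<open>('a, 'b) res\<close> has the cardinality \<open>2\<^sup>\<kappa>\<close>, where \<open>\<kappa>\<close> is infinite and bounds the
  cardinality of \<^typ>\<open>'a\<close>.  A finitely supported function is determined by a finite list of pairs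
  in this type, so there are at most \<open>2\<^sup>\<kappa>\<close> of them; the functions from \<^typ>\<open>'a\<close> to a set of this size
  are again at most \<open>2\<^sup>\<kappa>\<close> many.  The explicit injection prefixes the code of the value at \<open>r\<close> by the
  letter \<open>r\<close>.
\<close>

lemma function_room:
  fixes \<iota> :: "'x \<Rightarrow> ('a, 'b) res"
  assumes \<iota>: "inj \<iota>"
  shows "\<exists>u :: ('a \<Rightarrow> 'x \<Rightarrow>\<^sub>0 rat) \<Rightarrow> ('a, 'b) res. inj u"
proof -
  define enc where "enc = encode_list (Inl undefined :: 'a + 'b) (Inr undefined)"
  have enc: "inj enc" unfolding enc_def by (rule encode_list_inj) simp
  define q where "q c = enc (replicate (to_nat c) {})" for c :: rat
  have q: "inj q"
    by (rule injI) (metis enc injD inj_to_nat length_replicate q_def)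
  define pr where "pr = (\<lambda>(x, c). enc [\<iota> x, q c])"
  have pr: "inj pr" by (auto intro!: injI simp: pr_def inj_eq[OF enc] inj_eq[OF q] inj_eq[OF \<iota>])
  define fl where "fl f = (SOME xs. set xs = (\<lambda>k. (k, Poly_Mapping.lookup f k)) ` Poly_Mapping.keys f)" for f :: "'x \<Rightarrow>\<^sub>0 rat"
  have fl: "set (fl f) = (\<lambda>k. (k, Poly_Mapping.lookup f k)) ` Poly_Mapping.keys f" for f
    unfolding fl_def by (rule someI_ex) (simp add: finite_list)
  have inj_fl: "inj fl"
  proof (rule injI)
    fix f g assume "fl f = fl g"
    then have eq: "(\<lambda>k. (k, Poly_Mapping.lookup f k)) ` Poly_Mapping.keys f = (\<lambda>k. (k, Poly_Mapping.lookup g k)) ` Poly_Mapping.keys g" using fl by metis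
    show "f = g"
    proof (rule poly_mapping_eqI)
      fix k
      show "Poly_Mapping.lookup f k = Poly_Mapping.lookup g k"
        using eq by (cases "k \<in> Poly_Mapping.keys f"; cases "k \<in> Poly_Mapping.keys g") (auto simp: in_keys_iff set_eq_iff image_iff)
    qed
  qed
  define w where "w f = enc (map pr (fl f))" for f
  have w: "inj w"
    by (rule injI) (metis enc inj_fl injD inj_map pr w_def)
  define u where "u f = {Inl r # l | r l. l \<in> w (f r)}" for f :: "'a \<Rightarrow> 'x \<Rightarrow>\<^sub>0 rat"
  have "inj u"
  proof (rule injI)
    fix f g assume eq: "u f = u g"
    have "l \<in> w (f r) \<longleftrightarrow> Inl r # l \<in> u f" for f r l by (simp add: u_def)
    then have "w (f r) = w (g r)" for r using eq by blast
    then show "f = g" using w by (auto simp: inj_def fun_eq_iff)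
  qed
  then show ?thesis by blast
qed

lemma (in module) embed_quotient:
  fixes \<iota> :: "'c \<Rightarrow> ('a, 'x) res"
  assumes "inj \<iota>" and "submodule B R M"
  shows "\<exists>(E :: ('a, ('a, 'x) res) module) f. baer R E \<and> f \<in> mod_hom R M E \<and>
    (\<forall>x \<in> carrier M. f x = \<zero>\<^bsub>E\<^esub> \<longleftrightarrow> x \<in> B)"
proof -
  obtain E :: "('a, 'a \<Rightarrow> 'c \<Rightarrow>\<^sub>0 rat) module" and f where E: "baer R E" and f: "f \<in> mod_hom R M E"
    and f0: "\<And>x. x \<in> carrier M \<Longrightarrow> f x = \<zero>\<^bsub>E\<^esub> \<longleftrightarrow> x \<in> B"
    using embed_quotient_coinduced[OF assms(2)] by blast
  obtain u :: "('a \<Rightarrow> 'c \<Rightarrow>\<^sub>0 rat) \<Rightarrow> ('a, 'x) res" where u: "inj u"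
    using function_room[OF assms(1)] by blast
  have uE: "inj_on u (carrier E)" using u by (rule inj_on_subset) simp
  have "u (f x) = \<zero>\<^bsub>image_module u E\<^esub> \<longleftrightarrow> x \<in> B" if "x \<in> carrier M" for x
    using f0[OF that] u by (simp add: image_module_simps[OF uE] inj_eq)
  then show ?thesis
    using image_module_baer[OF E uE] mod_hom_comp[OF f image_module_hom[OF uE]] by blast
qed

lemma mod_hom_image_submodule:
  assumes "module R M" "module R N" "f \<in> mod_hom R M N"
  shows "submodule (f ` carrier M) R N"
proof -
  interpret M: module R M by fact
  interpret N: module R N by fact
  note f = mod_homD[OF assms(3)]
  show ?thesis
  proof (rule N.submoduleI)
    show "\<zero>\<^bsub>N\<^esub> \<in> f ` carrier M"
      using mod_hom_zero[OF assms] by (metis M.M.zero_closed imageI)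
    fix a assume "a \<in> f ` carrier M"
    then obtain x where x: "x \<in> carrier M" "a = f x" by blast
    show "\<ominus>\<^bsub>N\<^esub> a \<in> f ` carrier M"
      using mod_hom_minus[OF assms M.M.zero_closed x(1)] mod_hom_zero[OF assms] x f(1)
      by (intro image_eqI[of _ _ "\<zero>\<^bsub>M\<^esub> \<ominus>\<^bsub>M\<^esub> x"]) (auto simp: N.M.minus_eq)
    show "r \<odot>\<^bsub>N\<^esub> a \<in> f ` carrier M" if "r \<in> carrier R" for r
      using x that f(3) by (intro image_eqI[of _ _ "r \<odot>\<^bsub>M\<^esub> x"]) auto
    fix b assume "b \<in> f ` carrier M"
    then obtain y where y: "y \<in> carrier M" "b = f y" by blast
    show "a \<oplus>\<^bsub>N\<^esub> b \<in> f ` carrier M"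
      using x y f(2) by (intro image_eqI[of _ _ "x \<oplus>\<^bsub>M\<^esub> y"]) auto
  qed (use f(1) in blast)
qed

text \<open>
  At each stage the resolution is known up to a module \<open>E\<close> together with the submodule \<open>B\<close> that has to
  become the kernel of the next differential, namely the image of the previous one.  As
  \<open>embed_quotient\<close> embeds \<open>E / B\<close> into an injective module on the same type, no cokernel is formed.
\<close>

theorem injective_resolution_exists:
  fixes R :: "('a, 'r) ring_scheme" and X :: "('a, 'b, 'm) module_scheme"
  assumes X: "module R X"
  shows "\<exists>(E :: nat \<Rightarrow> ('a, ('a, 'b) res) module) d. injective_resolution R X E d"
proof -
  interpret X: module R X by fact
  have "inj (\<lambda>x. {[Inr x]} :: ('a, 'b) res)" by (rule injI) simp
  moreover have "submodule {\<zero>\<^bsub>X\<^esub>} R X"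
    by (rule X.submoduleI) (auto simp: X.neg_zero)
  ultimately obtain E0 :: "('a, ('a, 'b) res) module" and \<eta> where E0: "baer R E0"
    and \<eta>: "\<eta> \<in> mod_hom R X E0" and \<eta>0: "\<And>x. x \<in> carrier X \<Longrightarrow> \<eta> x = \<zero>\<^bsub>E0\<^esub> \<longleftrightarrow> x = \<zero>\<^bsub>X\<^esub>"
    using X.embed_quotient[of "\<lambda>x. {[Inr x]}" "{\<zero>\<^bsub>X\<^esub>}"] by auto
  define P where "P n EB \<longleftrightarrow> baer R (fst EB) \<and> submodule (snd EB) R (fst EB) \<and>
    (n = 0 \<longrightarrow> EB = (E0, \<eta> ` carrier X))" for n :: nat and EB :: "('a, ('a, 'b) res) module \<times> ('a, 'b) res set"
  define Q where "Q n EB EB' \<longleftrightarrow> (\<exists>f \<in> mod_hom R (fst EB) (fst EB').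
    (\<forall>x \<in> carrier (fst EB). f x = \<zero>\<^bsub>fst EB'\<^esub> \<longleftrightarrow> x \<in> snd EB) \<and> snd EB' = f ` carrier (fst EB))"
    for n :: nat and EB EB' :: "('a, ('a, 'b) res) module \<times> ('a, 'b) res set"
  have "\<exists>s. \<forall>n. P n (s n) \<and> Q n (s n) (s (Suc n))"
  proof (rule dependent_nat_choice)
    have "submodule (\<eta> ` carrier X) R E0"
      by (rule mod_hom_image_submodule[OF X _ \<eta>]) (use E0 in \<open>simp add: baer_def\<close>)
    then show "\<exists>EB. P 0 EB" using E0 by (auto simp: P_def)
    fix EB and n :: nat assume P: "P n EB"
    obtain E B where EB: "EB = (E, B)" by (cases EB)
    interpret E: module R E using P by (simp add: P_def EB baer_def)
    obtain E' :: "('a, ('a, 'b) res) module" and f where E': "baer R E'" and f: "f \<in> mod_hom R E E'"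
      and f0: "\<And>x. x \<in> carrier E \<Longrightarrow> f x = \<zero>\<^bsub>E'\<^esub> \<longleftrightarrow> x \<in> B"
      using E.embed_quotient[of "\<lambda>x. x" B] P by (auto simp: P_def EB)
    have "submodule (f ` carrier E) R E'"
      by (rule mod_hom_image_submodule[OF E.module_axioms _ f]) (use E' in \<open>simp add: baer_def\<close>)
    then have "P (Suc n) (E', f ` carrier E) \<and> Q n EB (E', f ` carrier E)"
      using E' f f0 by (auto simp: P_def Q_def EB)
    then show "\<exists>EB'. P (Suc n) EB' \<and> Q n EB EB'" by blast
  qed
  then obtain s where s: "\<And>n. P n (s n)" "\<And>n. Q n (s n) (s (Suc n))" by blast
  define E where "E n = fst (s n)" for n
  define B where "B n = snd (s n)" for n
  have "\<exists>d. \<forall>n. d n \<in> mod_hom R (E n) (E (Suc n)) \<and>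
      (\<forall>x \<in> carrier (E n). d n x = \<zero>\<^bsub>E (Suc n)\<^esub> \<longleftrightarrow> x \<in> B n) \<and> B (Suc n) = d n ` carrier (E n)"
  proof (rule choice, rule allI)
    fix n
    show "\<exists>f. f \<in> mod_hom R (E n) (E (Suc n)) \<and>
        (\<forall>x \<in> carrier (E n). f x = \<zero>\<^bsub>E (Suc n)\<^esub> \<longleftrightarrow> x \<in> B n) \<and> B (Suc n) = f ` carrier (E n)"
      using s(2)[of n] unfolding Q_def E_def B_def Bex_def .
  qed
  then obtain d where D: "\<forall>n. d n \<in> mod_hom R (E n) (E (Suc n)) \<and>
      (\<forall>x \<in> carrier (E n). d n x = \<zero>\<^bsub>E (Suc n)\<^esub> \<longleftrightarrow> x \<in> B n) \<and> B (Suc n) = d n ` carrier (E n)" ..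
  have d: "d n \<in> mod_hom R (E n) (E (Suc n))"
    and d0: "x \<in> carrier (E n) \<Longrightarrow> d n x = \<zero>\<^bsub>E (Suc n)\<^esub> \<longleftrightarrow> x \<in> B n"
    and dB: "B (Suc n) = d n ` carrier (E n)" for n x
    using D[rule_format, of n] by auto
  have baer: "baer R (E n)" for n using s(1)[of n] by (simp add: P_def E_def)
  have EB0: "E 0 = E0" "B 0 = \<eta> ` carrier X" using s(1)[of 0] by (simp_all add: P_def E_def B_def)
  have BE: "B n \<subseteq> carrier (E n)" for n
  proof -
    have "module R (E n)" using baer[of n] by (simp add: baer_def)
    moreover have "submodule (B n) R (E n)" using s(1)[of n] by (simp add: P_def E_def B_def)
    ultimately show ?thesis by (rule module.submoduleE(1))
  qed
  have ker: "B n = a_kernel (E n) (E (Suc n)) (d n)" for n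
  proof (intro equalityI subsetI)
    show "x \<in> a_kernel (E n) (E (Suc n)) (d n)" if "x \<in> B n" for x
      using that BE[of n] d0[of x n] by (auto simp: a_kernel_def' kernel_def)
    show "x \<in> B n" if "x \<in> a_kernel (E n) (E (Suc n)) (d n)" for x
      using that d0[of x n] by (simp add: a_kernel_def' kernel_def)
  qed
  have E0m: "module R E0" using E0 by (simp add: baer_def)
  interpret E0: module R E0 by (rule E0m)
  have "inj_on \<eta> (carrier X)"
  proof (rule inj_onI)
    fix x y assume xy: "x \<in> carrier X" "y \<in> carrier X" "\<eta> x = \<eta> y"
    then have "\<eta> (x \<ominus>\<^bsub>X\<^esub> y) = \<zero>\<^bsub>E0\<^esub>"
      using mod_hom_minus[OF X E0m \<eta>] mod_homD(1)[OF \<eta>] by (simp add: E0.minus_eq_zero_iff)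
    then show "x = y" using \<eta>0[of "x \<ominus>\<^bsub>X\<^esub> y"] X.minus_eq_zero_iff xy by simp
  qed
  then have "\<exists>\<eta>\<in>mod_hom R X (E 0). inj_on \<eta> (carrier X) \<and> \<eta> ` carrier X = a_kernel (E 0) (E 1) (d 0)"
    using \<eta> EB0 ker[of 0] by auto
  then have "injective_resolution R X E d"
    unfolding injective_resolution_def using baer_imp_injective[OF baer] d dB ker by simp
  then show ?thesis by blast
qed

section \<open>Local cohomology\<close>

lemma inj_on_ring_into_res: "inj_on (\<lambda>r. {[Inl r]} :: ('a, 'b) res) A"
  by (rule inj_onI) simp

lemma injective_resolution_baer:
  fixes E :: "nat \<Rightarrow> ('a, ('a, 'b) res) module"
  assumes "injective_resolution R X E d"
  shows "baer R (E n)"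
proof (rule injective_imp_baer[OF _ inj_on_ring_into_res])
  show "injective_module R (E n)" using assms by (simp add: injective_resolution_def)
qed

lemma injective_resolution_cochain:
  assumes "injective_resolution R X E d"
  shows "cochain R E d"
proof (rule cochain.intro)
  show "module R (E n)" "d n \<in> mod_hom R (E n) (E (Suc n))" for n
    using assms by (auto simp: injective_resolution_def injective_module_def)
  fix n v assume "v \<in> carrier (E n)"
  then have "d n v \<in> a_kernel (E (Suc n)) (E (Suc (Suc n))) (d (Suc n))"
    using assms unfolding injective_resolution_def by blast
  then show "d (Suc n) (d n v) = \<zero>\<^bsub>E (Suc (Suc n))\<^esub>" by (simp add: a_kernel_def' kernel_def)
qed

lemma injective_resolution_exact:
  assumes "injective_resolution R X E d" "0 < i"
  shows "exact_at E d i"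
  using assms by (cases i) (auto simp: exact_at_def cocycles_def coboundaries_Suc injective_resolution_def)

text \<open>
  The augmentation identifies \<open>M / H\<close> with the cohomology of its resolution in degree 0.
\<close>

lemma resolution_corr:
  assumes "module_pair R M H" and E: "injective_resolution R (quot_module M H) E d"
  shows "\<exists>\<sigma>. quot_corr R M H (cocycle_module E d 0) (coboundaries E d 0) \<sigma>"
proof -
  interpret M: module_pair R M H by fact
  interpret E: cochain R E d using E by (rule injective_resolution_cochain)
  obtain \<eta> where \<eta>: "\<eta> \<in> mod_hom R (quot_module M H) (E 0)" "inj_on \<eta> (carrier (quot_module M H))"
    and ker: "\<eta> ` carrier (quot_module M H) = cocycles E d 0"
    using E by (auto simp: injective_resolution_def cocycles_def)
  note h = mod_homD[OF \<eta>(1)]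
  have zero: "\<eta> \<zero>\<^bsub>quot_module M H\<^esub> = \<zero>\<^bsub>E 0\<^esub>"
    by (rule mod_hom_zero[OF M.quot_is_module E.mod \<eta>(1)])
  define \<sigma> where "\<sigma> = (\<lambda>x. (x, \<eta> (H +>\<^bsub>M\<^esub> x))) ` carrier M"
  have "quot_corr R M H (cocycle_module E d 0) (coboundaries E d 0) \<sigma>"
    unfolding quot_corr_def
  proof (intro conjI ballI allI impI)
    show "\<sigma> \<subseteq> carrier M \<times> carrier (cocycle_module E d 0)"
      using ker M.quot_carrierI by (auto simp: \<sigma>_def cocycle_module_def)
    show "\<exists>y. (x, y) \<in> \<sigma>" if "x \<in> carrier M" for x using that by (auto simp: \<sigma>_def)
    show "\<exists>x. (x, y) \<in> \<sigma>" if "y \<in> carrier (cocycle_module E d 0)" for y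
      using that by (auto simp: \<sigma>_def cocycle_module_def ker[symmetric] M.quot_carrier)
    fix x y assume "(x, y) \<in> \<sigma>"
    then have x: "x \<in> carrier M" "y = \<eta> (H +>\<^bsub>M\<^esub> x)" by (auto simp: \<sigma>_def)
    note xq = M.quot_carrierI[OF x(1)]
    show "x \<in> H \<longleftrightarrow> y \<in> coboundaries E d 0"
      using x inj_onD[OF \<eta>(2), of "H +>\<^bsub>M\<^esub> x" "\<zero>\<^bsub>quot_module M H\<^esub>"] xq M.quot_eq_zero_iff[OF x(1)] zero
        M.quot_carrierI[OF M.M.zero_closed] M.quot_zero_coset
      by (auto simp: coboundaries_0 M.quot_zero)
    show "(r \<odot>\<^bsub>M\<^esub> x, r \<odot>\<^bsub>cocycle_module E d 0\<^esub> y) \<in> \<sigma>" if "r \<in> carrier R" for r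
      using x that h(3)[OF that xq] by (auto simp: \<sigma>_def cocycle_module_def M.quot_smult)
    fix x' y' assume "(x', y') \<in> \<sigma>"
    then have x': "x' \<in> carrier M" "y' = \<eta> (H +>\<^bsub>M\<^esub> x')" by (auto simp: \<sigma>_def)
    show "(x \<oplus>\<^bsub>M\<^esub> x', y \<oplus>\<^bsub>cocycle_module E d 0\<^esub> y') \<in> \<sigma>"
      using x x' h(2)[OF xq M.quot_carrierI[OF x'(1)]] by (auto simp: \<sigma>_def cocycle_module_def M.quot_add)
  qed
  then show ?thesis by blast
qed

lemma local_cohomology_eq:
  assumes "the_injective_resolution R X = (E, d)"
    and "\<And>n. torsion_part R I (E n) = tors R S (E n)"
  shows "local_cohomology R I i X = quot_module (cocycle_module (tors_complex R S E) d i)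
    (coboundaries (tors_complex R S E) d i)"
  using assms by (simp add: local_cohomology_def cohomology_eq_quot[symmetric] torsion_functor_def tors_complex_def)

lemma the_injective_resolution_resolves:
  fixes X :: "('a, 'b, 'm) module_scheme"
  assumes "module R X" "the_injective_resolution R X = (E, d)"
  shows "injective_resolution R X E d"
proof -
  obtain E0 :: "nat \<Rightarrow> ('a, ('a, 'b) res) module" and d0 where "injective_resolution R X E0 d0"
    using injective_resolution_exists[OF assms(1)] by blast
  then have "case (E0, d0) of (E, d) \<Rightarrow> injective_resolution R X E d" by simp
  then have "case the_injective_resolution R X of (E, d) \<Rightarrow> injective_resolution R X E d"
    unfolding the_injective_resolution_def by (rule someI)
  then show ?thesis using assms(2) by simp
qed

text \<open>
  In a noetherian ring finitely many generators of the ideal are candidates, so that the minimum in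
  the definition of the arithmetic rank is attained.
\<close>

lemma arith_rank_witness:
  assumes "noetherian_ring R" "ideal I R"
  obtains xs where "length xs = arith_rank R I" "set xs \<subseteq> carrier R"
    "ideal_radical R I = ideal_radical R (genideal R (set xs))"
proof -
  interpret noetherian_ring R by fact
  obtain A where A: "A \<subseteq> carrier R" "finite A" "I = genideal R A" using finetely_gen[OF assms(2)] by blast
  then obtain ys where "set ys = A" using finite_list by blast
  then have "\<exists>n xs. length xs = n \<and> set xs \<subseteq> carrier R \<and>
      ideal_radical R I = ideal_radical R (genideal R (set xs))" using A by blast
  from LeastI_ex[OF this] show thesis using that unfolding arith_rank_def by blast
qed

text \<open>
  The bound has to be positive, since \<open>Sup {} = 0\<close>.
\<close>

lemma Sup_eq_bound_iff:
  fixes V :: "nat set"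
  assumes "\<And>i. i \<in> V \<Longrightarrow> i \<le> n" "0 < n"
  shows "Sup V = n \<longleftrightarrow> n \<in> V"
proof (cases "V = {}")
  case False
  have "finite V" using assms(1) by (meson finite_nat_set_iff_bounded_le)
  then have "Sup V = Max V" using False by (simp add: cSup_eq_Max)
  then show ?thesis using \<open>finite V\<close> False assms(1) by (metis Max_eqI Max_in)
qed (use assms in \<open>simp add: Sup_nat_def\<close>)

text \<open>
  Some bound \<open>n\<close> has to be known in advance: the supremum of an unbounded set of natural numbers
  says nothing about its elements.
\<close>

lemma cohomological_dim_bounds:
  assumes "\<And>i. n < i \<Longrightarrow> carrier (local_cohomology R I i X) = {\<zero>\<^bsub>local_cohomology R I i X\<^esub>}"
    and "cohomological_dim R I X < i"
  shows "carrier (local_cohomology R I i X) = {\<zero>\<^bsub>local_cohomology R I i X\<^esub>}"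
proof (rule ccontr)
  let ?V = "{i. carrier (local_cohomology R I i X) \<noteq> {\<zero>\<^bsub>local_cohomology R I i X\<^esub>}}"
  assume "carrier (local_cohomology R I i X) \<noteq> {\<zero>\<^bsub>local_cohomology R I i X\<^esub>}"
  then have "i \<in> ?V" by simp
  moreover have "\<And>j. j \<in> ?V \<Longrightarrow> j \<le> n" using assms(1) by (force simp: not_less[symmetric])
  then have "bdd_above ?V" by (rule bdd_aboveI)
  ultimately have "i \<le> Sup ?V" by (rule cSup_upper)
  then show False using assms(2) by (simp add: cohomological_dim_def)
qed

lemma mod_iso_trivial:
  assumes "module R M" "module R N" "mod_iso R M N"
  shows "carrier M = {\<zero>\<^bsub>M\<^esub>} \<longleftrightarrow> carrier N = {\<zero>\<^bsub>N\<^esub>}"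
proof -
  interpret M: module R M by fact
  interpret N: module R N by fact
  obtain f where f: "f \<in> mod_hom R M N" "bij_betw f (carrier M) (carrier N)"
    using assms(3) by (auto simp: mod_iso_def)
  have f0: "f \<zero>\<^bsub>M\<^esub> = \<zero>\<^bsub>N\<^esub>" by (rule mod_hom_zero[OF assms(1,2) f(1)])
  have im: "f ` carrier M = carrier N" and inj: "inj_on f (carrier M)"
    using f(2) by (auto simp: bij_betw_def)
  show ?thesis
  proof
    assume "carrier M = {\<zero>\<^bsub>M\<^esub>}"
    then show "carrier N = {\<zero>\<^bsub>N\<^esub>}" using im f0 by auto
  next
    assume N0: "carrier N = {\<zero>\<^bsub>N\<^esub>}"
    have "x = \<zero>\<^bsub>M\<^esub>" if "x \<in> carrier M" for x
    proof -
      have "f x \<in> carrier N" using im that by blast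
      then show ?thesis using inj_onD[OF inj _ that M.zero_closed] N0 f0 by simp
    qed
    then show "carrier M = {\<zero>\<^bsub>M\<^esub>}" using M.zero_closed by blast
  qed
qed

theorem corollary2p7:
  fixes R :: "('a, 'r) ring_scheme" and X :: "('a, 'b, 'm) module_scheme"
  assumes "cring R" and "noetherian_ring R"
    and "ideal \<aa> R" and "\<aa> \<noteq> carrier R"
    and "ideal \<bb> R"
    and "module R X" and "carrier X \<noteq> {\<zero>\<^bsub>X\<^esub>}"
  shows "mod_iso R
           (local_cohomology R (\<aa> <+>\<^bsub>R\<^esub> \<bb>)
              (arith_rank R \<aa> + cohomological_dim R \<bb> X) X)
           (local_cohomology R \<aa> (arith_rank R \<aa>)
              (local_cohomology R \<bb> (cohomological_dim R \<bb> X) X))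
       \<and> (cohomological_dim R (\<aa> <+>\<^bsub>R\<^esub> \<bb>) X
            = arith_rank R \<aa> + cohomological_dim R \<bb> X
          \<longleftrightarrow>
          arith_rank R \<aa>
            = cohomological_dim R \<aa> (local_cohomology R \<bb> (cohomological_dim R \<bb> X) X))"
proof -
  interpret R: cring R by fact
  interpret noetherian_ring R by fact
  define c where "c = cohomological_dim R \<bb> X"
  define n where "n = arith_rank R \<aa>"
  obtain xs where xs: "length xs = n" "set xs \<subseteq> carrier R"
    and rad_xs: "ideal_radical R \<aa> = ideal_radical R (genideal R (set xs))"
    using arith_rank_witness[OF assms(2,3)] unfolding n_def by metis
  obtain A where A: "A \<subseteq> carrier R" "finite A" "\<aa> = genideal R A"
    using finetely_gen[OF assms(3)] by blast
  obtain B where B: "B \<subseteq> carrier R" "finite B" "\<bb> = genideal R B"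
    using finetely_gen[OF assms(5)] by blast
  obtain ys where ys: "set ys = B" using finite_list B(2) by blast
  have tors_A: "torsion_part R \<aa> M = tors R (set xs) M"
    and tors_B: "torsion_part R \<bb> M = tors R B M"
    and tors_AB: "torsion_part R (\<aa> <+>\<^bsub>R\<^esub> \<bb>) M = tors R (B \<union> set xs) M"
    if "module R M" for M :: "('a, 'y) module"
  proof -
    interpret M: module R M by fact
    have AX: "tors R A M = tors R (set xs) M"
      using M.tors_mono_radical[of A "set xs"] M.tors_mono_radical[of "set xs" A] A xs(2) rad_xs by auto
    then show "torsion_part R \<aa> M = tors R (set xs) M" using M.torsion_part_genideal A by simp
    show "torsion_part R \<bb> M = tors R B M" using M.torsion_part_genideal B by simp
    have "\<aa> <+>\<^bsub>R\<^esub> \<bb> = genideal R (A \<union> B)"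
      unfolding R.union_genideal[OF assms(3,5), symmetric]
    proof (rule antisym)
      show "genideal R (\<aa> \<union> \<bb>) \<subseteq> genideal R (A \<union> B)"
      proof -
        have AB: "A \<union> B \<subseteq> carrier R" using A(1) B(1) by blast
        have "\<aa> \<subseteq> genideal R (A \<union> B)" "\<bb> \<subseteq> genideal R (A \<union> B)"
          unfolding A(3) B(3)
          by (rule R.genideal_minimal[OF R.genideal_ideal[OF AB]]; use R.genideal_self[OF AB] in blast)+
        then show ?thesis by (intro R.genideal_minimal R.genideal_ideal[OF AB]) blast
      qed
      show "genideal R (A \<union> B) \<subseteq> genideal R (\<aa> \<union> \<bb>)"
      proof (intro R.genideal_minimal R.genideal_ideal)
        have ab: "\<aa> \<union> \<bb> \<subseteq> carrier R" using assms(3,5) ideal.Icarr by fast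
        then show "\<aa> \<union> \<bb> \<subseteq> carrier R" .
        show "A \<union> B \<subseteq> genideal R (\<aa> \<union> \<bb>)"
          using R.genideal_self[OF A(1)] R.genideal_self[OF B(1)] R.genideal_self[OF ab] A(3) B(3) by blast
      qed
    qed
    then have "torsion_part R (\<aa> <+>\<^bsub>R\<^esub> \<bb>) M = tors R (A \<union> B) M" using M.torsion_part_genideal A B by simp
    also have "\<dots> = tors R (B \<union> set xs) M" using AX by (auto simp: tors_Un)
    finally show "torsion_part R (\<aa> <+>\<^bsub>R\<^esub> \<bb>) M = tors R (B \<union> set xs) M" .
  qed
  obtain E d where Ed: "the_injective_resolution R X = (E, d)" by fastforce
  have resX: "injective_resolution R X E d" by (rule the_injective_resolution_resolves[OF assms(6) Ed])
  interpret E: cochain R E d using resX by (rule injective_resolution_cochain)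
  have baerE: "baer R (E i)" for i using resX by (rule injective_resolution_baer)
  interpret EB: cochain R "tors_complex R B E" d by (rule E.tors_cochain[OF B(1)])
  interpret EAB: cochain R "tors_complex R (B \<union> set xs) E" d using E.tors_cochain[of "B \<union> set xs"] B xs by simp
  let ?HB = "\<lambda>i. quot_module (cocycle_module (tors_complex R B E) d i) (coboundaries (tors_complex R B E) d i)"
  let ?HAB = "\<lambda>i. quot_module (cocycle_module (tors_complex R (B \<union> set xs) E) d i)
    (coboundaries (tors_complex R (B \<union> set xs) E) d i)"
  have HB: "local_cohomology R \<bb> i X = ?HB i" for i
    by (rule local_cohomology_eq[OF Ed tors_B[OF E.mod]])
  have HAB: "local_cohomology R (\<aa> <+>\<^bsub>R\<^esub> \<bb>) i X = ?HAB i" for i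
    by (rule local_cohomology_eq[OF Ed tors_AB[OF E.mod]])
  have trivial: "carrier (quot_module (cocycle_module C d' i) (coboundaries C d' i)) =
      {\<zero>\<^bsub>quot_module (cocycle_module C d' i) (coboundaries C d' i)\<^esub>} \<longleftrightarrow> exact_at C d' i"
    if "cochain R C d'" for C :: "nat \<Rightarrow> ('a, 'y) module" and d' i
    using module_pair.quot_trivial_iff[OF cochain.cocycle_module_pair[OF that]]
    by (simp add: exact_at_def cocycle_module_def)
  have exB: "exact_at (tors_complex R B E) d i" if "c < i" for i
  proof -
    \<comment> \<open>the resolution itself is exact in positive degrees, and the finitely many generators of \<open>\<bb>\<close> give a bound\<close>
    have "exact_at (tors_complex R ({} \<union> set ys) E) d i" if "length ys < i" for i
      by (rule exact_at_tors_above[OF assms(2) E.cochain_axioms baerE, where c = 0])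
        (use that ys B injective_resolution_exact[OF resX] in \<open>auto simp: tors_complex_empty\<close>)
    then have "carrier (local_cohomology R \<bb> i X) = {\<zero>\<^bsub>local_cohomology R \<bb> i X\<^esub>}"
      using cohomological_dim_bounds[of "length ys" R \<bb> X i] \<open>c < i\<close>
      by (simp add: HB trivial[OF EB.cochain_axioms] ys c_def)
    then show ?thesis by (simp add: HB trivial[OF EB.cochain_axioms])
  qed
  have exAB: "exact_at (tors_complex R (B \<union> set xs) E) d i" if "n + c < i" for i
    by (rule exact_at_tors_above[OF assms(2) E.cochain_axioms baerE B(1) xs(2) exB])
      (use that xs in auto)
  define H where "H = local_cohomology R \<bb> c X"
  have H_mod: "module R H"
    unfolding H_def HB by (rule module_pair.quot_is_module[OF EB.cocycle_module_pair])
  obtain E' d' where Ed': "the_injective_resolution R H = (E', d')" by fastforce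
  have resH: "injective_resolution R H E' d'" by (rule the_injective_resolution_resolves[OF H_mod Ed'])
  interpret E': cochain R E' d' using resH by (rule injective_resolution_cochain)
  have baerE': "baer R (E' i)" for i using resH by (rule injective_resolution_baer)
  interpret EA: cochain R "tors_complex R (set xs) E'" d' by (rule E'.tors_cochain[OF xs(2)])
  let ?HA = "\<lambda>i. quot_module (cocycle_module (tors_complex R (set xs) E') d' i)
    (coboundaries (tors_complex R (set xs) E') d' i)"
  have HA: "local_cohomology R \<aa> i H = ?HA i" for i
    by (rule local_cohomology_eq[OF Ed' tors_A[OF E'.mod]])
  have exE': "exact_at (tors_complex R {} E') d' i" if "0 < i" for i
    using injective_resolution_exact[OF resH that] by (simp add: tors_complex_empty)
  have exA: "exact_at (tors_complex R (set xs) E') d' i" if "n < i" for i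
    using exact_at_tors_above[where S = "{}" and c = 0, OF assms(2) E'.cochain_axioms baerE' _ xs(2) exE'] that xs
    by simp
  obtain \<sigma> where \<sigma>: "quot_corr R (cocycle_module (tors_complex R B E) d c) (coboundaries (tors_complex R B E) d c)
      (cocycle_module (tors_complex R {} E') d' 0) (coboundaries (tors_complex R {} E') d' 0) \<sigma>"
    using resolution_corr[OF EB.cocycle_module_pair resH[unfolded H_def HB]] by (auto simp: tors_complex_empty)
  obtain \<tau> where \<tau>: "quot_corr R
      (cocycle_module (tors_complex R (B \<union> set xs) E) d (c + n))
      (coboundaries (tors_complex R (B \<union> set xs) E) d (c + n))
      (cocycle_module (tors_complex R (set xs) E') d' n)
      (coboundaries (tors_complex R (set xs) E') d' n) \<tau>"
    using cohomology_corr_tors_list[OF assms(2) E.cochain_axioms baerE E'.cochain_axioms baerE'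
        B(1) empty_subsetI xs(2) exB exE' \<sigma>] xs(1) by auto
  have iso: "mod_iso R (local_cohomology R (\<aa> <+>\<^bsub>R\<^esub> \<bb>) (n + c) X) (local_cohomology R \<aa> n H)"
    unfolding HAB HA add.commute[of n c]
    by (rule quot_corr_imp_mod_iso[OF EAB.cocycle_module_pair EA.cocycle_module_pair \<tau>])
  let ?V = "{i. carrier (local_cohomology R (\<aa> <+>\<^bsub>R\<^esub> \<bb>) i X) \<noteq> {\<zero>\<^bsub>local_cohomology R (\<aa> <+>\<^bsub>R\<^esub> \<bb>) i X\<^esub>}}"
  let ?W = "{i. carrier (local_cohomology R \<aa> i H) \<noteq> {\<zero>\<^bsub>local_cohomology R \<aa> i H\<^esub>}}"
  have V: "i \<le> n + c" if "i \<in> ?V" for i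
    by (rule ccontr) (use that exAB[of i] in \<open>simp add: HAB trivial[OF EAB.cochain_axioms]\<close>)
  have W: "i \<le> n" if "i \<in> ?W" for i
    by (rule ccontr) (use that exA[of i] in \<open>simp add: HA trivial[OF EA.cochain_axioms]\<close>)
  have VW: "n + c \<in> ?V \<longleftrightarrow> n \<in> ?W"
    using mod_iso_trivial[OF _ _ iso] module_pair.quot_is_module[OF EAB.cocycle_module_pair]
      module_pair.quot_is_module[OF EA.cocycle_module_pair] by (simp add: HAB HA)
  have "Sup ?V = n + c \<longleftrightarrow> n = Sup ?W"
  proof (cases "n = 0")
    case True
    have "?W \<subseteq> {0}" using W True by blast
    then have "Sup ?W = 0" unfolding subset_singleton_iff by (elim disjE) (simp_all only: Sup_nat_empty cSup_singleton)
    \<comment> \<open>here the list \<open>xs\<close> is empty, so \<open>\<aa> + \<bb>\<close> and \<open>\<bb>\<close> have the same torsion functor\<close>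
    moreover have "Sup ?V = c"
      using True xs(1) by (simp add: c_def cohomological_dim_def HAB HB)
    ultimately show ?thesis using True by (simp only: add_0 simp_thms)
  next
    case False
    then have pos: "0 < n" "0 < n + c" by auto
    have "Sup ?V = n + c \<longleftrightarrow> n + c \<in> ?V" by (rule Sup_eq_bound_iff[OF _ pos(2)]) (rule V)
    also have "\<dots> \<longleftrightarrow> n \<in> ?W" by (rule VW)
    also have "\<dots> \<longleftrightarrow> Sup ?W = n" by (rule Sup_eq_bound_iff[OF _ pos(1), symmetric]) (rule W)
    also have "\<dots> \<longleftrightarrow> n = Sup ?W" by (rule eq_commute)
    finally show ?thesis .
  qed
  then show ?thesis
    using iso unfolding cohomological_dim_def[of R "\<aa> <+>\<^bsub>R\<^esub> \<bb>"] cohomological_dim_def[of R \<aa>]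
    by (simp add: c_def n_def H_def)
qed

end
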